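(* Let $T>0$ and $c\in\mathbb{R}$. Let $g\colon [0,+\infty)\to[0,+\infty)$ be a continuous function such that $g(0)=0$ and $g(s)>0$ for all $s>0$. Suppose also that $g$ is regularly oscillating at zero and at infinity, and that $$\lim_{s\to 0^{+}}\frac{g(s)}{s}=0 \qquad\text{and}\qquad \lim_{s\to+\infty}\frac{g(s)}{s}=0.$$ Let $a\colon\mathbb{R}\to\mathbb{R}$ be a $T$-periodic function with $a^{\pm}\in L^{1}([0,T])$ and $a^{-}\not\equiv 0$ (that is, $\int_0^T a^-(t)\,dt>0$). Suppose also that there exists an interval $I\subseteq[0,T]$ such that $$\int_{I}a^{-}(t)\,dt=0<\int_{I}a^{+}(t)\,dt.$$ Then there exists $\lambda^{*}>0$ such that for each $\lambda>\lambda^{*}$ and for each $$\mu>\lambda\,\frac{\int_{0}^{T}a^{+}(t)\,dt}{\int_{0}^{T}a^{-}(t)\,dt}$$ the equation $$u''+cu'+\bigl(\lambda a^{+}(t)-\mu a^{-}(t)\bigr)g(u)=0$$ has at least two positive $T$-periodic solutions.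
   Context: Here $a^{+}(t):=\frac{a(t)+|a(t)|}{2}$ and $a^{-}(t):=\frac{-a(t)+|a(t)|}{2}$. A continuous function $h\colon(0,+\infty)\to(0,+\infty)$ is called regularly oscillating at zero if $\lim_{s\to0^{+},\,\omega\to1} h(\omega s)/h(s)=1$, and regularly oscillating at infinity if $\lim_{s\to+\infty,\,\omega\to1} h(\omega s)/h(s)=1$ (joint limits in $(s,\omega)$); for $g$ this is applied to the restriction of $g$ to $(0,+\infty)$. Solutions are meant in the Carathéodory sense: $u$ is continuously differentiable with $u'$ locally absolutely continuous, and the equation holds for almost every $t$. A positive $T$-periodic solution is a solution $u\colon\mathbb{R}\to\mathbb{R}$ with $u(t+T)=u(t)>0$ for all $t\in\mathbb{R}$. *)

theory Defs
  imports "HOL-Analysis.Analysis"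
begin

definition pos_part :: "(real \<Rightarrow> real) \<Rightarrow> real \<Rightarrow> real" where
  "pos_part a t = (a t + \<bar>a t\<bar>) / 2"

definition neg_part :: "(real \<Rightarrow> real) \<Rightarrow> real \<Rightarrow> real" where
  "neg_part a t = (- a t + \<bar>a t\<bar>) / 2"

(* Both notions concern the restriction of h to the open half-line; values of h at
   nonpositive arguments play no role. The product filter expresses the joint limit
   in (s, w). *)

definition regularly_oscillating_at_zero :: "(real \<Rightarrow> real) \<Rightarrow> bool" where
  "regularly_oscillating_at_zero h \<longleftrightarrow>
     continuous_on {0<..} h \<and> (\<forall>s>0. h s > 0) \<and>
     ((\<lambda>(s, w). h (w * s) / h s) \<longlongrightarrow> 1) (at_right 0 \<times>\<^sub>F at 1)"

definition regularly_oscillating_at_infinity :: "(real \<Rightarrow> real) \<Rightarrow> bool" where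
  "regularly_oscillating_at_infinity h \<longleftrightarrow>
     continuous_on {0<..} h \<and> (\<forall>s>0. h s > 0) \<and>
     ((\<lambda>(s, w). h (w * s) / h s) \<longlongrightarrow> 1) (at_top \<times>\<^sub>F at 1)"

(* Absolute continuity of a function on a compact interval; the measure-theoretic
   absolutely_continuous of HOL-Analysis is a relation between measures. *)

definition abs_continuous_on_interval :: "real \<Rightarrow> real \<Rightarrow> (real \<Rightarrow> real) \<Rightarrow> bool" where
  "abs_continuous_on_interval p q f \<longleftrightarrow>
     (\<forall>\<epsilon>>0. \<exists>\<delta>>0. \<forall>(n::nat) (x :: nat \<Rightarrow> real) (y :: nat \<Rightarrow> real).
        (\<forall>i<n. p \<le> x i \<and> x i \<le> y i \<and> y i \<le> q) \<and>
        disjoint_family_on (\<lambda>i. {x i<..<y i}) {..<n} \<and>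
        (\<Sum>i<n. y i - x i) < \<delta>
        \<longrightarrow> (\<Sum>i<n. \<bar>f (y i) - f (x i)\<bar>) < \<epsilon>)"

definition locally_abs_continuous :: "(real \<Rightarrow> real) \<Rightarrow> bool" where
  "locally_abs_continuous f \<longleftrightarrow> (\<forall>p q. p \<le> q \<longrightarrow> abs_continuous_on_interval p q f)"

(* Caratheodory solutions, on the whole line, of u'' + c u' + w(t) g(u) = 0.
   Here v is u', and d is u''(t). *)

definition caratheodory_solution ::
    "real \<Rightarrow> (real \<Rightarrow> real) \<Rightarrow> (real \<Rightarrow> real) \<Rightarrow> (real \<Rightarrow> real) \<Rightarrow> bool" where
  "caratheodory_solution c w g u \<longleftrightarrow>
     (\<exists>v. (\<forall>t. (u has_real_derivative v t) (at t)) \<and>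
          continuous_on UNIV v \<and>
          locally_abs_continuous v \<and>
          (AE t in lebesgue. \<exists>d. (v has_real_derivative d) (at t) \<and>
             d + c * v t + w t * g (u t) = 0))"

definition positive_periodic_solution ::
    "real \<Rightarrow> real \<Rightarrow> (real \<Rightarrow> real) \<Rightarrow> (real \<Rightarrow> real) \<Rightarrow> (real \<Rightarrow> real) \<Rightarrow> bool" where
  "positive_periodic_solution T c w g u \<longleftrightarrow>
     caratheodory_solution c w g u \<and> (\<forall>t. u (t + T) = u t \<and> u t > 0)"

end

theory Submission
  imports Defs "HOL-Complex_Analysis.Great_Picard"
begin

text \<open>Fix a point \<open>t\<^sub>0\<close> inside the interval on which the negative part of the weight vanishes. For a
continuous function \<open>u\<close> put \<open>s = u t\<^sub>0\<close> and consider the \<open>T\<close>-periodic problem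
\<open>u'' + c u' + w(t) g(u) + \<alpha> = 0\<close> with a constant \<open>\<alpha>\<close>. Integration over a period shows that \<open>\<alpha>\<close> is
necessarily minus the mean of \<open>w g(u)\<close>. With \<open>\<alpha>\<close> as an additional unknown the value \<open>s\<close> can be
prescribed; the solutions sought are those with \<open>\<alpha> = 0\<close>. The sign of \<open>\<alpha>\<close> is known at three places.

\<^item> For \<open>s\<close> close to \<open>0\<close> and for large \<open>s\<close>, sublinearity of \<open>g\<close> gives \<open>u / s \<rightarrow> 1\<close> uniformly;
  regular oscillation then gives \<open>g(u) / g(s) \<rightarrow> 1\<close>, so the mean of \<open>w g(u)\<close> has the sign of the
  mean of \<open>w\<close>, which is negative by the choice of \<open>\<mu>\<close>. Hence \<open>\<alpha> > 0\<close>
  (\<open>multiplier_positive\<close>).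
\<^item> For \<open>s = 1\<close> and \<open>\<lambda>\<close> large, \<open>\<alpha> < 0\<close>: otherwise \<open>exp (c t) * u'\<close> would be nonincreasing on the
  interval where \<open>w \<ge> 0\<close>, which keeps \<open>u\<close> between positive constants and \<open>u'\<close> bounded well inside it, and
  integration of the equation bounds \<open>\<lambda>\<close>. The bound involves neither \<open>\<mu>\<close> nor the weight outside
  this interval (\<open>multiplier_negative\<close>).

No degree theory is needed to pass from these signs to zeros of \<open>\<alpha>\<close>. On an interval
\<open>[s\<^sub>-, s\<^sub>+]\<close> of parameters the operator that sends \<open>u\<close> to the projection of \<open>s - \<sigma> \<alpha>\<close> onto
\<open>[s\<^sub>-, s\<^sub>+]\<close> plus the periodic response to \<open>w g(u)\<close> that vanishes at \<open>t\<^sub>0\<close> has a fixed point by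
Schauder's theorem (\<open>schauder_lipschitz\<close>, \<open>parameter_fixed_point\<close>). At a fixed point either
\<open>\<alpha> = 0\<close> or \<open>s\<close> is an end point and \<open>\<sigma> \<alpha>\<close> has a definite sign there. The choice \<open>\<sigma> = -1\<close> excludes
the end points between a small \<open>s\<close> and \<open>1\<close>, and \<open>\<sigma> = 1\<close> excludes them between \<open>1\<close> and a large \<open>s\<close>.
The two solutions obtained satisfy \<open>u\<^sub>1 t\<^sub>0 < 1 < u\<^sub>2 t\<^sub>0\<close>.

To make the operator bounded, \<open>g(u)\<close> is replaced by \<open>g\<close> of the truncation of \<open>u\<close> to \<open>[0, K s]\<close>. The
truncation is proportional to \<open>s\<close>, and solutions with \<open>\<alpha> = 0\<close> satisfy \<open>0 < u \<le> K s\<close> by concavity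
and a Gronwall estimate (\<open>a_priori_bounds\<close>), so it is inactive on them.\<close>

section \<open>Approximate fixed points and Schauder's theorem\<close>

text \<open>Vectors of varying dimension \<open>n\<close> are functions on the naturals of which only the first \<open>n\<close> values
matter. Kuhn's combinatorial lemma on a fine grid replaces Brouwer's theorem.\<close>

lemma kuhn_approximate_fixed_point:
  fixes F :: "(nat \<Rightarrow> real) \<Rightarrow> nat \<Rightarrow> real" and n :: nat and B e :: real
  assumes "B > 0" and "e > 0"
    and range: "\<And>x i. (\<forall>j<n. \<bar>x j\<bar> \<le> B) \<Longrightarrow> i < n \<Longrightarrow> \<bar>F x i\<bar> \<le> B"
    and uc: "\<And>e. e > 0 \<Longrightarrow> \<exists>d>0. \<forall>x y. (\<forall>j<n. \<bar>x j\<bar> \<le> B) \<longrightarrow> (\<forall>j<n. \<bar>y j\<bar> \<le> B) \<longrightarrow>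
              (\<forall>j<n. \<bar>x j - y j\<bar> \<le> d) \<longrightarrow> (\<forall>j<n. \<bar>F x j - F y j\<bar> \<le> e)"
  obtains x where "\<forall>j<n. \<bar>x j\<bar> \<le> B" and "\<forall>j<n. \<bar>F x j - x j\<bar> \<le> e"
proof -
  obtain d where d: "d > 0" and dF: "\<And>x y j. (\<forall>j<n. \<bar>x j\<bar> \<le> B) \<Longrightarrow> (\<forall>j<n. \<bar>y j\<bar> \<le> B) \<Longrightarrow>
              (\<forall>j<n. \<bar>x j - y j\<bar> \<le> d) \<Longrightarrow> j < n \<Longrightarrow> \<bar>F x j - F y j\<bar> \<le> e / 3"
    using uc[of "e / 3"] \<open>e > 0\<close> by (metis divide_pos_pos zero_less_numeral)
  obtain p :: nat where p: "real p > 2 * B / min d (e / 3)"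
    using reals_Archimedean2 by blast
  have pp: "real p > 0"
    using p assms(1,2) d by (smt (verit) divide_pos_pos)
  have step: "2 * B / p \<le> d" "2 * B / p \<le> e / 3"
  proof -
    have "2 * B / p \<le> min d (e / 3)"
    proof -
      have "2 * B < real p * min d (e / 3)"
        using p d \<open>e > 0\<close> by (simp add: pos_divide_less_eq)
      then have "2 * B / p < min d (e / 3)" using pp by (simp only: pos_divide_less_eq mult.commute)
      then show ?thesis by (rule less_imp_le)
    qed
    then show "2 * B / p \<le> d" "2 * B / p \<le> e / 3" by auto
  qed
  define P where "P k j = 2 * B * real (k j) / p - B" for k :: "nat \<Rightarrow> nat" and j
  have Pin: "\<forall>j<n. \<bar>P k j\<bar> \<le> B" if "\<forall>j<n. k j \<le> p" for k
  proof (intro allI impI)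
    fix j assume "j < n"
    then have "real (k j) / p \<le> 1" "0 \<le> real (k j) / p" using that pp by auto
    then have "2 * B * (real (k j) / p) \<le> 2 * B * 1" "0 \<le> 2 * B * (real (k j) / p)"
      using \<open>B > 0\<close> by (intro mult_left_mono mult_nonneg_nonneg; simp)+
    then show "\<bar>P k j\<bar> \<le> B" by (simp add: P_def)
  qed
  \<comment> \<open>Label \<open>1\<close> records that \<open>F\<close> does not increase the coordinate, label \<open>0\<close> that it does not
      decrease it; the two faces of the cube are labelled as Kuhn's lemma requires.\<close>
  define label where "label k i = (if k i = p \<or> (k i \<noteq> 0 \<and> F (P k) i < P k i) then 1 else (0::nat))"
    for k i
  have p0: "0 < p" using pp by simp
  obtain q where q: "\<forall>i<n. q i < p"
    and qq: "\<forall>i<n. \<exists>r s. (\<forall>j<n. q j \<le> r j \<and> r j \<le> q j + 1) \<and>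
                (\<forall>j<n. q j \<le> s j \<and> s j \<le> q j + 1) \<and> label r i \<noteq> label s i"
  proof (rule kuhn_lemma[of p n label])
    show "\<forall>x. (\<forall>i<n. x i \<le> p) \<longrightarrow> (\<forall>i<n. x i = 0 \<longrightarrow> label x i = 0)"
      using p0 by (simp add: label_def)
    show "\<forall>x. (\<forall>i<n. x i \<le> p) \<longrightarrow> (\<forall>i<n. x i = p \<longrightarrow> label x i = 1)"
      by (simp add: label_def)
    show "\<forall>x. (\<forall>i<n. x i \<le> p) \<longrightarrow> (\<forall>i<n. label x i = 0 \<or> label x i = 1)"
      by (simp add: label_def)
  qed ((use p0 that in blast)+)
  have lab1: "F (P k) i \<le> P k i" if "label k i = 1" "\<forall>j<n. k j \<le> p" "i < n" for k i
  proof (cases "k i = p")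
    case True
    then have "P k i = B" using pp by (simp add: P_def)
    then show ?thesis using range[OF Pin[OF that(2)] \<open>i < n\<close>] by simp
  next
    case False then show ?thesis using that by (auto simp: label_def split: if_splits)
  qed
  have lab0: "F (P k) i \<ge> P k i" if "label k i \<noteq> 1" "\<forall>j<n. k j \<le> p" "i < n" for k i
  proof (cases "k i = 0")
    case True
    then have "P k i = - B" using pp by (simp add: P_def)
    then show ?thesis using range[OF Pin[OF that(2)] \<open>i < n\<close>] by simp
  next
    case False then show ?thesis using that by (auto simp: label_def split: if_splits)
  qed
  have near: "\<forall>j<n. P q j \<le> P r j \<and> P r j \<le> P q j + 2 * B / p"
    if "\<forall>j<n. q j \<le> r j \<and> r j \<le> q j + 1" for r
  proof (intro allI impI)
    fix j assume "j < n"
    then have "real (q j) \<le> real (r j)" "real (r j) \<le> real (q j) + 1"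
      using that by (auto simp flip: of_nat_Suc)
    then have "2 * B / p * real (q j) \<le> 2 * B / p * real (r j)"
      "2 * B / p * real (r j) \<le> 2 * B / p * (real (q j) + 1)"
      using \<open>B > 0\<close> pp by (auto intro!: mult_left_mono simp del: times_divide_eq_left)
    then show "P q j \<le> P r j \<and> P r j \<le> P q j + 2 * B / p"
      by (simp add: P_def distrib_left)
  qed
  have qp: "\<forall>j<n. q j \<le> p" using q by auto
  have "\<bar>F (P q) i - P q i\<bar> \<le> e" if "i < n" for i
  proof -
    have *: "F (P q) i \<ge> P q i - e / 3 \<and> F (P q) i \<le> P q i + 2 * (e / 3)"
      if r: "\<forall>j<n. q j \<le> r j \<and> r j \<le> q j + 1" and s: "\<forall>j<n. q j \<le> s j \<and> s j \<le> q j + 1"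
        and lr: "label r i \<noteq> 1" and ls: "label s i = 1" for r s
    proof -
      have rp: "\<forall>j<n. r j \<le> p" and sp: "\<forall>j<n. s j \<le> p"
      proof -
        show "\<forall>j<n. r j \<le> p"
        proof (intro allI impI)
          fix j assume "j < n"
          then have "q j < p" "r j \<le> q j + 1" using q r by auto
          then show "r j \<le> p" by linarith
        qed
        show "\<forall>j<n. s j \<le> p"
        proof (intro allI impI)
          fix j assume "j < n"
          then have "q j < p" "s j \<le> q j + 1" using q s by auto
          then show "s j \<le> p" by linarith
        qed
      qed
      have "\<bar>F (P q) i - F (P r) i\<bar> \<le> e / 3"
        using near[OF r] step by (intro dF Pin qp rp \<open>i < n\<close>) fastforce
      moreover have "\<bar>F (P q) i - F (P s) i\<bar> \<le> e / 3"
        using near[OF s] step by (intro dF Pin qp sp \<open>i < n\<close>) fastforce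
      moreover have "F (P r) i \<ge> P r i" "F (P s) i \<le> P s i"
        using lab0[OF lr rp \<open>i < n\<close>] lab1[OF ls sp \<open>i < n\<close>] by auto
      moreover have "P r i \<ge> P q i" "P s i \<le> P q i + e / 3"
        using near[OF r] near[OF s] step(2) \<open>i < n\<close> by fastforce+
      ultimately show ?thesis by linarith
    qed
    obtain r s where rs: "\<forall>j<n. q j \<le> r j \<and> r j \<le> q j + 1" "\<forall>j<n. q j \<le> s j \<and> s j \<le> q j + 1"
      "label r i \<noteq> label s i" using qq \<open>i < n\<close> by blast
    have "(label r i \<noteq> 1 \<and> label s i = 1) \<or> (label s i \<noteq> 1 \<and> label r i = 1)"
      using rs(3) by (auto simp: label_def split: if_splits)
    then have "F (P q) i \<ge> P q i - e / 3 \<and> F (P q) i \<le> P q i + 2 * (e / 3)"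
      using *[OF rs(1,2)] *[OF rs(2,1)] by blast
    then show ?thesis using \<open>e > 0\<close> by (auto simp: abs_le_iff)
  qed
  then show thesis using that[of "P q"] Pin[OF qp] by blast
qed

text \<open>Schauder's theorem for an operator that maps the measurable functions bounded by \<open>B\<close> on \<open>[0, T]\<close>
into uniformly Lipschitz ones. Admitting measurable and not only continuous arguments allows step
functions as finite-dimensional approximations; the Lipschitz bound supplies the compactness.\<close>

lemma schauder_lipschitz:
  fixes \<Phi> :: "(real \<Rightarrow> real) \<Rightarrow> real \<Rightarrow> real" and T B L :: real
  assumes T: "T > 0" and B: "B > 0"
    and bound: "\<And>u t. u \<in> borel_measurable borel \<Longrightarrow> (\<forall>t\<in>{0..T}. \<bar>u t\<bar> \<le> B) \<Longrightarrow> t \<in> {0..T} \<Longrightarrow>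
                  \<bar>\<Phi> u t\<bar> \<le> B"
    and lip: "\<And>u t t'. u \<in> borel_measurable borel \<Longrightarrow> (\<forall>t\<in>{0..T}. \<bar>u t\<bar> \<le> B) \<Longrightarrow> t \<in> {0..T} \<Longrightarrow>
                  t' \<in> {0..T} \<Longrightarrow> \<bar>\<Phi> u t - \<Phi> u t'\<bar> \<le> L * \<bar>t - t'\<bar>"
    and uc: "\<And>e. e > 0 \<Longrightarrow> \<exists>d>0. \<forall>u v. u \<in> borel_measurable borel \<longrightarrow> (\<forall>t\<in>{0..T}. \<bar>u t\<bar> \<le> B) \<longrightarrow>
                  v \<in> borel_measurable borel \<longrightarrow> (\<forall>t\<in>{0..T}. \<bar>v t\<bar> \<le> B) \<longrightarrow>
                  (\<forall>t\<in>{0..T}. \<bar>u t - v t\<bar> \<le> d) \<longrightarrow> (\<forall>t\<in>{0..T}. \<bar>\<Phi> u t - \<Phi> v t\<bar> \<le> e)"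
  obtains u where "continuous_on UNIV u" and "\<forall>t\<in>{0..T}. \<bar>u t\<bar> \<le> B"
    and "\<forall>t\<in>{0..T}. \<Phi> u t = u t"
proof -
  define X where "X = {u. u \<in> borel_measurable borel \<and> (\<forall>t\<in>{0..T}. \<bar>u t\<bar> \<le> B)}"
  have uc': "\<exists>d>0. \<forall>u\<in>X. \<forall>v\<in>X. (\<forall>t\<in>{0..T}. \<bar>u t - v t\<bar> \<le> d) \<longrightarrow> (\<forall>t\<in>{0..T}. \<bar>\<Phi> u t - \<Phi> v t\<bar> \<le> e)"
    if "e > 0" for e
    using uc[OF that] by (auto simp: X_def)
  have boundX: "\<bar>\<Phi> u t\<bar> \<le> B" if "u \<in> X" "t \<in> {0..T}" for u t
    using bound that by (auto simp: X_def)
  have lipX: "\<bar>\<Phi> u t - \<Phi> u t'\<bar> \<le> L * \<bar>t - t'\<bar>" if "u \<in> X" "t \<in> {0..T}" "t' \<in> {0..T}" for u t t'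
    using lip that by (auto simp: X_def)
  define L' where "L' = max L 1"
  have L': "L' \<ge> 1" "\<And>x. L * \<bar>x\<bar> \<le> L' * \<bar>x\<bar>" by (auto simp: L'_def intro: mult_right_mono)
  \<comment> \<open>Step functions on a grid turn the operator into a map of a cube, whose approximate fixed
      points are approximate fixed points of the operator.\<close>
  have approx: "\<exists>u\<in>X. \<forall>t\<in>{0..T}. \<bar>\<Phi> u t - u t\<bar> \<le> e" if e: "e > 0" for e
  proof -
    obtain n :: nat where n: "real n > L' * T / (e / 2)" using reals_Archimedean2 by blast
    have n0: "real n > 0" using n e T L' by (smt (verit) divide_pos_pos mult_pos_pos)
    have mesh: "L' * (T / n) \<le> e / 2"
      using n n0 e by (simp add: field_simps)
    define idx where "idx t = min (n - 1) (nat \<lfloor>real n * t / T\<rfloor>)" for t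
    have idx: "idx t < n" for t using n0 by (auto simp: idx_def)
    have idxm: "idx \<in> borel \<rightarrow>\<^sub>M count_space UNIV" unfolding idx_def by measurable
    have close: "\<bar>t - T * idx t / n\<bar> \<le> T / n" if t: "t \<in> {0..T}" for t
    proof -
      define z where "z = real n * t / T"
      have z: "0 \<le> z" "z \<le> n" using t T n0 by (auto simp: z_def field_simps)
      have fz: "real (nat \<lfloor>z\<rfloor>) = of_int \<lfloor>z\<rfloor>" using z by simp
      have "real (idx t) \<le> z \<and> z \<le> real (idx t) + 1"
      proof (cases "nat \<lfloor>z\<rfloor> \<le> n - 1")
        case True
        then have "idx t = nat \<lfloor>z\<rfloor>" by (simp add: idx_def z_def min_def)
        then show ?thesis using fz by linarith
      next
        case False
        then have "idx t = n - 1" by (simp add: idx_def z_def min_def)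
        moreover have "real (n - 1) = real n - 1" using n0 by (simp add: of_nat_diff)
        moreover have "z \<ge> n - 1" using False fz n0 by linarith
        ultimately show ?thesis using z by linarith
      qed
      then have "\<bar>z - idx t\<bar> \<le> 1" by linarith
      then have "\<bar>T / n * (z - idx t)\<bar> \<le> T / n * 1"
        unfolding abs_mult using T n0 by (intro mult_mono) auto
      then show ?thesis using T n0 by (simp add: z_def right_diff_distrib)
    qed
    have node: "T * idx t / n \<in> {0..T}" for t
      using idx[of t] T n0 by (auto simp: field_simps)
    define st where "st x t = x (idx t)" for x :: "nat \<Rightarrow> real" and t
    have stX: "st x \<in> X" if "\<forall>j<n. \<bar>x j\<bar> \<le> B" for x
      using that idx measurable_compose[OF idxm, of x borel] by (auto simp: X_def st_def[abs_def])
    define F where "F x i = \<Phi> (st x) (T * real i / n)" for x i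
    have nodei: "T * real i / n \<in> {0..T}" if "i < n" for i
      using that T n0 by (auto simp: field_simps)
    obtain x where x: "\<forall>j<n. \<bar>x j\<bar> \<le> B" "\<forall>j<n. \<bar>F x j - x j\<bar> \<le> e / 2"
    proof (rule kuhn_approximate_fixed_point[of B "e / 2" n F])
      show "\<bar>F x i\<bar> \<le> B" if "\<forall>j<n. \<bar>x j\<bar> \<le> B" "i < n" for x i
        unfolding F_def using boundX stX[OF that(1)] nodei[OF that(2)] by blast
      show "\<exists>d>0. \<forall>x y. (\<forall>j<n. \<bar>x j\<bar> \<le> B) \<longrightarrow> (\<forall>j<n. \<bar>y j\<bar> \<le> B) \<longrightarrow>
              (\<forall>j<n. \<bar>x j - y j\<bar> \<le> d) \<longrightarrow> (\<forall>j<n. \<bar>F x j - F y j\<bar> \<le> e')" if e': "e' > 0" for e'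
      proof -
        obtain d where d: "d > 0" "\<forall>u\<in>X. \<forall>v\<in>X. (\<forall>t\<in>{0..T}. \<bar>u t - v t\<bar> \<le> d) \<longrightarrow>
            (\<forall>t\<in>{0..T}. \<bar>\<Phi> u t - \<Phi> v t\<bar> \<le> e')" using uc'[OF e'] by blast
        show ?thesis
        proof (intro exI[of _ d] conjI allI impI)
          fix x y j assume h: "\<forall>j<n. \<bar>x j\<bar> \<le> B" "\<forall>j<n. \<bar>y j\<bar> \<le> B" "\<forall>j<n. \<bar>x j - y j\<bar> \<le> d" "j < n"
          have "\<forall>t\<in>{0..T}. \<bar>st x t - st y t\<bar> \<le> d" using h idx by (auto simp: st_def)
          then show "\<bar>F x j - F y j\<bar> \<le> e'"
            unfolding F_def using d(2) stX[OF h(1)] stX[OF h(2)] nodei[OF h(4)] by blast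
        qed (fact d(1))
      qed
    qed (use B e in auto)
    show ?thesis
    proof (intro bexI[of _ "st x"] ballI)
      fix t assume t: "t \<in> {0..T}"
      have "\<bar>\<Phi> (st x) t - \<Phi> (st x) (T * idx t / n)\<bar> \<le> L * \<bar>t - T * idx t / n\<bar>"
        by (rule lipX[OF stX[OF x(1)] t node])
      also have "\<dots> \<le> L' * \<bar>t - T * idx t / n\<bar>" by (rule L')
      also have "\<dots> \<le> L' * (T / n)" using close[OF t] L' by (intro mult_left_mono) auto
      also have "\<dots> \<le> e / 2" by (rule mesh)
      finally have "\<bar>\<Phi> (st x) t - F x (idx t)\<bar> \<le> e / 2" by (simp add: F_def)
      moreover have "\<bar>F x (idx t) - st x t\<bar> \<le> e / 2" using x(2) idx by (simp add: st_def)
      ultimately show "\<bar>\<Phi> (st x) t - st x t\<bar> \<le> e" by linarith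
    qed (rule stX[OF x(1)])
  qed
  have "\<exists>u. \<forall>k::nat. u k \<in> X \<and> (\<forall>t\<in>{0..T}. \<bar>\<Phi> (u k) t - u k t\<bar> \<le> inverse (Suc k))"
  proof (rule choice, rule allI)
    show "\<exists>u. u \<in> X \<and> (\<forall>t\<in>{0..T}. \<bar>\<Phi> u t - u t\<bar> \<le> inverse (Suc k))" for k
      using approx[of "inverse (Suc k)"] by auto
  qed
  then obtain U where UX: "\<And>k. U k \<in> X"
    and Uap: "\<And>k t. t \<in> {0..T} \<Longrightarrow> \<bar>\<Phi> (U k) t - U k t\<bar> \<le> inverse (Suc k)" by blast
  \<comment> \<open>The images of the approximate fixed points are equi-Lipschitz, so a subsequence converges
      uniformly; the approximate fixed points have the same limit.\<close>
  obtain h r where h: "continuous_on {0..T} h" and r: "strict_mono (r :: nat \<Rightarrow> nat)"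
    and conv: "\<And>e. 0 < e \<Longrightarrow> \<exists>N. \<forall>n t. n \<ge> N \<and> t \<in> {0..T} \<longrightarrow> norm (\<Phi> (U (r n)) t - h t) < e"
  proof (rule Arzela_Ascoli[of "{0..T}" "\<lambda>n. \<Phi> (U n)" B])
    show "\<exists>d>0. \<forall>n y. y \<in> {0..T} \<and> norm (x - y) < d \<longrightarrow> norm (\<Phi> (U n) x - \<Phi> (U n) y) < e"
      if "x \<in> {0..T}" "0 < e" for x e
    proof (intro exI[of _ "e / L'"] conjI allI impI)
      fix n y assume y: "y \<in> {0..T} \<and> norm (x - y) < e / L'"
      have "\<bar>\<Phi> (U n) x - \<Phi> (U n) y\<bar> \<le> L' * \<bar>x - y\<bar>"
        using lipX[OF UX that(1), of y n] y L'(2)[of "x - y"] by linarith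
      also have "\<dots> < e" using y L'(1) by (simp add: field_simps)
      finally show "norm (\<Phi> (U n) x - \<Phi> (U n) y) < e" by simp
    qed (use that L' in auto)
  qed (use boundX UX in auto)
  define u where "u t = h (max 0 (min T t))" for t
  have ueq: "u t = h t" if "t \<in> {0..T}" for t using that by (simp add: u_def)
  have ucont: "continuous_on UNIV u"
    unfolding u_def by (rule continuous_on_compose2[OF h]) (use T in \<open>auto intro!: continuous_intros\<close>)
  have smallk: "\<exists>N. \<forall>n\<ge>N. inverse (real (Suc (r n))) < e" if "e > 0" for e
  proof -
    obtain N where N: "inverse (real (Suc N)) < e" using reals_Archimedean[OF \<open>e > 0\<close>] by blast
    have "inverse (real (Suc (r n))) < e" if "n \<ge> N" for n
    proof -
      have "r n \<ge> N" using seq_suble[OF r, of n] that by linarith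
      then have "inverse (real (Suc (r n))) \<le> inverse (real (Suc N))" by (simp add: field_simps)
      with N show ?thesis by linarith
    qed
    then show ?thesis by blast
  qed
  have Uconv: "\<exists>N. \<forall>n\<ge>N. \<forall>t\<in>{0..T}. \<bar>U (r n) t - u t\<bar> \<le> e" if e: "e > 0" for e
  proof -
    obtain N1 where N1: "\<forall>n t. n \<ge> N1 \<and> t \<in> {0..T} \<longrightarrow> norm (\<Phi> (U (r n)) t - h t) < e / 2"
      using conv[of "e / 2"] e by auto
    obtain N2 where N2: "\<forall>n\<ge>N2. inverse (real (Suc (r n))) < e / 2" using smallk[of "e / 2"] e by auto
    have "\<bar>U (r n) t - u t\<bar> \<le> e" if n: "n \<ge> max N1 N2" and t: "t \<in> {0..T}" for n t
    proof -
      have "\<bar>\<Phi> (U (r n)) t - h t\<bar> < e / 2" using N1 n t by auto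
      moreover have "\<bar>\<Phi> (U (r n)) t - U (r n) t\<bar> < e / 2"
        using Uap[OF t, of "r n"] N2 n by (meson le_less_trans max.bounded_iff)
      ultimately show ?thesis using ueq[OF t] by linarith
    qed
    then show ?thesis by blast
  qed
  have ubound: "\<forall>t\<in>{0..T}. \<bar>u t\<bar> \<le> B"
  proof (rule ballI, rule field_le_epsilon)
    fix t e :: real assume t: "t \<in> {0..T}" and "e > 0"
    then obtain n where "\<bar>U (r n) t - u t\<bar> \<le> e" using Uconv by blast
    moreover have "\<bar>U (r n) t\<bar> \<le> B" using UX[of "r n"] t by (simp add: X_def)
    ultimately show "\<bar>u t\<bar> \<le> B + e" by linarith
  qed
  then have uX: "u \<in> X" using ucont by (simp add: X_def borel_measurable_continuous_onI)
  have "\<Phi> u t = u t" if t: "t \<in> {0..T}" for t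
  proof -
    have "\<bar>\<Phi> u t - u t\<bar> \<le> e" if e: "e > 0" for e
    proof -
      obtain d where d: "d > 0" "\<forall>u\<in>X. \<forall>v\<in>X. (\<forall>t\<in>{0..T}. \<bar>u t - v t\<bar> \<le> d) \<longrightarrow>
            (\<forall>t\<in>{0..T}. \<bar>\<Phi> u t - \<Phi> v t\<bar> \<le> e / 2)" using uc'[of "e / 2"] e by auto
      obtain N1 where N1: "\<forall>n t. n \<ge> N1 \<and> t \<in> {0..T} \<longrightarrow> norm (\<Phi> (U (r n)) t - h t) < e / 2"
        using conv[of "e / 2"] e by auto
      obtain N2 where N2: "\<forall>n\<ge>N2. \<forall>t\<in>{0..T}. \<bar>U (r n) t - u t\<bar> \<le> d" using Uconv[OF d(1)] by blast
      define n where "n = max N1 N2"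
      have "\<bar>\<Phi> (U (r n)) t - \<Phi> u t\<bar> \<le> e / 2"
        using d(2) UX uX N2 t by (auto simp: n_def)
      moreover have "\<bar>\<Phi> (U (r n)) t - u t\<bar> < e / 2" using N1 t ueq[OF t] by (auto simp: n_def)
      ultimately show ?thesis by linarith
    qed
    then have "\<bar>\<Phi> u t - u t\<bar> \<le> 0" by (rule field_le_epsilon) auto
    then show ?thesis by simp
  qed
  with that ucont ubound show thesis by blast
qed

section \<open>Indefinite integrals\<close>

lemma abs_integral_le_integral:
  fixes f g :: "real \<Rightarrow> real"
  assumes "f integrable_on S" "g integrable_on S" "\<And>x. x \<in> S \<Longrightarrow> \<bar>f x\<bar> \<le> g x"
  shows "\<bar>integral S f\<bar> \<le> integral S g"
  using Henstock_Kurzweil_Integration.integral_norm_bound_integral[of f S g] assms by simp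

text \<open>Lebesgue's differentiation theorem on the line. \<open>integrable_ccontinuous_explicit\<close> is its one-sided
form; applying it also to the reflected function gives the two-sided derivative.\<close>

lemma indefinite_integral_AE_derivative:
  fixes f v :: "real \<Rightarrow> real"
  assumes int: "\<And>p q. p \<le> q \<Longrightarrow> (f has_integral (v q - v p)) {p..q}"
  shows "AE t in lebesgue. (v has_real_derivative f t) (at t)"
proof -
  have "f integrable_on cbox a b" for a b
    using int[of a b] by (cases "a \<le> b") (auto simp: integrable_on_def)
  then obtain N where N: "negligible N" and right: "\<And>x e. \<lbrakk>x \<notin> N; 0 < e\<rbrakk> \<Longrightarrow>
      \<exists>d>0. \<forall>h. 0 < h \<and> h < d \<longrightarrow> norm (integral (cbox x (x + h *\<^sub>R One)) f /\<^sub>R h ^ DIM(real) - f x) < e"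
    using integrable_ccontinuous_explicit[of f] by blast
  have reflint: "((\<lambda>x. f (- x)) has_integral (v (- p) - v (- q))) {p..q}" if "p \<le> q" for p q
    using int[of "- q" "- p"] that has_integral_reflect_real[of f "v (-p) - v (-q)" "-p" "-q"] by simp
  have "(\<lambda>x. f (- x)) integrable_on cbox a b" for a b
    using reflint[of a b] by (cases "a \<le> b") (auto simp: integrable_on_def)
  then obtain M where M: "negligible M" and left: "\<And>x e. \<lbrakk>x \<notin> M; 0 < e\<rbrakk> \<Longrightarrow>
      \<exists>d>0. \<forall>h. 0 < h \<and> h < d \<longrightarrow>
        norm (integral (cbox x (x + h *\<^sub>R One)) (\<lambda>x. f (- x)) /\<^sub>R h ^ DIM(real) - f (- x)) < e"
    using integrable_ccontinuous_explicit[of "\<lambda>x. f (- x)"] by blast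
  define M' where "M' = uminus ` M"
  have M': "negligible M'"
    unfolding M'_def
    by (rule negligible_differentiable_image_negligible[OF order_refl M]) (intro derivative_intros)
  have deriv: "(v has_real_derivative f t) (at t)" if t: "t \<notin> N \<union> M'" for t
    unfolding DERIV_def
  proof (rule LIM_I)
    fix r :: real assume r: "r > 0"
    obtain d1 where d1: "d1 > 0" and R: "\<And>h. 0 < h \<Longrightarrow> h < d1 \<Longrightarrow> \<bar>(v (t + h) - v t) / h - f t\<bar> < r"
    proof -
      obtain d where "d > 0" and d: "\<forall>h. 0 < h \<and> h < d \<longrightarrow>
          norm (integral (cbox t (t + h *\<^sub>R One)) f /\<^sub>R h ^ DIM(real) - f t) < r"
        using right[of t r] t r by blast
      have "\<bar>(v (t + h) - v t) / h - f t\<bar> < r" if "0 < h" "h < d" for h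
        using d[rule_format, of h] that integral_unique[OF int[of t "t + h"]]
        by (simp add: divide_inverse_commute)
      with \<open>d > 0\<close> that show thesis by blast
    qed
    have tM: "- t \<notin> M" using t by (force simp: M'_def)
    obtain d2 where d2: "d2 > 0" and L: "\<And>h. 0 < h \<Longrightarrow> h < d2 \<Longrightarrow> \<bar>(v t - v (t - h)) / h - f t\<bar> < r"
    proof -
      obtain d where "d > 0" and d: "\<forall>h. 0 < h \<and> h < d \<longrightarrow>
          norm (integral (cbox (- t) (- t + h *\<^sub>R One)) (\<lambda>x. f (- x)) /\<^sub>R h ^ DIM(real) - f (- (- t))) < r"
        using left[OF tM r] by blast
      have "\<bar>(v t - v (t - h)) / h - f t\<bar> < r" if "0 < h" "h < d" for h
        using d[rule_format, of h] that integral_unique[OF reflint[of "- t" "- t + h"]]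
        by (simp add: divide_inverse_commute)
      with \<open>d > 0\<close> that show thesis by blast
    qed
    show "\<exists>s>0. \<forall>h. h \<noteq> 0 \<and> norm (h - 0) < s \<longrightarrow> norm ((v (t + h) - v t) / h - f t) < r"
    proof (intro exI[of _ "min d1 d2"] conjI allI impI)
      fix h :: real assume h: "h \<noteq> 0 \<and> norm (h - 0) < min d1 d2"
      show "norm ((v (t + h) - v t) / h - f t) < r"
      proof (cases "h > 0")
        case True then show ?thesis using R[of h] h by simp
      next
        case False
        then have "\<bar>(v t - v (t - (- h))) / (- h) - f t\<bar> < r" using L[of "- h"] h by simp
        moreover have "(v t - v (t - (- h))) / (- h) = (v (t + h) - v t) / h"
          using False h by (simp add: divide_simps)
        ultimately show ?thesis by simp
      qed
    qed (use d1 d2 in auto)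
  qed
  have "negligible (N \<union> M')" using N M' by (rule negligible_Un)
  then have "N \<union> M' \<in> null_sets lebesgue" by (simp only: negligible_iff_null_sets)
  then show ?thesis by (rule AE_I') (use deriv in blast)
qed

text \<open>Uniform integrability of a single function: the part above a high level has small integral.\<close>

lemma indefinite_integral_small_tail:
  fixes f :: "real \<Rightarrow> real"
  assumes f: "f absolutely_integrable_on {p..q}" and e: "e > 0"
  obtains n :: nat where "integral {p..q} (\<lambda>t. max 0 (\<bar>f t\<bar> - n)) < e"
    "(\<lambda>t. max 0 (\<bar>f t\<bar> - n)) integrable_on {p..q}"
proof -
  have abs: "(\<lambda>t. \<bar>f t\<bar>) absolutely_integrable_on {p..q}"
    using absolutely_integrable_norm[OF f] by (simp add: o_def)
  have g: "(\<lambda>t. max 0 (\<bar>f t\<bar> - real n)) absolutely_integrable_on {p..q}" for n :: nat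
    by (intro absolutely_integrable_max_1 set_integral_diff abs absolutely_integrable_on_const) auto
  have "(\<lambda>n. integral {p..q} (\<lambda>t. max 0 (\<bar>f t\<bar> - real n))) \<longlonglongrightarrow> integral {p..q} (\<lambda>t. 0)"
  proof (rule dominated_convergence(2)[where h = "\<lambda>t. \<bar>f t\<bar>"])
    show "(\<lambda>t. max 0 (\<bar>f t\<bar> - real n)) integrable_on {p..q}" for n
      using g set_lebesgue_integral_eq_integral(1) by blast
    show "(\<lambda>t. \<bar>f t\<bar>) integrable_on {p..q}"
      using abs set_lebesgue_integral_eq_integral(1) by blast
    show "(\<lambda>n. max 0 (\<bar>f t\<bar> - real n)) \<longlonglongrightarrow> 0" for t
    proof (rule tendsto_eventually)
      obtain N :: nat where "\<bar>f t\<bar> < N" using reals_Archimedean2 by blast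
      then show "\<forall>\<^sub>F n in sequentially. max 0 (\<bar>f t\<bar> - real n) = 0"
        by (intro eventually_sequentiallyI[of N]) auto
    qed
  qed auto
  then have "(\<lambda>n. integral {p..q} (\<lambda>t. max 0 (\<bar>f t\<bar> - real n))) \<longlonglongrightarrow> 0" by simp
  then have "\<forall>\<^sub>F n in sequentially. integral {p..q} (\<lambda>t. max 0 (\<bar>f t\<bar> - real n)) < e"
    using e by (rule order_tendstoD(2))
  then obtain n where "integral {p..q} (\<lambda>t. max 0 (\<bar>f t\<bar> - real n)) < e"
    by (auto simp: eventually_sequentially)
  then show thesis using that g set_lebesgue_integral_eq_integral(1) by blast
qed

lemma sum_integral_disjoint_le:
  fixes f :: "real \<Rightarrow> real"
  assumes f: "f integrable_on {p..q}" and nn: "\<And>t. f t \<ge> 0"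
    and xy: "\<forall>i<n. p \<le> x i \<and> x i \<le> y i \<and> y i \<le> q"
    and disj: "disjoint_family_on (\<lambda>i. {x i<..<y i}) {..<n::nat}"
  shows "(\<Sum>i<n. integral {x i..y i} f) \<le> integral {p..q} f"
proof -
  have oi: "f integrable_on {x i..y i}" "f integrable_on {x i<..<y i}" if "i < n" for i
  proof -
    show "f integrable_on {x i..y i}"
      using integrable_on_subinterval[OF f, of "x i" "y i"] xy that by auto
    then show "f integrable_on {x i<..<y i}" by (simp add: integrable_on_open_interval_real)
  qed
  have "(\<Sum>i<n. integral {x i..y i} f) = (\<Sum>i\<in>{..<n}. integral {x i<..<y i} f)"
    by (simp add: integral_open_interval_real)
  also have "\<dots> = integral (\<Union>i\<in>{..<n}. {x i<..<y i}) f"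
  proof (rule has_integral_UN[THEN integral_unique, symmetric])
    show "(f has_integral integral {x i<..<y i} f) {x i<..<y i}" if "i \<in> {..<n}" for i
      using oi(2) that by (auto intro: integrable_integral)
    show "pairwise (\<lambda>i i'. negligible ({x i<..<y i} \<inter> {x i'<..<y i'})) {..<n}"
      using disj by (auto simp: pairwise_def disjoint_family_on_def)
  qed simp
  also have "\<dots> \<le> integral {p..q} f"
  proof (rule integral_subset_le)
    show "f integrable_on (\<Union>i\<in>{..<n}. {x i<..<y i})"
      using oi(2) disj
      by (intro has_integral_UN[THEN has_integral_integrable])
        (auto simp: pairwise_def disjoint_family_on_def intro: integrable_integral)
  qed (use xy f nn in force)+
  finally show ?thesis .
qed

text \<open>The integrand is bounded by a constant \<open>n\<close> up to a part of small integral, so the increments over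
disjoint intervals are controlled by their total length.\<close>

lemma indefinite_integral_locally_abs_continuous:
  fixes f v :: "real \<Rightarrow> real"
  assumes int: "\<And>p q. p \<le> q \<Longrightarrow> (f has_integral (v q - v p)) {p..q}"
    and abs: "\<And>p q. f absolutely_integrable_on {p..q}"
  shows "locally_abs_continuous v"
  unfolding locally_abs_continuous_def abs_continuous_on_interval_def
proof (intro allI impI)
  fix p q e :: real assume "p \<le> q" and e: "e > 0"
  obtain n :: nat where n: "integral {p..q} (\<lambda>t. max 0 (\<bar>f t\<bar> - n)) < e / 2"
    "(\<lambda>t. max 0 (\<bar>f t\<bar> - n)) integrable_on {p..q}"
    using indefinite_integral_small_tail[OF abs, of "e / 2"] e by auto
  define h where "h t = max 0 (\<bar>f t\<bar> - n)" for t
  show "\<exists>\<delta>>0. \<forall>(m::nat) x y. (\<forall>i<m. p \<le> x i \<and> x i \<le> y i \<and> y i \<le> q) \<and>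
        disjoint_family_on (\<lambda>i. {x i<..<y i}) {..<m} \<and> (\<Sum>i<m. y i - x i) < \<delta> \<longrightarrow>
        (\<Sum>i<m. \<bar>v (y i) - v (x i)\<bar>) < e"
  proof (intro exI[of _ "e / (2 * (real n + 1))"] conjI allI impI, goal_cases)
    case 1 show ?case using e by simp
  next
    case (2 m x y)
    then have xy: "\<forall>i<m. p \<le> x i \<and> x i \<le> y i \<and> y i \<le> q"
      and dj: "disjoint_family_on (\<lambda>i. {x i<..<y i}) {..<m}"
      and sm: "(\<Sum>i<m. y i - x i) < e / (2 * (real n + 1))" by auto
    have "\<bar>v (y i) - v (x i)\<bar> \<le> n * (y i - x i) + integral {x i..y i} h" if "i < m" for i
    proof -
      have le: "x i \<le> y i" and sub: "{x i..y i} \<subseteq> {p..q}" using xy that by auto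
      have hi: "h integrable_on {x i..y i}"
        using n(2) sub unfolding h_def by (rule integrable_on_subinterval)
      have fi: "(f has_integral (v (y i) - v (x i))) {x i..y i}" using int[OF le] .
      have "\<bar>integral {x i..y i} f\<bar> \<le> integral {x i..y i} (\<lambda>t. real n + h t)"
      proof (rule abs_integral_le_integral)
        show "f integrable_on {x i..y i}" using fi by blast
        show "(\<lambda>t. real n + h t) integrable_on {x i..y i}" by (intro integrable_add hi) auto
        show "\<bar>f t\<bar> \<le> real n + h t" for t by (simp add: h_def)
      qed
      also have "\<dots> = n * (y i - x i) + integral {x i..y i} h"
        using le by (subst integral_add) (auto intro: hi)
      finally show ?thesis using integral_unique[OF fi] by simp
    qed
    then have "(\<Sum>i<m. \<bar>v (y i) - v (x i)\<bar>) \<le> (\<Sum>i<m. n * (y i - x i) + integral {x i..y i} h)"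
      by (intro sum_mono) auto
    also have "\<dots> = n * (\<Sum>i<m. y i - x i) + (\<Sum>i<m. integral {x i..y i} h)"
      by (simp add: sum.distrib sum_distrib_left)
    also have "\<dots> \<le> n * (e / (2 * (real n + 1))) + integral {p..q} h"
      using sm n(2) by (intro add_mono mult_left_mono sum_integral_disjoint_le xy dj) (auto simp: h_def[abs_def])
    also have "\<dots> < e / 2 + e / 2"
    proof (rule add_le_less_mono)
      show "n * (e / (2 * (real n + 1))) \<le> e / 2" using e by (simp add: field_simps)
      show "integral {p..q} h < e / 2" using n(1) by (simp add: h_def[abs_def])
    qed
    finally show ?case by simp
  qed
qed


section \<open>Periodic extension\<close>

text \<open>The \<open>T\<close>-periodic function that agrees with \<open>u\<close> on \<open>[0, T)\<close>. The value \<open>u T\<close> is not used, so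
that statements about the closed period need \<open>u 0 = u T\<close>.\<close>

definition periodic_extension :: "real \<Rightarrow> (real \<Rightarrow> real) \<Rightarrow> real \<Rightarrow> real" where
  "periodic_extension T u t = u (t - T * of_int \<lfloor>t / T\<rfloor>)"

lemma periodic_extension_cell:
  assumes "T > 0" "u 0 = u T" "T * of_int k \<le> t" "t \<le> T * (of_int k + 1)"
  shows "periodic_extension T u t = u (t - T * of_int k)"
proof (cases "t = T * (of_int k + 1)")
  case True
  then have "t / T = of_int (k + 1)" using assms(1) by simp
  then have "\<lfloor>t / T\<rfloor> = k + 1" by (simp only: floor_of_int)
  then show ?thesis using True assms(2) by (simp add: periodic_extension_def algebra_simps)
next
  case False
  then have "\<lfloor>t / T\<rfloor> = k" using assms by (intro floor_unique) (auto simp: field_simps)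
  then show ?thesis by (simp add: periodic_extension_def)
qed

lemma periodic_extension_base:
  assumes "T > 0" "u 0 = u T" "t \<in> {0..T}"
  shows "periodic_extension T u t = u t"
  using periodic_extension_cell[of T u 0 t] assms by simp

lemma periodic_extension_periodic:
  assumes "T > 0"
  shows "periodic_extension T u (t + T) = periodic_extension T u t"
proof -
  have "(t + T) / T = t / T + 1" using assms by (simp add: field_simps)
  then have "\<lfloor>(t + T) / T\<rfloor> = \<lfloor>t / T\<rfloor> + 1" by simp
  then show ?thesis by (simp add: periodic_extension_def algebra_simps)
qed

lemma periodic_extension_mem:
  assumes "T > 0"
  shows "t - T * of_int \<lfloor>t / T\<rfloor> \<in> {0..T}"
proof -
  have "of_int \<lfloor>t / T\<rfloor> \<le> t / T" "t / T \<le> of_int \<lfloor>t / T\<rfloor> + 1" by linarith+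
  then have "T * of_int \<lfloor>t / T\<rfloor> \<le> T * (t / T)" "T * (t / T) \<le> T * (of_int \<lfloor>t / T\<rfloor> + 1)"
    using assms by (intro mult_left_mono; simp)+
  then show ?thesis using assms by (simp add: algebra_simps)
qed

lemma has_real_derivative_periodic_extension:
  assumes T: "T > 0" and u0: "u 0 = u T" and v0: "v 0 = v T"
    and der: "\<And>t. t \<in> {0..T} \<Longrightarrow> (u has_real_derivative v t) (at t within {0..T})"
  shows "(periodic_extension T u has_real_derivative periodic_extension T v t) (at t)"
proof -
  have cell: "(periodic_extension T u has_real_derivative periodic_extension T v t)
      (at t within {T * of_int k..T * (of_int k + 1)})"
    if t: "t \<in> {T * of_int k..T * (of_int k + 1)}" for t and k :: int
  proof (rule has_field_derivative_transform_within[OF _ zero_less_one t])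
    have im: "(\<lambda>x. x - T * of_int k) ` {T * of_int k..T * (of_int k + 1)} \<subseteq> {0..T}"
      by (auto simp: algebra_simps)
    have "(u has_real_derivative v (t - T * of_int k))
        (at (t - T * of_int k) within (\<lambda>x. x - T * of_int k) ` {T * of_int k..T * (of_int k + 1)})"
      by (rule DERIV_subset[OF der im]) (use t in \<open>auto simp: algebra_simps\<close>)
    from DERIV_image_chain[OF this, of 1]
    have "((\<lambda>x. u (x - T * of_int k)) has_real_derivative v (t - T * of_int k))
        (at t within {T * of_int k..T * (of_int k + 1)})"
      by (simp add: o_def DERIV_diff[OF DERIV_ident DERIV_const, simplified])
    then show "((\<lambda>x. u (x - T * of_int k)) has_real_derivative periodic_extension T v t)
        (at t within {T * of_int k..T * (of_int k + 1)})"
      using periodic_extension_cell[OF T v0, of k t] t by simp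
  qed (use periodic_extension_cell[OF T u0] in auto)
  define k where "k = \<lfloor>t / T\<rfloor>"
  have "of_int k \<le> t / T" "t / T < of_int k + 1" by (auto simp: k_def)
  then have k: "T * of_int k \<le> t" "t < T * (of_int k + 1)" using T by (simp_all add: field_simps)
  show ?thesis
  proof (cases "T * of_int k = t")
    case False
    then have "at t within {T * of_int k..T * (of_int k + 1)} = at t"
      using k by (intro at_within_Icc_at) auto
    then show ?thesis using cell[of t k] k by simp
  next
    case True
    \<comment> \<open>At a multiple of \<open>T\<close> the derivatives from the right and from the left come from adjacent cells.\<close>
    have r: "(periodic_extension T u has_real_derivative periodic_extension T v t) (at t within {t..t + T})"
      using cell[of t k] k True T by (simp add: algebra_simps)
    have "T * of_int (k - 1) = t - T" "T * (of_int (k - 1) + 1) = t"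
      using True by (simp_all add: algebra_simps)
    then have l: "(periodic_extension T u has_real_derivative periodic_extension T v t) (at t within {t - T..t})"
      using cell[of t "k - 1"] T by simp
    have un: "{t - T..t} \<union> {t..t + T} = {t - T..t + T}" using T by auto
    have "(periodic_extension T u has_real_derivative periodic_extension T v t)
        (at t within ({t - T..t} \<union> {t..t + T}))"
      using l r unfolding has_field_derivative_iff by (simp add: at_within_union filterlim_sup)
    then show ?thesis unfolding un using T by (simp add: at_within_Icc_at)
  qed
qed

lemma periodic_int_multiple:
  fixes f :: "real \<Rightarrow> real"
  assumes "\<And>t. f (t + T) = f t"
  shows "f (t + T * of_int k) = f t"
proof (induction k rule: int_induct[where k = 0])
  case (step1 i)
  then show ?case using assms[of "t + T * of_int i"] by (simp add: algebra_simps)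
next
  case (step2 i)
  then show ?case using assms[of "t + T * of_int (i - 1)"] by (simp add: algebra_simps)
qed simp

lemma periodic_has_integral_cell:
  fixes f :: "real \<Rightarrow> real" and k :: int
  assumes per: "\<And>t. f (t + T) = f t" and int: "(f has_integral i) {p - T * of_int k..q - T * of_int k}"
  shows "(f has_integral i) {p..q}"
proof -
  have "f (x + - (T * of_int k)) = f x" for x
    using periodic_int_multiple[where f = f, OF per, of x "- k"] by simp
  then show ?thesis using has_integral_shift_real_ivl[OF int, of "- (T * of_int k)"] by simp
qed

lemma integrable_on_periodic:
  fixes f :: "real \<Rightarrow> real"
  assumes T: "T > 0" and per: "\<And>t. f (t + T) = f t" and f: "f integrable_on {0..T}"
  shows "f integrable_on {p..q}"
proof -
  have cell: "f integrable_on {T * of_int k..T * (of_int k + 1)}" for k :: int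
  proof -
    obtain i where "(f has_integral i) {0..T}" using f by blast
    then have "(f has_integral i) {T * of_int k - T * of_int k..T * (of_int k + 1) - T * of_int k}"
      by (simp add: algebra_simps)
    from periodic_has_integral_cell[where f = f, OF per this] show ?thesis by blast
  qed
  have big: "f integrable_on {- (T * real n)..T * real n}" for n :: nat
  proof (induction n)
    case (Suc n)
    have "f integrable_on {T * real n..T * real (Suc n)}"
      using cell[of "int n"] by (simp add: algebra_simps)
    with Suc have 1: "f integrable_on {- (T * real n)..T * real (Suc n)}"
      using Henstock_Kurzweil_Integration.integrable_combine[of "- (T * real n)" "T * real n" "T * real (Suc n)" f] T
      by (simp add: algebra_simps)
    have "f integrable_on {- (T * real (Suc n))..- (T * real n)}"
      using cell[of "- int (Suc n)"] by (simp add: algebra_simps)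
    from Henstock_Kurzweil_Integration.integrable_combine[OF _ _ this 1] show ?case using T by (simp add: algebra_simps)
  qed (use integrable_on_refl[of f 0] in simp)
  obtain n :: nat where n: "real n > max \<bar>p\<bar> \<bar>q\<bar> / T" using reals_Archimedean2 by blast
  then have "T * real n > max \<bar>p\<bar> \<bar>q\<bar>" using T by (simp add: pos_divide_less_eq mult.commute)
  then have "{p..q} \<subseteq> {- (T * real n)..T * real n}" by auto
  then show ?thesis using big integrable_on_subinterval by blast
qed

lemma absolutely_integrable_on_periodic:
  fixes f :: "real \<Rightarrow> real"
  assumes T: "T > 0" and per: "\<And>t. f (t + T) = f t" and f: "f absolutely_integrable_on {0..T}"
  shows "f absolutely_integrable_on {p..q}"
  using integrable_on_periodic[where f = f, OF T per, of p q]
    integrable_on_periodic[OF T, of "\<lambda>t. norm (f t)" p q] per f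
  by (simp add: absolutely_integrable_on_def)

lemma has_integral_periodic_extension:
  fixes f v :: "real \<Rightarrow> real"
  assumes T: "T > 0" and per: "\<And>t. f (t + T) = f t" and v0: "v 0 = v T"
    and int: "\<And>p q. 0 \<le> p \<Longrightarrow> p \<le> q \<Longrightarrow> q \<le> T \<Longrightarrow> (f has_integral (v q - v p)) {p..q}"
    and pq: "p \<le> q"
  shows "(f has_integral (periodic_extension T v q - periodic_extension T v p)) {p..q}"
proof -
  define P where "P p q \<longleftrightarrow> (f has_integral (periodic_extension T v q - periodic_extension T v p)) {p..q}"
    for p q
  have trans: "P p r" if "P p q" "P q r" "p \<le> q" "q \<le> r" for p q r
    using has_integral_combine[OF that(3,4)] that(1,2) by (fastforce simp: P_def)
  have cell: "P p q" if "T * of_int k \<le> p" "p \<le> q" "q \<le> T * (of_int k + 1)" for p q and k :: int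
  proof -
    have "(f has_integral (v (q - T * of_int k) - v (p - T * of_int k))) {p - T * of_int k..q - T * of_int k}"
      using that by (intro int) (auto simp: algebra_simps)
    from periodic_has_integral_cell[where f = f, OF per this]
    show ?thesis unfolding P_def using that periodic_extension_cell[OF T v0, of k] by simp
  qed
  have nodes: "P (T * of_int k) (T * of_int (k + int n))" for k n
  proof (induction n)
    case 0
    show ?case using has_integral_refl(1)[of f "T * of_int k"] by (simp add: P_def)
  next
    case (Suc n)
    have "P (T * of_int (k + int n)) (T * of_int (k + int (Suc n)))"
      using T by (intro cell[of "k + int n"]) (auto simp: algebra_simps)
    from trans[OF Suc this] show ?case using T by (auto simp: algebra_simps)
  qed
  define k l where "k = \<lfloor>p / T\<rfloor>" and "l = \<lfloor>q / T\<rfloor>"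
  have fl: "T * of_int \<lfloor>t / T\<rfloor> \<le> t" "t \<le> T * (of_int \<lfloor>t / T\<rfloor> + 1)" for t
    using periodic_extension_mem[OF T, of t] by (auto simp: algebra_simps)
  have kl: "k \<le> l" unfolding k_def l_def using pq T by (intro floor_mono divide_right_mono) auto
  show ?thesis
  proof (cases "k = l")
    case True
    then show ?thesis using cell[of k p q] fl[of p] fl[of q] pq by (simp add: k_def l_def P_def)
  next
    case False
    then have l: "l = (k + 1) + int (nat (l - k - 1))" using kl by simp
    have "of_int (k + 1) \<le> (of_int l :: real)" using False kl by linarith
    then have kl': "T * of_int (k + 1) \<le> T * of_int l" using T by simp
    have 1: "P p (T * of_int (k + 1))" using fl[of p] T by (intro cell[of k]) (auto simp: k_def)
    have 2: "P (T * of_int (k + 1)) (T * of_int l)" using nodes[of "k + 1" "nat (l - k - 1)"] l by simp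
    have 3: "P (T * of_int l) q" using fl[of q] T by (intro cell[of l]) (auto simp: l_def)
    have "P p (T * of_int l)" using trans[OF 1 2] fl[of p] kl' by (simp add: k_def)
    from trans[OF this 3] have "P p q" using fl[of p] fl[of q] kl' by (simp add: k_def l_def)
    then show ?thesis by (simp add: P_def)
  qed
qed

lemma locally_abs_continuous_imp_continuous:
  assumes "locally_abs_continuous v"
  shows "continuous_on UNIV v"
  unfolding continuous_on_iff
proof (intro ballI allI impI)
  fix t e :: real assume "e > 0"
  moreover have "abs_continuous_on_interval (t - 1) (t + 1) v"
    using assms by (simp add: locally_abs_continuous_def)
  ultimately obtain d where d: "d > 0" and ac: "\<And>(n::nat) x y.
        (\<forall>i<n. t - 1 \<le> x i \<and> x i \<le> y i \<and> y i \<le> t + 1) \<and>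
        disjoint_family_on (\<lambda>i. {x i<..<y i}) {..<n} \<and>
        (\<Sum>i<n. y i - x i) < d \<Longrightarrow> (\<Sum>i<n. \<bar>v (y i) - v (x i)\<bar>) < e"
    unfolding abs_continuous_on_interval_def by blast
  have "dist (v s) (v t) < e" if "dist s t < min d 1" for s
  proof (cases "s \<le> t")
    case True
    then show ?thesis using ac[of 1 "\<lambda>_. s" "\<lambda>_. t"] that
      by (simp add: disjoint_family_on_def dist_real_def abs_minus_commute)
  next
    case False
    then show ?thesis using ac[of 1 "\<lambda>_. t" "\<lambda>_. s"] that
      by (simp add: disjoint_family_on_def dist_real_def)
  qed
  then show "\<exists>d>0. \<forall>s\<in>UNIV. dist s t < d \<longrightarrow> dist (v s) (v t) < e"
    using d by (intro exI[of _ "min d 1"]) auto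
qed

text \<open>A positive solution on one period with matching values and derivatives at the end points extends to
a Caratheodory solution on the line. On \<open>[0, T]\<close> the equation is used in integrated form.\<close>

lemma positive_periodic_solution_of_cell:
  fixes T c :: real and g w u v :: "real \<Rightarrow> real"
  assumes T: "T > 0" and per: "\<And>t. w (t + T) = w t" and w: "w absolutely_integrable_on {0..T}"
    and g: "continuous_on {0..} g"
    and der: "\<And>t. t \<in> {0..T} \<Longrightarrow> (u has_real_derivative v t) (at t within {0..T})"
    and v: "continuous_on {0..T} v" and u0: "u 0 = u T" and v0: "v 0 = v T"
    and pos: "\<And>t. t \<in> {0..T} \<Longrightarrow> u t > 0"
    and int: "\<And>p q. 0 \<le> p \<Longrightarrow> p \<le> q \<Longrightarrow> q \<le> T \<Longrightarrow>
                ((\<lambda>t. - c * v t - w t * g (u t)) has_integral (v q - v p)) {p..q}"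
  shows "positive_periodic_solution T c w g (periodic_extension T u)"
proof -
  let ?u = "periodic_extension T u" and ?v = "periodic_extension T v"
  define F where "F t = - c * ?v t - w t * g (?u t)" for t
  have Fper: "F (t + T) = F t" for t
    by (simp add: F_def per periodic_extension_periodic[OF T])
  have Feq: "F t = - c * v t - w t * g (u t)" if "t \<in> {0..T}" for t
    using periodic_extension_base[OF T] u0 v0 that by (simp add: F_def)
  have Fint: "(F has_integral (?v q - ?v p)) {p..q}" if "p \<le> q" for p q
  proof (rule has_integral_periodic_extension[where f = F, OF T Fper v0 _ that])
    show "(F has_integral (v q - v p)) {p..q}" if "0 \<le> p" "p \<le> q" "q \<le> T" for p q
      using int[OF that] by (rule has_integral_eq[rotated]) (use Feq that in auto)
  qed
  have ucont: "continuous_on {0..T} u"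
    using der by (intro DERIV_continuous_on) auto
  have gu: "continuous_on {0..T} (\<lambda>t. g (u t))"
    by (rule continuous_on_compose2[OF g ucont]) (use pos in \<open>auto intro: less_imp_le\<close>)
  have "(\<lambda>t. - c * v t - g (u t) * w t) absolutely_integrable_on {0..T}"
  proof (rule set_integral_diff)
    show "set_integrable lebesgue {0..T} (\<lambda>t. - c * v t)"
      by (intro absolutely_integrable_continuous_real continuous_intros v)
    show "set_integrable lebesgue {0..T} (\<lambda>t. g (u t) * w t)"
      by (rule absolutely_integrable_bounded_measurable_product_real[OF _ _ _ w])
        (auto intro!: continuous_imp_measurable_on_sets_lebesgue gu compact_imp_bounded compact_continuous_image)
  qed
  then have "F absolutely_integrable_on {0..T}"
    by (rule absolutely_integrable_spike[OF _ negligible_empty]) (use Feq in auto)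
  then have Fabs: "F absolutely_integrable_on {p..q}" for p q
    by (rule absolutely_integrable_on_periodic[where f = F, OF T Fper])
  have lac: "locally_abs_continuous ?v"
    by (rule indefinite_integral_locally_abs_continuous[OF Fint Fabs])
  have "AE t in lebesgue. (?v has_real_derivative F t) (at t)"
    by (rule indefinite_integral_AE_derivative[OF Fint])
  then have ae: "AE t in lebesgue. \<exists>d. (?v has_real_derivative d) (at t) \<and> d + c * ?v t + w t * g (?u t) = 0"
    by eventually_elim (auto simp: F_def)
  have "caratheodory_solution c w g ?u"
    unfolding caratheodory_solution_def
    using has_real_derivative_periodic_extension[OF T u0 v0 der]
      locally_abs_continuous_imp_continuous[OF lac] lac ae by blast
  moreover have "?u t > 0" for t
    unfolding periodic_extension_def by (rule pos[OF periodic_extension_mem[OF T]])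
  ultimately show ?thesis
    using periodic_extension_periodic[OF T] by (simp add: positive_periodic_solution_def)
qed

section \<open>Differential inequalities\<close>

lemma derivative_ge_imp_growth:
  fixes u v :: "real \<Rightarrow> real"
  assumes der: "\<And>t. t \<in> {P..Q} \<Longrightarrow> (u has_real_derivative v t) (at t within {P..Q})"
    and pq: "P \<le> p" "p \<le> q" "q \<le> Q" and m: "\<And>t. p \<le> t \<Longrightarrow> t \<le> q \<Longrightarrow> v t \<ge> m"
  shows "u q - u p \<ge> m * (q - p)"
proof -
  have cont: "continuous_on {P..Q} u" using der by (intro DERIV_continuous_on) auto
  have "u p - m * p \<le> u q - m * q"
  proof (rule DERIV_nonneg_imp_increasing_open[OF pq(2)])
    fix x assume x: "p < x" "x < q"
    have "at x within {P..Q} = at x" using x pq by (intro at_within_Icc_at) auto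
    then have "(u has_real_derivative v x) (at x)" using der[of x] x pq by simp
    then have "((\<lambda>t. u t - m * t) has_real_derivative v x - m) (at x)"
      by (auto intro!: derivative_eq_intros)
    then show "\<exists>y. ((\<lambda>t. u t - m * t) has_real_derivative y) (at x) \<and> y \<ge> 0" using m[of x] x by fastforce
  qed (use continuous_on_subset[OF cont] pq in \<open>auto intro!: continuous_intros\<close>)
  then show ?thesis by (simp add: algebra_simps)
qed

lemma derivative_le_imp_growth:
  fixes u v :: "real \<Rightarrow> real"
  assumes der: "\<And>t. t \<in> {P..Q} \<Longrightarrow> (u has_real_derivative v t) (at t within {P..Q})"
    and pq: "P \<le> p" "p \<le> q" "q \<le> Q" and m: "\<And>t. p \<le> t \<Longrightarrow> t \<le> q \<Longrightarrow> v t \<le> m"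
  shows "u q - u p \<le> m * (q - p)"
proof -
  have "(- u q) - (- u p) \<ge> (- m) * (q - p)"
    by (rule derivative_ge_imp_growth[OF DERIV_minus[OF der] pq]) (use m in auto)
  then show ?thesis by simp
qed

text \<open>If \<open>u'' + c u' \<le> 0\<close> in the weak sense that \<open>u' + c u\<close> is nonincreasing, then \<open>exp (c t) * u'\<close> is
nonincreasing. No second derivative is needed: the proof compares \<open>c * exp (c t) * u\<close> with a multiple
of \<open>exp (c t)\<close>.\<close>

lemma exp_mult_derivative_antimono:
  fixes u v :: "real \<Rightarrow> real"
  assumes der: "\<And>t. t \<in> {P..Q} \<Longrightarrow> (u has_real_derivative v t) (at t within {P..Q})"
    and W: "\<And>p q. P \<le> p \<Longrightarrow> p \<le> q \<Longrightarrow> q \<le> Q \<Longrightarrow> v q + c * u q \<le> v p + c * u p"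
    and pq: "P \<le> p" "p \<le> q" "q \<le> Q"
  shows "exp (c * q) * v q \<le> exp (c * p) * v p"
proof -
  define \<phi> where "\<phi> K t = c * exp (c * t) * u t - K * exp (c * t)" for K t
  have d\<phi>: "(\<phi> K has_real_derivative c * exp (c * t) * (v t + c * u t - K)) (at t within {P..Q})"
    if "t \<in> {P..Q}" for K t
    unfolding \<phi>_def by (auto intro!: derivative_eq_intros der[OF that] simp: algebra_simps)
  \<comment> \<open>The value of \<open>u' + c u\<close> at the end point for which the derivative of \<open>\<phi> K\<close> is nonnegative.\<close>
  define K where "K = (if c \<ge> 0 then v q + c * u q else v p + c * u p)"
  have "\<phi> K q - \<phi> K p \<ge> 0 * (q - p)"
  proof (rule derivative_ge_imp_growth[OF d\<phi> pq])
    fix t assume t: "p \<le> t" "t \<le> q"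
    show "0 \<le> c * exp (c * t) * (v t + c * u t - K)"
    proof (cases "c \<ge> 0")
      case True
      then show ?thesis using W[of t q] t pq by (simp add: K_def)
    next
      case False
      then have "v t + c * u t - K \<le> 0" using W[of p t] t pq by (simp add: K_def)
      with False show ?thesis by (intro mult_nonpos_nonpos) (auto simp: mult_nonpos_nonneg)
    qed
  qed
  then have \<phi>: "\<phi> K q \<ge> \<phi> K p" by simp
  have WW: "(v p + c * u p) - (v q + c * u q) \<ge> 0" using W[OF pq] by simp
  show ?thesis
  proof (cases "c \<ge> 0")
    case True
    have "exp (c * p) * ((v p + c * u p) - (v q + c * u q)) \<ge> 0" using WW by simp
    then show ?thesis using \<phi> True by (simp add: \<phi>_def K_def algebra_simps)
  next
    case False
    have "exp (c * q) * ((v p + c * u p) - (v q + c * u q)) \<ge> 0" using WW by simp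
    then show ?thesis using \<phi> False by (simp add: \<phi>_def K_def algebra_simps)
  qed
qed

text \<open>A nonnegative function for which \<open>exp (c t) * u'\<close> is nonincreasing has \<open>\<bar>u'\<bar>\<close> bounded by a multiple of
\<open>u\<close> away from the ends of the interval: a steep slope persists on one side, along which \<open>u\<close> would
become negative.\<close>

lemma log_derivative_bound:
  fixes u v :: "real \<Rightarrow> real"
  assumes der: "\<And>t. t \<in> {P..Q} \<Longrightarrow> (u has_real_derivative v t) (at t within {P..Q})"
    and E: "\<And>p q. P \<le> p \<Longrightarrow> p \<le> q \<Longrightarrow> q \<le> Q \<Longrightarrow> exp (c * q) * v q \<le> exp (c * p) * v p"
    and u: "\<And>t. t \<in> {P..Q} \<Longrightarrow> u t \<ge> 0" and T: "Q - P \<le> T"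
    and \<eta>: "\<eta> > 0" and t: "P + \<eta> \<le> t" "t \<le> Q - \<eta>"
  shows "\<bar>v t\<bar> \<le> exp (\<bar>c\<bar> * T) / \<eta> * u t"
proof -
  let ?e = "exp (- (\<bar>c\<bar> * T))"
  have ee: "exp (\<bar>c\<bar> * T) * ?e = 1" by (simp flip: exp_add)
  have expo: "exp (c * (r - s)) \<ge> ?e" if "r \<in> {P..Q}" "s \<in> {P..Q}" for r s
  proof -
    have "\<bar>c * (r - s)\<bar> \<le> \<bar>c\<bar> * T" unfolding abs_mult using that T by (intro mult_left_mono) auto
    then show ?thesis by simp
  qed
  have cmp: "v s \<ge> exp (c * (r - s)) * v r" if "P \<le> s" "s \<le> r" "r \<le> Q" for r s
  proof -
    have "exp (- (c * s)) * (exp (c * r) * v r) \<le> exp (- (c * s)) * (exp (c * s) * v s)"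
      using E[OF that] by (intro mult_left_mono) auto
    then show ?thesis by (simp add: mult.assoc[symmetric] right_diff_distrib flip: exp_add)
  qed
  have "\<eta> * (?e * \<bar>v t\<bar>) \<le> u t"
  proof (cases "v t \<ge> 0")
    case True
    have "u t - u P \<ge> (?e * v t) * (t - P)"
    proof (rule derivative_ge_imp_growth[OF der])
      fix s assume s: "P \<le> s" "s \<le> t"
      have "?e * v t \<le> exp (c * (t - s)) * v t"
        using expo[of t s] True s t \<eta> by (intro mult_right_mono) auto
      then show "?e * v t \<le> v s" using cmp[of s t] s t \<eta> by linarith
    qed (use t \<eta> in auto)
    moreover have "(?e * v t) * (t - P) \<ge> (?e * v t) * \<eta>" using t True by (intro mult_left_mono) auto
    moreover have "u P \<ge> 0" using u t \<eta> by simp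
    moreover have "\<eta> * (?e * \<bar>v t\<bar>) = (?e * v t) * \<eta>" using True by simp
    ultimately show ?thesis by linarith
  next
    case False
    have "u Q - u t \<le> (?e * v t) * (Q - t)"
    proof (rule derivative_le_imp_growth[OF der])
      fix s assume s: "t \<le> s" "s \<le> Q"
      have "exp (c * (s - t)) * v s \<le> v t" using cmp[of t s] s t \<eta> by simp
      then have "exp (c * (t - s)) * (exp (c * (s - t)) * v s) \<le> exp (c * (t - s)) * v t"
        by (intro mult_left_mono) auto
      then have "v s \<le> exp (c * (t - s)) * v t"
        by (simp add: mult.assoc[symmetric] right_diff_distrib flip: exp_add)
      moreover have "exp (c * (t - s)) * v t \<le> ?e * v t"
        using expo[of t s] False s t \<eta> by (intro mult_right_mono_neg) auto
      ultimately show "v s \<le> ?e * v t" by linarith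
    qed (use t \<eta> in auto)
    moreover have "(?e * v t) * (Q - t) \<le> (?e * v t) * \<eta>"
      using t False by (intro mult_left_mono_neg) (auto simp: mult_nonneg_nonpos)
    moreover have "u Q \<ge> 0" using u t \<eta> by simp
    moreover have "\<eta> * (?e * \<bar>v t\<bar>) = - ((?e * v t) * \<eta>)" using False by simp
    ultimately show ?thesis by linarith
  qed
  then have "exp (\<bar>c\<bar> * T) / \<eta> * (\<eta> * (?e * \<bar>v t\<bar>)) \<le> exp (\<bar>c\<bar> * T) / \<eta> * u t"
    using \<eta> by (intro mult_left_mono) auto
  then show ?thesis using \<eta> ee by (simp add: mult.assoc[symmetric])
qed

lemma harnack_of_log_derivative_bound:
  fixes u v :: "real \<Rightarrow> real"
  assumes der: "\<And>t. t \<in> {P..Q} \<Longrightarrow> (u has_real_derivative v t) (at t within {P..Q})"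
    and log: "\<And>t. t \<in> {P..Q} \<Longrightarrow> \<bar>v t\<bar> \<le> D * u t" and pq: "P \<le> p" "p \<le> q" "q \<le> Q"
  shows "u q \<le> exp (D * (q - p)) * u p" and "u p \<le> exp (D * (q - p)) * u q"
proof -
  have d: "((\<lambda>t. exp (k * t) * u t) has_real_derivative exp (k * t) * (v t + k * u t)) (at t within {P..Q})"
    if "t \<in> {P..Q}" for t k
    by (auto intro!: derivative_eq_intros der[OF that] simp: algebra_simps)
  have "exp (- D * q) * u q - exp (- D * p) * u p \<le> 0 * (q - p)"
  proof (rule derivative_le_imp_growth[OF d pq])
    show "exp (- D * t) * (v t + - D * u t) \<le> 0" if "p \<le> t" "t \<le> q" for t
      using log[of t] that pq by (intro mult_nonneg_nonpos) (auto simp: abs_le_iff)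
  qed
  then have "exp (D * q) * (exp (- D * q) * u q) \<le> exp (D * q) * (exp (- D * p) * u p)"
    by (intro mult_left_mono) auto
  then show "u q \<le> exp (D * (q - p)) * u p"
    by (simp add: mult.assoc[symmetric] right_diff_distrib flip: exp_add)
  have "exp (D * q) * u q - exp (D * p) * u p \<ge> 0 * (q - p)"
  proof (rule derivative_ge_imp_growth[OF d pq])
    show "exp (D * t) * (v t + D * u t) \<ge> 0" if "p \<le> t" "t \<le> q" for t
      using log[of t] that pq by (intro mult_nonneg_nonneg) (auto simp: abs_le_iff)
  qed
  then have "exp (- (D * p)) * (exp (D * p) * u p) \<le> exp (- (D * p)) * (exp (D * q) * u q)"
    by (intro mult_left_mono) auto
  then show "u p \<le> exp (D * (q - p)) * u q"
    by (simp add: mult.assoc[symmetric] right_diff_distrib flip: exp_add)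
qed

text \<open>A Gronwall inequality for an integrable kernel, valid forwards and backwards. On a piece where the
kernel has integral at most \<open>1/2\<close> the function \<open>z\<close> varies at most by the factor \<open>2\<close>; the interval
is exhausted by \<open>k + 1\<close> such pieces, found by the intermediate value theorem.\<close>

lemma gronwall_two_sided:
  fixes z \<omega> :: "real \<Rightarrow> real" and k :: nat
  assumes \<omega>: "\<omega> integrable_on {A..B}" "\<And>t. t \<in> {A..B} \<Longrightarrow> \<omega> t \<ge> 0"
    and z: "continuous_on {A..B} z" "\<And>t. t \<in> {A..B} \<Longrightarrow> z t \<ge> 0"
    and \<omega>z: "(\<lambda>t. \<omega> t * z t) integrable_on {A..B}"
    and incr: "\<And>p q. A \<le> p \<Longrightarrow> p \<le> q \<Longrightarrow> q \<le> B \<Longrightarrow> \<bar>z q - z p\<bar> \<le> integral {p..q} (\<lambda>t. \<omega> t * z t)"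
    and k: "integral {A..B} \<omega> \<le> real (Suc k) / 2"
    and pq: "p \<in> {A..B}" "q \<in> {A..B}"
  shows "z q \<le> 2 ^ Suc k * z p"
proof -
  have small: "z r \<le> 2 * z r'"
    if h: "A \<le> p" "p \<le> q" "q \<le> B" "integral {p..q} \<omega> \<le> 1 / 2" "r \<in> {p..q}" "r' \<in> {p..q}" for p q r r'
  proof -
    have sub: "{p..q} \<subseteq> {A..B}" using h by auto
    obtain x where x: "x \<in> {p..q}" "\<And>y. y \<in> {p..q} \<Longrightarrow> z y \<le> z x"
      using continuous_attains_sup[of "{p..q}" z] continuous_on_subset[OF z(1) sub] h by auto
    have bd: "\<bar>z b - z a\<bar> \<le> z x / 2" if ab: "p \<le> a" "a \<le> b" "b \<le> q" for a b
    proof -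
      have s1: "{a..b} \<subseteq> {p..q}" using ab by auto
      have s2: "{a..b} \<subseteq> {A..B}" using s1 sub by auto
      have "\<bar>z b - z a\<bar> \<le> integral {a..b} (\<lambda>t. \<omega> t * z t)" using ab h by (intro incr) auto
      also have "\<dots> \<le> integral {a..b} (\<lambda>t. \<omega> t * z x)"
      proof (rule integral_le)
        show "(\<lambda>t. \<omega> t * z t) integrable_on {a..b}" by (rule integrable_on_subinterval[OF \<omega>z s2])
        show "(\<lambda>t. \<omega> t * z x) integrable_on {a..b}"
          by (intro integrable_on_mult_left integrable_on_subinterval[OF \<omega>(1) s2])
        show "\<omega> t * z t \<le> \<omega> t * z x" if "t \<in> {a..b}" for t
          using that s1 s2 x(2) \<omega>(2) by (intro mult_left_mono) auto
      qed
      also have "\<dots> = integral {a..b} \<omega> * z x" by simp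
      also have "\<dots> \<le> 1 / 2 * z x"
      proof (rule mult_right_mono)
        have "integral {a..b} \<omega> \<le> integral {p..q} \<omega>"
          using s1 s2 sub \<omega> by (intro integral_subset_le integrable_on_subinterval[OF \<omega>(1)]) auto
        then show "integral {a..b} \<omega> \<le> 1 / 2" using h by simp
      qed (use z(2) x sub in auto)
      finally show ?thesis by simp
    qed
    have "\<bar>z x - z r'\<bar> \<le> z x / 2"
      using bd[of x r'] bd[of r' x] x h by (cases "x \<le> r'") (auto simp: abs_minus_commute)
    moreover have "z r \<le> z x" using x h by auto
    ultimately show ?thesis by linarith
  qed
  have main: "z q \<le> 2 ^ Suc k * z p \<and> z p \<le> 2 ^ Suc k * z q"
    if "A \<le> p" "p \<le> q" "q \<le> B" "integral {p..q} \<omega> \<le> real (Suc k) / 2" for p q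
    using that
  proof (induction k arbitrary: q)
    case 0
    then show ?case using small[of p q p q] small[of p q q p] by auto
  next
    case (Suc k)
    show ?case
    proof (cases "integral {p..q} \<omega> \<le> real (Suc k) / 2")
      case True
      have "z q \<le> 2 ^ Suc k * z p" "z p \<le> 2 ^ Suc k * z q" using Suc.IH[of q] Suc.prems True by auto
      moreover have "2 ^ Suc k * z r \<le> 2 ^ Suc (Suc k) * z r" if "r \<in> {A..B}" for r
        using z(2)[OF that] by (intro mult_right_mono) auto
      ultimately show ?thesis using Suc.prems by (meson atLeastAtMost_iff order_trans)
    next
      case False
      have \<omega>pq: "\<omega> integrable_on {p..q}"
        using integrable_on_subinterval[OF \<omega>(1), of p q] Suc.prems by auto
      have "\<exists>m\<ge>p. m \<le> q \<and> integral {p..m} \<omega> = real (Suc k) / 2"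
        using False Suc.prems indefinite_integral_continuous_1[OF \<omega>pq]
        by (intro IVT') auto
      then obtain m where m: "p \<le> m" "m \<le> q" "integral {p..m} \<omega> = real (Suc k) / 2" by blast
      have "integral {p..m} \<omega> + integral {m..q} \<omega> = integral {p..q} \<omega>"
        using m \<omega>pq by (intro Henstock_Kurzweil_Integration.integral_combine) auto
      then have half: "integral {m..q} \<omega> \<le> 1 / 2" using m Suc.prems by (simp add: field_simps)
      have "z q \<le> 2 * z m" "z m \<le> 2 * z q"
        using small[of m q q m] small[of m q m q] half m Suc.prems by auto
      moreover define E where "E = (2::real) ^ Suc k"
      have "z m \<le> E * z p" "z p \<le> E * z m"
        using Suc.IH[of m] m Suc.prems by (auto simp: E_def)
      moreover have "E * z m \<le> E * (2 * z q)"
        using calculation(2) by (intro mult_left_mono) (auto simp: E_def)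
      ultimately have "z q \<le> 2 * (E * z p)" "z p \<le> 2 * (E * z q)" by linarith+
      then show ?thesis by (simp add: E_def)
    qed
  qed
  have mono: "integral {p..q} \<omega> \<le> real (Suc k) / 2" if "A \<le> p" "q \<le> B" for p q
  proof -
    have "integral {p..q} \<omega> \<le> integral {A..B} \<omega>"
      using that \<omega> by (intro integral_subset_le integrable_on_subinterval[OF \<omega>(1)]) auto
    then show ?thesis using k by simp
  qed
  show ?thesis
  proof (cases "p \<le> q")
    case True
    then show ?thesis using main[of p q] mono[of p q] pq by auto
  next
    case False
    then show ?thesis using main[of q p] mono[of q p] pq by auto
  qed
qed

section \<open>Periodic solutions with a constant multiplier\<close>

text \<open>\<open>T\<close>-periodic solutions, on the period \<open>[0, T]\<close>, of \<open>u'' + c u' + f(t) + \<alpha> = 0\<close>, where \<open>v\<close> is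
\<open>u'\<close> and the equation is integrated once. The function \<open>f\<close> stands for \<open>w(t) g(u(t))\<close>; the constant
\<open>\<alpha>\<close> is the multiplier that makes a periodic solution possible.\<close>

definition multiplier_solution :: "real \<Rightarrow> real \<Rightarrow> (real \<Rightarrow> real) \<Rightarrow> real \<Rightarrow> (real \<Rightarrow> real) \<Rightarrow> (real \<Rightarrow> real) \<Rightarrow> bool" where
  "multiplier_solution T c f \<alpha> u v \<longleftrightarrow>
     f integrable_on {0..T} \<and> continuous_on {0..T} v \<and>
     (\<forall>t\<in>{0..T}. (u has_real_derivative v t) (at t within {0..T})) \<and> u 0 = u T \<and> v 0 = v T \<and>
     (\<forall>p q. 0 \<le> p \<longrightarrow> p \<le> q \<longrightarrow> q \<le> T \<longrightarrow>
        v q - v p = - c * (u q - u p) - integral {p..q} f - \<alpha> * (q - p))"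

lemma multiplier_solution_derivative:
  assumes "multiplier_solution T c f \<alpha> u v" "t \<in> {0..T}"
  shows "(u has_real_derivative v t) (at t within {0..T})"
  using assms by (simp add: multiplier_solution_def)

lemma multiplier_solution_increment:
  assumes "multiplier_solution T c f \<alpha> u v" "0 \<le> p" "p \<le> q" "q \<le> T"
  shows "v q - v p = - c * (u q - u p) - integral {p..q} f - \<alpha> * (q - p)"
  using assms by (simp add: multiplier_solution_def)

lemma multiplier_solution_periodic:
  assumes "multiplier_solution T c f \<alpha> u v"
  shows "u 0 = u T" and "v 0 = v T"
  using assms by (simp_all add: multiplier_solution_def)

lemma multiplier_solution_mean:
  assumes T: "T > 0" and sol: "multiplier_solution T c f \<alpha> u v"
  shows "\<alpha> = - integral {0..T} f / T"
proof -
  have "\<alpha> * T = - integral {0..T} f"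
    using multiplier_solution_increment[OF sol, of 0 T] multiplier_solution_periodic[OF sol] T by simp
  then show ?thesis using T by (simp add: field_simps)
qed

lemma periodic_min_imp_zero_derivative:
  fixes u v :: "real \<Rightarrow> real"
  assumes T: "T > 0" and der: "\<And>t. t \<in> {0..T} \<Longrightarrow> (u has_real_derivative v t) (at t within {0..T})"
    and per: "u 0 = u T" "v 0 = v T"
    and t: "t \<in> {0..T}" and min: "\<And>s. s \<in> {0..T} \<Longrightarrow> u t \<le> u s"
  shows "v t = 0"
proof (cases "0 < t \<and> t < T")
  case True
  then have "(u has_real_derivative v t) (at t)" using der[OF t] by (simp add: at_within_Icc_at)
  then show ?thesis
  proof (rule DERIV_local_min)
    show "0 < min t (T - t)" using True by simp
    show "\<forall>s. \<bar>t - s\<bar> < min t (T - t) \<longrightarrow> u t \<le> u s"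
    proof (intro allI impI)
      fix s assume "\<bar>t - s\<bar> < min t (T - t)"
      then show "u t \<le> u s" by (intro min) (auto simp: abs_if split: if_splits)
    qed
  qed
next
  case False
  then have ut: "u 0 = u t" "u T = u t" "v t = v 0" using t per by auto
  have "v 0 \<ge> 0"
  proof (rule ccontr)
    assume "\<not> v 0 \<ge> 0"
    then obtain d where d: "d > 0" "\<And>h. h > 0 \<Longrightarrow> 0 + h \<in> {0..T} \<Longrightarrow> h < d \<Longrightarrow> u 0 > u (0 + h)"
      using has_real_derivative_neg_dec_right[OF der[of 0]] T by auto
    define h where "h = min (d / 2) T"
    have "u 0 > u (0 + h)" using d T by (intro d(2)) (auto simp: h_def)
    moreover have "u t \<le> u h" using d T by (intro min) (auto simp: h_def)
    ultimately show False using ut by simp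
  qed
  moreover have "v T \<le> 0"
  proof (rule ccontr)
    assume "\<not> v T \<le> 0"
    then obtain d where d: "d > 0" "\<And>h. h > 0 \<Longrightarrow> T - h \<in> {0..T} \<Longrightarrow> h < d \<Longrightarrow> u (T - h) < u T"
      using has_real_derivative_pos_inc_left[OF der[of T]] T by auto
    define h where "h = min (d / 2) T"
    have "u (T - h) < u T" using d T by (intro d(2)) (auto simp: h_def)
    moreover have "u t \<le> u (T - h)" using d T by (intro min) (auto simp: h_def)
    ultimately show False using ut by simp
  qed
  ultimately show ?thesis using ut per by simp
qed

lemma first_zero:
  fixes u :: "real \<Rightarrow> real"
  assumes cont: "continuous_on {a..b} u" and "a \<le> b" "u a < 0" "u b > 0"
  obtains t where "t \<in> {a..b}" "u t = 0" "\<And>s. a \<le> s \<Longrightarrow> s \<le> t \<Longrightarrow> u s \<le> 0"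
proof -
  define S where "S = {t \<in> {a..b}. u t = 0}"
  have "\<exists>x\<ge>a. x \<le> b \<and> u x = 0" using assms by (intro IVT') auto
  then have ne: "S \<noteq> {}" by (auto simp: S_def)
  have "closed S" unfolding S_def by (rule continuous_closed_preimage_constant[OF cont]) simp
  moreover have bb: "bdd_below S" by (auto simp: S_def bdd_below_def)
  ultimately have inS: "Inf S \<in> S" using ne closed_contains_Inf by blast
  have "u s \<le> 0" if s: "a \<le> s" "s \<le> Inf S" for s
  proof (rule ccontr)
    assume "\<not> u s \<le> 0"
    then have us: "u s > 0" by simp
    have sb: "s \<le> b" using s inS by (auto simp: S_def)
    have "continuous_on {a..s} u" using continuous_on_subset[OF cont] sb by auto
    then have "\<exists>x\<ge>a. x \<le> s \<and> u x = 0" using us assms s by (intro IVT') auto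
    then obtain x where x: "a \<le> x" "x \<le> s" "u x = 0" by blast
    then have "x \<in> S" using sb by (auto simp: S_def)
    then have "Inf S \<le> x" using bb by (intro cInf_lower)
    then have "x = s" using x s by simp
    then show False using x us by simp
  qed
  with that[of "Inf S"] inS show thesis by (auto simp: S_def)
qed

lemma last_zero:
  fixes u :: "real \<Rightarrow> real"
  assumes cont: "continuous_on {a..b} u" and "a \<le> b" "u a > 0" "u b < 0"
  obtains t where "t \<in> {a..b}" "u t = 0" "\<And>s. t \<le> s \<Longrightarrow> s \<le> b \<Longrightarrow> u s \<le> 0"
proof (rule first_zero[of "- b" "- a" "\<lambda>t. u (- t)"])
  show "continuous_on {- b..- a} (\<lambda>t. u (- t))"
    by (rule continuous_on_compose2[OF cont]) (auto intro!: continuous_intros)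
  fix t assume t: "t \<in> {- b..- a}" "u (- t) = 0" "\<And>s. - b \<le> s \<Longrightarrow> s \<le> t \<Longrightarrow> u (- s) \<le> 0"
  show thesis
  proof (rule that[of "- t"])
    show "u s \<le> 0" if "- t \<le> s" "s \<le> b" for s using t(3)[of "- s"] that by simp
  qed (use t in auto)
qed (use assms in auto)

text \<open>Where \<open>u \<le> 0\<close> the forcing vanishes, so \<open>exp (c t) * u'\<close> is nonincreasing there. Starting from a
negative minimum, \<open>u\<close> could therefore not return to positive values.\<close>

lemma multiplier_solution_nonneg:
  assumes T: "T > 0" and sol: "multiplier_solution T c f \<alpha> u v" and \<alpha>: "\<alpha> \<ge> 0"
    and t0: "t0 \<in> {0..T}" "u t0 > 0" and f: "\<And>t. t \<in> {0..T} \<Longrightarrow> u t \<le> 0 \<Longrightarrow> f t = 0"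
    and t: "t \<in> {0..T}"
  shows "u t \<ge> 0"
proof (rule ccontr)
  assume neg: "\<not> u t \<ge> 0"
  have der: "(u has_real_derivative v t) (at t within {0..T})" if "t \<in> {0..T}" for t
    using sol that by (simp add: multiplier_solution_def)
  have per: "u 0 = u T" "v 0 = v T" using sol by (auto simp: multiplier_solution_def)
  have cont: "continuous_on {0..T} u" using der by (intro DERIV_continuous_on) auto
  obtain t1 where t1: "t1 \<in> {0..T}" "\<And>s. s \<in> {0..T} \<Longrightarrow> u t1 \<le> u s"
    using continuous_attains_inf[of "{0..T}" u] cont T by auto
  have v1: "v t1 = 0" by (rule periodic_min_imp_zero_derivative[OF T der per t1])
  have u1: "u t1 < 0" using t1(2)[OF t] neg by simp
  have anti: "exp (c * q) * v q \<le> exp (c * p) * v p"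
    if PQ: "0 \<le> P" "Q \<le> T" "\<And>s. P \<le> s \<Longrightarrow> s \<le> Q \<Longrightarrow> u s \<le> 0" and pq: "P \<le> p" "p \<le> q" "q \<le> Q" for P Q p q
  proof (rule exp_mult_derivative_antimono[of P Q u v c, OF _ _ pq])
    show "(u has_real_derivative v t) (at t within {P..Q})" if "t \<in> {P..Q}" for t
      by (rule DERIV_subset[OF der]) (use that PQ in auto)
    show "v q + c * u q \<le> v p + c * u p" if "P \<le> p" "p \<le> q" "q \<le> Q" for p q
    proof -
      have "integral {p..q} f = integral {p..q} (\<lambda>_. 0)"
        using f PQ that by (intro Henstock_Kurzweil_Integration.integral_cong) auto
      moreover have "v q - v p = - c * (u q - u p) - integral {p..q} f - \<alpha> * (q - p)"
        using sol PQ that by (simp add: multiplier_solution_def)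
      moreover have "\<alpha> * (q - p) \<ge> 0" using \<alpha> that by simp
      ultimately show ?thesis by (simp add: algebra_simps)
    qed
  qed
  show False
  proof (cases "t1 \<le> t0")
    case True
    obtain t2 where t2: "t2 \<in> {t1..t0}" "u t2 = 0" "\<And>s. t1 \<le> s \<Longrightarrow> s \<le> t2 \<Longrightarrow> u s \<le> 0"
      using first_zero[of t1 t0 u] continuous_on_subset[OF cont] True t1 t0 u1 by auto
    have "u t2 - u t1 \<le> 0 * (t2 - t1)"
    proof (rule derivative_le_imp_growth[OF der])
      show "v s \<le> 0" if "t1 \<le> s" "s \<le> t2" for s
        using anti[of t1 t2 t1 s] t2 t1 t0 that v1 by (simp add: mult_le_0_iff)
    qed (use t1 t2 t0 in auto)
    then show False using t2 u1 by simp
  next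
    case False
    obtain t2 where t2: "t2 \<in> {t0..t1}" "u t2 = 0" "\<And>s. t2 \<le> s \<Longrightarrow> s \<le> t1 \<Longrightarrow> u s \<le> 0"
      using last_zero[of t0 t1 u] continuous_on_subset[OF cont] False t1 t0 u1 by auto
    have "u t1 - u t2 \<ge> 0 * (t1 - t2)"
    proof (rule derivative_ge_imp_growth[OF der])
      show "v s \<ge> 0" if "t2 \<le> s" "s \<le> t1" for s
        using anti[of t2 t1 s t1] t2 t1 t0 that v1 by (simp add: zero_le_mult_iff)
    qed (use t1 t2 t0 in auto)
    then show False using t2 u1 by simp
  qed
qed

text \<open>With \<open>\<alpha> = 0\<close> and \<open>\<bar>f\<bar> \<le> K \<bar>w\<bar> \<bar>u\<bar>\<close>, the size of \<open>(u, u')\<close> at any point of the period controls its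
size at any other point.\<close>

lemma multiplier_solution_gronwall:
  fixes k :: nat
  assumes sol: "multiplier_solution T c f 0 u v" and w: "w absolutely_integrable_on {0..T}" and K: "K \<ge> 0"
    and f: "\<And>t. t \<in> {0..T} \<Longrightarrow> \<bar>f t\<bar> \<le> K * \<bar>w t\<bar> * \<bar>u t\<bar>"
    and k: "integral {0..T} (\<lambda>t. 1 + \<bar>c\<bar> + K * \<bar>w t\<bar>) \<le> real (Suc k) / 2"
    and pq: "p \<in> {0..T}" "q \<in> {0..T}"
  shows "\<bar>u q\<bar> + \<bar>v q\<bar> \<le> 2 ^ Suc k * (\<bar>u p\<bar> + \<bar>v p\<bar>)"
proof -
  have der: "(u has_real_derivative v t) (at t within {0..T})" if "t \<in> {0..T}" for t
    using sol that by (simp add: multiplier_solution_def)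
  have uc: "continuous_on {0..T} u" using der by (intro DERIV_continuous_on) auto
  have vc: "continuous_on {0..T} v" using sol by (simp add: multiplier_solution_def)
  define \<omega> where "\<omega> t = 1 + \<bar>c\<bar> + K * \<bar>w t\<bar>" for t
  define z where "z t = \<bar>u t\<bar> + \<bar>v t\<bar>" for t
  have zc: "continuous_on {0..T} z" unfolding z_def by (intro continuous_intros uc vc)
  have wabs: "(\<lambda>t. \<bar>w t\<bar>) absolutely_integrable_on {0..T}"
    using absolutely_integrable_norm[OF w] by (simp add: o_def)
  have \<omega>a: "\<omega> absolutely_integrable_on {0..T}"
    unfolding \<omega>_def by (intro set_integral_add set_integrable_mult_right wabs absolutely_integrable_on_const) auto
  have \<omega>i: "\<omega> integrable_on {0..T}" using \<omega>a set_lebesgue_integral_eq_integral(1) by blast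
  have "(\<lambda>t. z t * \<omega> t) absolutely_integrable_on {0..T}"
    by (rule absolutely_integrable_bounded_measurable_product_real[OF _ _ _ \<omega>a])
      (auto intro!: continuous_imp_measurable_on_sets_lebesgue zc compact_imp_bounded compact_continuous_image)
  then have \<omega>zi: "(\<lambda>t. \<omega> t * z t) integrable_on {0..T}"
    using set_lebesgue_integral_eq_integral(1) by (simp add: mult.commute)
  have "z q \<le> 2 ^ Suc k * z p"
  proof (rule gronwall_two_sided[OF \<omega>i _ zc _ \<omega>zi _ _ pq])
    show "integral {0..T} \<omega> \<le> real (Suc k) / 2" using k by (simp add: \<omega>_def[abs_def])
    show "0 \<le> \<omega> t" for t using K by (simp add: \<omega>_def)
    show "0 \<le> z t" for t by (simp add: z_def)
    fix p q assume pq: "0 \<le> p" "p \<le> q" "q \<le> T"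
    have sub: "{p..q} \<subseteq> {0..T}" using pq by auto
    have vci: "continuous_on {p..q} v" by (rule continuous_on_subset[OF vc sub])
    have "(v has_integral (u q - u p)) {p..q}"
    proof (rule fundamental_theorem_of_calculus)
      show "(u has_vector_derivative v t) (at t within {p..q})" if "t \<in> {p..q}" for t
        unfolding has_real_derivative_iff_has_vector_derivative[symmetric]
        by (rule DERIV_subset[OF der sub]) (use that sub in auto)
    qed (use pq in auto)
    then have ui: "u q - u p = integral {p..q} v" by (simp add: integral_unique)
    have ub: "\<bar>u q - u p\<bar> \<le> integral {p..q} (\<lambda>t. \<bar>v t\<bar>)"
      unfolding ui
      by (rule abs_integral_le_integral)
        (auto intro!: integrable_continuous_real continuous_intros vci)
    have fi: "f integrable_on {p..q}" using sol sub by (auto simp: multiplier_solution_def intro: integrable_on_subinterval)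
    have wu: "(\<lambda>t. K * \<bar>w t\<bar> * \<bar>u t\<bar>) integrable_on {p..q}"
    proof -
      have "(\<lambda>t. \<bar>u t\<bar> * \<bar>w t\<bar>) absolutely_integrable_on {0..T}"
        by (rule absolutely_integrable_bounded_measurable_product_real[OF _ _ _ wabs])
          (auto intro!: continuous_imp_measurable_on_sets_lebesgue continuous_intros uc
            compact_imp_bounded compact_continuous_image)
      then have "(\<lambda>t. K * (\<bar>u t\<bar> * \<bar>w t\<bar>)) integrable_on {p..q}"
        using set_lebesgue_integral_eq_integral(1) integrable_on_subinterval[OF _ sub]
        by (intro integrable_on_mult_right) blast
      then show ?thesis by (simp add: mult_ac)
    qed
    have fb: "\<bar>integral {p..q} f\<bar> \<le> integral {p..q} (\<lambda>t. K * \<bar>w t\<bar> * \<bar>u t\<bar>)"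
      by (rule abs_integral_le_integral)
        (use fi wu f sub in auto)
    have "v q - v p = - c * (u q - u p) - integral {p..q} f"
      using sol pq by (simp add: multiplier_solution_def)
    then have "\<bar>v q - v p\<bar> \<le> \<bar>c\<bar> * \<bar>u q - u p\<bar> + \<bar>integral {p..q} f\<bar>"
      by (simp add: abs_mult[symmetric])
    moreover have "\<bar>c\<bar> * \<bar>u q - u p\<bar> \<le> \<bar>c\<bar> * integral {p..q} (\<lambda>t. \<bar>v t\<bar>)"
      by (intro mult_left_mono ub) auto
    ultimately have "\<bar>z q - z p\<bar> \<le> integral {p..q} (\<lambda>t. \<bar>v t\<bar>) + \<bar>c\<bar> * integral {p..q} (\<lambda>t. \<bar>v t\<bar>)
        + integral {p..q} (\<lambda>t. K * \<bar>w t\<bar> * \<bar>u t\<bar>)"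
      using ub fb unfolding z_def by linarith
    also have "\<dots> = integral {p..q} (\<lambda>t. \<bar>v t\<bar> + \<bar>c\<bar> * \<bar>v t\<bar> + K * \<bar>w t\<bar> * \<bar>u t\<bar>)"
    proof -
      have i: "(\<lambda>t. \<bar>v t\<bar>) integrable_on {p..q}" "(\<lambda>t. \<bar>c\<bar> * \<bar>v t\<bar>) integrable_on {p..q}"
        by (auto intro!: integrable_continuous_real continuous_intros vci)
      show ?thesis using i wu by (simp add: integral_add integrable_add)
    qed
    also have "\<dots> \<le> integral {p..q} (\<lambda>t. \<omega> t * z t)"
    proof (rule integral_le)
      show "(\<lambda>t. \<bar>v t\<bar> + \<bar>c\<bar> * \<bar>v t\<bar> + K * \<bar>w t\<bar> * \<bar>u t\<bar>) integrable_on {p..q}"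
        by (intro integrable_add wu) (auto intro!: integrable_continuous_real continuous_intros vci)
      show "(\<lambda>t. \<omega> t * z t) integrable_on {p..q}" by (rule integrable_on_subinterval[OF \<omega>zi sub])
      show "\<bar>v t\<bar> + \<bar>c\<bar> * \<bar>v t\<bar> + K * \<bar>w t\<bar> * \<bar>u t\<bar> \<le> \<omega> t * z t" for t
        using K by (simp add: \<omega>_def z_def algebra_simps)
    qed
    finally show "\<bar>z q - z p\<bar> \<le> integral {p..q} (\<lambda>t. \<omega> t * z t)" .
  qed
  then show ?thesis by (simp add: z_def)
qed

section \<open>The linear periodic problem\<close>

text \<open>The linear periodic problem \<open>y'' + c y' + f + \<alpha> = 0\<close> with \<open>y 0 = 0\<close>, where \<open>\<alpha>\<close> is minus the mean of
\<open>f\<close>, is solved by integrating twice. The first integral is \<open>y' + c y = H + \<kappa>\<close>, where \<open>H\<close> is the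
primitive of minus the centred function \<open>f\<close> with \<open>H 0 = H T = 0\<close>:\<close>

definition centred_primitive :: "real \<Rightarrow> (real \<Rightarrow> real) \<Rightarrow> real \<Rightarrow> real" where
  "centred_primitive T f t = t / T * integral {0..T} f - integral {0..t} f"

text \<open>The constant \<open>\<kappa>\<close>, chosen so that \<open>y T = 0\<close>:\<close>

definition periodic_constant :: "real \<Rightarrow> real \<Rightarrow> (real \<Rightarrow> real) \<Rightarrow> real" where
  "periodic_constant T c f =
     - integral {0..T} (\<lambda>s. exp (c * s) * centred_primitive T f s) / integral {0..T} (\<lambda>s. exp (c * s))"

text \<open>The solution \<open>y\<close>, and below it \<open>y'\<close>:\<close>

definition periodic_response :: "real \<Rightarrow> real \<Rightarrow> (real \<Rightarrow> real) \<Rightarrow> real \<Rightarrow> real" where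
  "periodic_response T c f t = exp (- c * t) *
     integral {0..t} (\<lambda>s. exp (c * s) * (centred_primitive T f s + periodic_constant T c f))"

definition response_derivative :: "real \<Rightarrow> real \<Rightarrow> (real \<Rightarrow> real) \<Rightarrow> real \<Rightarrow> real" where
  "response_derivative T c f t =
     centred_primitive T f t + periodic_constant T c f - c * periodic_response T c f t"

text \<open>A constant that bounds \<open>y\<close> and \<open>y'\<close> in terms of the integral of \<open>\<bar>f\<bar>\<close>:\<close>

definition response_bound :: "real \<Rightarrow> real \<Rightarrow> real" where
  "response_bound T c = 4 + 4 * T * exp (2 * \<bar>c\<bar> * T) * (1 + \<bar>c\<bar>)"

lemma continuous_on_centred_primitive:
  assumes "T > 0" "f integrable_on {0..T}"
  shows "continuous_on {0..T} (centred_primitive T f)"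
  unfolding centred_primitive_def
  by (intro continuous_intros indefinite_integral_continuous_1 assms) (use assms in auto)

lemma exp_integral_pos:
  assumes "T > 0"
  shows "integral {0..T} (\<lambda>s. exp (c * s)) > (0::real)"
proof -
  have "integral {0..T} (\<lambda>s. exp (- \<bar>c\<bar> * T)) \<le> integral {0..T} (\<lambda>s. exp (c * s))"
  proof (rule integral_le)
    fix s assume s: "s \<in> {0..T}"
    have "\<bar>c * s\<bar> \<le> \<bar>c\<bar> * T" unfolding abs_mult using s by (intro mult_left_mono) auto
    then show "exp (- \<bar>c\<bar> * T) \<le> exp (c * s)" by simp
  qed (auto intro!: integrable_continuous_real continuous_intros)
  moreover have "integral {0..T} (\<lambda>s. exp (- \<bar>c\<bar> * T)) > 0" using assms by simp
  ultimately show ?thesis by linarith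
qed

lemma multiplier_solution_periodic_response:
  assumes T: "T > 0" and f: "f integrable_on {0..T}"
  shows "multiplier_solution T c f (- integral {0..T} f / T) (\<lambda>t. k + periodic_response T c f t) (response_derivative T c f)"
proof -
  let ?H = "centred_primitive T f" and ?\<kappa> = "periodic_constant T c f"
    and ?y = "periodic_response T c f" and ?v = "response_derivative T c f"
  have Hc: "continuous_on {0..T} ?H" by (rule continuous_on_centred_primitive[OF T f])
  have der: "(?y has_real_derivative ?v t) (at t within {0..T})" if t: "t \<in> {0..T}" for t
  proof -
    have "((\<lambda>t. integral {0..t} (\<lambda>s. exp (c * s) * (?H s + ?\<kappa>))) has_real_derivative
        exp (c * t) * (?H t + ?\<kappa>)) (at t within {0..T})"
      by (rule integral_has_real_derivative[OF _ t]) (intro continuous_intros Hc)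
    then have "(?y has_real_derivative exp (- c * t) * (exp (c * t) * (?H t + ?\<kappa>)) +
        (exp (- c * t) * - c) * integral {0..t} (\<lambda>s. exp (c * s) * (?H s + ?\<kappa>))) (at t within {0..T})"
      unfolding periodic_response_def by (auto intro!: derivative_eq_intros)
    moreover have "exp (- c * t) * (exp (c * t) * (?H t + ?\<kappa>)) = ?H t + ?\<kappa>"
      by (simp add: mult.assoc[symmetric] flip: exp_add)
    ultimately show ?thesis
      by (simp add: response_derivative_def periodic_response_def algebra_simps)
  qed
  have H0: "?H 0 = 0" "?H T = 0" using T by (auto simp: centred_primitive_def)
  have y0: "?y 0 = 0" by (simp add: periodic_response_def)
  have yT: "?y T = 0"
  proof -
    have e: "integral {0..T} (\<lambda>s. exp (c * s)) > 0" by (rule exp_integral_pos[OF T])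
    have "integral {0..T} (\<lambda>s. exp (c * s) * (?H s + ?\<kappa>)) =
        integral {0..T} (\<lambda>s. exp (c * s) * ?H s + exp (c * s) * ?\<kappa>)" by (simp add: distrib_left)
    also have "\<dots> = integral {0..T} (\<lambda>s. exp (c * s) * ?H s) + integral {0..T} (\<lambda>s. exp (c * s) * ?\<kappa>)"
      by (rule integral_add) (auto intro!: integrable_continuous_real continuous_intros Hc)
    also have "\<dots> = 0" using e by (simp add: periodic_constant_def)
    finally show ?thesis by (simp add: periodic_response_def)
  qed
  have yc: "continuous_on {0..T} ?y" using der by (intro DERIV_continuous_on) auto
  have vc: "continuous_on {0..T} ?v"
    unfolding response_derivative_def by (intro continuous_intros Hc yc)
  have rel: "?v q - ?v p = - c * (?y q - ?y p) - integral {p..q} f - (- integral {0..T} f / T) * (q - p)"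
    if "0 \<le> p" "p \<le> q" "q \<le> T" for p q
  proof -
    have "integral {0..p} f + integral {p..q} f = integral {0..q} f"
      using that integrable_on_subinterval[OF f, of 0 q]
      by (intro Henstock_Kurzweil_Integration.integral_combine) auto
    then have "?H q - ?H p = - integral {p..q} f + (q - p) / T * integral {0..T} f"
      unfolding centred_primitive_def by (simp add: diff_divide_distrib left_diff_distrib)
    then show ?thesis by (simp add: response_derivative_def algebra_simps)
  qed
  show ?thesis
    unfolding multiplier_solution_def
  proof (intro conjI ballI allI impI)
    show "((\<lambda>t. k + ?y t) has_real_derivative ?v t) (at t within {0..T})" if "t \<in> {0..T}" for t
      using DERIV_add[OF DERIV_const der[OF that], of k] by simp
    show "?v 0 = ?v T" using H0 y0 yT by (simp add: response_derivative_def)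
  qed (use f vc y0 yT rel in auto)
qed

lemma periodic_response_bounds:
  assumes T: "T > 0" and f: "f absolutely_integrable_on {0..T}" and t: "t \<in> {0..T}"
  defines "N \<equiv> integral {0..T} (\<lambda>t. \<bar>f t\<bar>)"
  shows "\<bar>periodic_response T c f t\<bar> \<le> response_bound T c * N"
    and "\<bar>response_derivative T c f t\<bar> \<le> response_bound T c * N"
proof -
  let ?H = "centred_primitive T f" and ?\<kappa> = "periodic_constant T c f"
    and ?y = "periodic_response T c f"
  have fi: "f integrable_on {0..T}" and afi: "(\<lambda>t. \<bar>f t\<bar>) integrable_on {0..T}"
    using f by (auto simp: absolutely_integrable_on_def)
  have N0: "N \<ge> 0" unfolding N_def by (rule integral_nonneg[OF afi]) auto
  have Hc: "continuous_on {0..T} ?H" by (rule continuous_on_centred_primitive[OF T fi])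
  have part: "\<bar>integral {0..s} f\<bar> \<le> N" if "s \<in> {0..T}" for s
  proof -
    have sub: "{0..s} \<subseteq> {0..T}" using that by auto
    have "\<bar>integral {0..s} f\<bar> \<le> integral {0..s} (\<lambda>t. \<bar>f t\<bar>)"
      by (rule abs_integral_le_integral)
        (auto intro: integrable_on_subinterval[OF fi sub] integrable_on_subinterval[OF afi sub])
    also have "\<dots> \<le> N" unfolding N_def
      by (rule integral_subset_le[OF sub integrable_on_subinterval[OF afi sub] afi]) auto
    finally show ?thesis .
  qed
  have H: "\<bar>?H s\<bar> \<le> 2 * N" if s: "s \<in> {0..T}" for s
  proof -
    have "\<bar>s / T * integral {0..T} f\<bar> \<le> 1 * N"
      unfolding abs_mult using s T part[of T] by (intro mult_mono) auto
    moreover have "\<bar>x - y\<bar> \<le> 2 * N" if "\<bar>x\<bar> \<le> 1 * N" "\<bar>y\<bar> \<le> N" for x y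
      using that by linarith
    ultimately show ?thesis using part[OF s] unfolding centred_primitive_def by blast
  qed
  let ?E = "integral {0..T} (\<lambda>s. exp (c * s))"
  have E: "?E > 0" by (rule exp_integral_pos[OF T])
  have "\<bar>integral {0..T} (\<lambda>s. exp (c * s) * ?H s)\<bar> \<le> integral {0..T} (\<lambda>s. exp (c * s) * (2 * N))"
  proof (rule abs_integral_le_integral)
    show "\<bar>exp (c * s) * ?H s\<bar> \<le> exp (c * s) * (2 * N)" if "s \<in> {0..T}" for s
      using H[of s] that by (simp add: abs_mult)
  qed (auto intro!: integrable_continuous_real continuous_intros Hc)
  then have "\<bar>integral {0..T} (\<lambda>s. exp (c * s) * ?H s)\<bar> \<le> ?E * (2 * N)" by simp
  then have \<kappa>: "\<bar>?\<kappa>\<bar> \<le> 2 * N"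
    using E by (simp add: periodic_constant_def abs_divide pos_divide_le_eq mult.commute)
  have expb: "exp (r * s) \<le> exp (\<bar>c\<bar> * T)" if "s \<in> {0..T}" "\<bar>r\<bar> = \<bar>c\<bar>" for r s
  proof -
    have "\<bar>r * s\<bar> \<le> \<bar>c\<bar> * T" unfolding abs_mult using that by (intro mult_mono) auto
    then show ?thesis by simp
  qed
  have "\<bar>integral {0..t} (\<lambda>s. exp (c * s) * (?H s + ?\<kappa>))\<bar> \<le> integral {0..t} (\<lambda>s. exp (\<bar>c\<bar> * T) * (4 * N))"
  proof (rule abs_integral_le_integral)
    have "continuous_on {0..t} ?H" using continuous_on_subset[OF Hc] t by auto
    then show "(\<lambda>s. exp (c * s) * (?H s + ?\<kappa>)) integrable_on {0..t}"
      by (intro integrable_continuous_real continuous_intros)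
    show "\<bar>exp (c * s) * (?H s + ?\<kappa>)\<bar> \<le> exp (\<bar>c\<bar> * T) * (4 * N)" if "s \<in> {0..t}" for s
      unfolding abs_mult using H[of s] \<kappa> expb[of s c] that t by (intro mult_mono) auto
  qed (rule integrable_const_ivl)
  also have "\<dots> \<le> T * (exp (\<bar>c\<bar> * T) * (4 * N))" using t N0 by (auto intro!: mult_right_mono)
  finally have I: "\<bar>integral {0..t} (\<lambda>s. exp (c * s) * (?H s + ?\<kappa>))\<bar> \<le> T * (exp (\<bar>c\<bar> * T) * (4 * N))" .
  have "\<bar>?y t\<bar> \<le> exp (\<bar>c\<bar> * T) * (T * (exp (\<bar>c\<bar> * T) * (4 * N)))"
    unfolding periodic_response_def abs_mult
    using I expb[of t "- c"] t T N0 by (intro mult_mono) auto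
  also have "\<dots> = 4 * T * exp (2 * \<bar>c\<bar> * T) * N"
    by (simp add: mult_ac flip: exp_add)
  finally have y: "\<bar>?y t\<bar> \<le> 4 * T * exp (2 * \<bar>c\<bar> * T) * N" .
  define M where "M = 4 * T * exp (2 * \<bar>c\<bar> * T) * N"
  have M0: "M \<ge> 0" using T N0 by (simp add: M_def)
  have rb: "response_bound T c * N = 4 * N + M + \<bar>c\<bar> * M"
    by (simp add: response_bound_def M_def algebra_simps)
  have "\<bar>c\<bar> * M \<ge> 0" using M0 by simp
  with y M0 N0 show "\<bar>?y t\<bar> \<le> response_bound T c * N" unfolding rb M_def[symmetric] by linarith
  have "\<bar>c * ?y t\<bar> \<le> \<bar>c\<bar> * M" unfolding abs_mult using y by (intro mult_left_mono) (auto simp: M_def)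
  with H[OF t] \<kappa> M0 show "\<bar>response_derivative T c f t\<bar> \<le> response_bound T c * N"
    unfolding rb response_derivative_def by linarith
qed

lemma periodic_response_diff:
  assumes T: "T > 0" and f: "f integrable_on {0..T}" and g: "g integrable_on {0..T}" and t: "t \<in> {0..T}"
  shows "periodic_response T c (\<lambda>t. f t - g t) t = periodic_response T c f t - periodic_response T c g t"
proof -
  have H: "centred_primitive T (\<lambda>t. f t - g t) s = centred_primitive T f s - centred_primitive T g s"
    if "s \<in> {0..T}" for s
  proof -
    have "f integrable_on {0..s}" "g integrable_on {0..s}"
      using f g that by (auto intro: integrable_on_subinterval)
    then show ?thesis using f g by (simp add: centred_primitive_def integral_diff algebra_simps)
  qed
  have fc: "continuous_on {0..T} (centred_primitive T f)" and gc: "continuous_on {0..T} (centred_primitive T g)"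
    using continuous_on_centred_primitive[OF T] f g by auto
  have "integral {0..T} (\<lambda>s. exp (c * s) * centred_primitive T (\<lambda>t. f t - g t) s) =
      integral {0..T} (\<lambda>s. exp (c * s) * centred_primitive T f s - exp (c * s) * centred_primitive T g s)"
    using H by (intro Henstock_Kurzweil_Integration.integral_cong) (simp add: right_diff_distrib)
  also have "\<dots> = integral {0..T} (\<lambda>s. exp (c * s) * centred_primitive T f s) -
      integral {0..T} (\<lambda>s. exp (c * s) * centred_primitive T g s)"
    by (rule integral_diff) (auto intro!: integrable_continuous_real continuous_intros fc gc)
  finally have \<kappa>: "periodic_constant T c (\<lambda>t. f t - g t) = periodic_constant T c f - periodic_constant T c g"
    by (simp add: periodic_constant_def diff_divide_distrib)
  have sub: "{0..t} \<subseteq> {0..T}" using t by auto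
  note fct = continuous_on_subset[OF fc sub] and gct = continuous_on_subset[OF gc sub]
  have "integral {0..t} (\<lambda>s. exp (c * s) * (centred_primitive T (\<lambda>t. f t - g t) s + periodic_constant T c (\<lambda>t. f t - g t))) =
      integral {0..t} (\<lambda>s. exp (c * s) * (centred_primitive T f s + periodic_constant T c f) -
                           exp (c * s) * (centred_primitive T g s + periodic_constant T c g))"
    using H t by (intro Henstock_Kurzweil_Integration.integral_cong)
      (simp add: right_diff_distrib distrib_left \<kappa>)
  also have "\<dots> = integral {0..t} (\<lambda>s. exp (c * s) * (centred_primitive T f s + periodic_constant T c f)) -
                  integral {0..t} (\<lambda>s. exp (c * s) * (centred_primitive T g s + periodic_constant T c g))"
    by (rule integral_diff) (auto intro!: integrable_continuous_real continuous_intros fct gct)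
  finally show ?thesis by (simp only: periodic_response_def right_diff_distrib)
qed

section \<open>The parametrised fixed point problem\<close>

text \<open>The projection of \<open>x\<close> onto the interval \<open>[a, b]\<close>.\<close>

definition truncate :: "real \<Rightarrow> real \<Rightarrow> real \<Rightarrow> real" where
  "truncate a b x = max a (min b x)"

lemma truncate_lipschitz: "\<bar>truncate a b x - truncate a b' y\<bar> \<le> \<bar>x - y\<bar> + \<bar>b - b'\<bar>"
  unfolding truncate_def by (auto simp: max_def min_def abs_if)

lemma truncate_mem: "a \<le> b \<Longrightarrow> truncate a b x \<in> {a..b}"
  by (simp add: truncate_def)

lemma continuous_on_truncate: "continuous_on S (truncate a b)"
  unfolding truncate_def[abs_def] by (intro continuous_intros)

lemma absolutely_integrable_truncated_product:
  fixes w g u :: "real \<Rightarrow> real"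
  assumes w: "w absolutely_integrable_on {0..T}" and g: "continuous_on {0..} g" and m: "m \<ge> 0"
    and u: "u \<in> borel_measurable borel"
  shows "(\<lambda>t. w t * g (truncate 0 m (u t))) absolutely_integrable_on {0..T}"
proof -
  have cg: "continuous_on UNIV (\<lambda>x. g (truncate 0 m x))"
    by (rule continuous_on_compose2[OF g continuous_on_truncate]) (use truncate_mem[OF m] in auto)
  have "(\<lambda>t. g (truncate 0 m (u t))) \<in> borel_measurable borel"
    using measurable_compose[OF u borel_measurable_continuous_onI[OF cg]] .
  then have "(\<lambda>t. g (truncate 0 m (u t))) \<in> borel_measurable lebesgue"
    by (simp add: measurable_completion)
  then have meas: "(\<lambda>t. g (truncate 0 m (u t))) \<in> borel_measurable (lebesgue_on {0..T})"
    by (rule measurable_restrict_space1)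
  have "bounded (g ` {0..m})"
    using continuous_on_subset[OF g] by (intro compact_imp_bounded compact_continuous_image) auto
  then have "bounded ((\<lambda>t. g (truncate 0 m (u t))) ` {0..T})"
    by (rule bounded_subset) (use truncate_mem[OF m] in auto)
  then have "(\<lambda>t. g (truncate 0 m (u t)) * w t) absolutely_integrable_on {0..T}"
    by (intro absolutely_integrable_bounded_measurable_product_real[OF meas _ _ w]) auto
  then show ?thesis by (simp add: mult.commute)
qed

text \<open>The solution \<open>u\<close> produced here has \<open>u t0 = s\<close>. The last conclusion says that \<open>\<alpha> = 0\<close> unless \<open>s\<close> is an
end point of \<open>[a, b]\<close>, with \<open>\<sigma> * \<alpha> \<ge> 0\<close> at \<open>a\<close> and \<open>\<sigma> * \<alpha> \<le> 0\<close> at \<open>b\<close> when \<open>a < b\<close>. The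
truncation level \<open>K * s\<close> moves with the parameter.\<close>

lemma parameter_fixed_point:
  fixes w g :: "real \<Rightarrow> real"
  assumes T: "T > 0" and w: "w absolutely_integrable_on {0..T}" and g: "continuous_on {0..} g"
    and ab: "0 < a" "a \<le> b" and K: "K > 0" and t0: "t0 \<in> {0..T}"
  obtains s \<alpha> u v where "s \<in> {a..b}" "u t0 = s" "continuous_on UNIV u"
    "multiplier_solution T c (\<lambda>t. w t * g (truncate 0 (K * s) (u t))) \<alpha> u v"
    "\<And>t. t \<in> {0..T} \<Longrightarrow> \<bar>u t - s\<bar> \<le>
       2 * response_bound T c * integral {0..T} (\<lambda>t. \<bar>w t * g (truncate 0 (K * s) (u t))\<bar>)"
    "s = truncate a b (s - \<sigma> * \<alpha>)"
proof -
  define par where "par u = truncate a b (u t0)" for u :: "real \<Rightarrow> real"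
  define f where "f u t = w t * g (truncate 0 (K * par u) (u t))" for u t
  define al where "al u = - integral {0..T} (f u) / T" for u
  define \<Phi> where "\<Phi> u t = truncate a b (par u - \<sigma> * al u) + (periodic_response T c (f u) t - periodic_response T c (f u) t0)"
    for u t
  define W where "W = integral {0..T} (\<lambda>t. \<bar>w t\<bar>)"
  define C where "C = response_bound T c"
  have C: "C > 0" using T by (auto simp: C_def response_bound_def intro!: add_pos_nonneg)
  have wi: "(\<lambda>t. \<bar>w t\<bar>) integrable_on {0..T}" using w by (simp add: absolutely_integrable_on_def)
  have W0: "W \<ge> 0" unfolding W_def by (rule integral_nonneg[OF wi]) auto
  have par: "par u \<in> {a..b}" for u unfolding par_def by (rule truncate_mem[OF ab(2)])
  have Kpar: "0 \<le> K * par u" "K * par u \<le> K * b" for u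
    using par[of u] ab K by auto
  have arg: "truncate 0 (K * par u) x \<in> {0..K * b}" for u x
    using truncate_mem[OF Kpar(1), of u x] Kpar(2)[of u] by auto
  have gK: "continuous_on {0..K * b} g" using continuous_on_subset[OF g] by auto
  obtain G where G: "G > 0" "\<And>x. x \<in> {0..K * b} \<Longrightarrow> \<bar>g x\<bar> \<le> G"
  proof -
    have "bounded (g ` {0..K * b})" by (intro compact_imp_bounded compact_continuous_image gK) auto
    then show thesis using that by (auto simp: bounded_pos)
  qed
  have fa: "f u absolutely_integrable_on {0..T}" if "u \<in> borel_measurable borel" for u
    unfolding f_def by (rule absolutely_integrable_truncated_product[OF w g Kpar(1) that])
  have fi: "f u integrable_on {0..T}" if "u \<in> borel_measurable borel" for u
    using fa[OF that] by (simp add: absolutely_integrable_on_def)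
  have fN: "integral {0..T} (\<lambda>t. \<bar>f u t\<bar>) \<le> W * G" if "u \<in> borel_measurable borel" for u
  proof -
    have "integral {0..T} (\<lambda>t. \<bar>f u t\<bar>) \<le> integral {0..T} (\<lambda>t. \<bar>w t\<bar> * G)"
    proof (rule integral_le)
      show "(\<lambda>t. \<bar>f u t\<bar>) integrable_on {0..T}" using fa[OF that] by (simp add: absolutely_integrable_on_def)
      show "(\<lambda>t. \<bar>w t\<bar> * G) integrable_on {0..T}" by (rule integrable_on_mult_left[OF wi])
      show "\<bar>f u t\<bar> \<le> \<bar>w t\<bar> * G" for t
        unfolding f_def abs_mult by (intro mult_left_mono G arg) auto
    qed
    then show ?thesis by (simp add: W_def)
  qed
  have yb: "\<bar>periodic_response T c (f u) t\<bar> \<le> C * (W * G)" "\<bar>response_derivative T c (f u) t\<bar> \<le> C * (W * G)"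
    if "u \<in> borel_measurable borel" "t \<in> {0..T}" for u t
    using periodic_response_bounds[OF T fa[OF that(1)] that(2), of c] fN[OF that(1)] C
    by (auto simp: C_def intro: order_trans mult_left_mono)
  have aux: "multiplier_solution T c (f u) (al u) (\<lambda>t. k + periodic_response T c (f u) t) (response_derivative T c (f u))"
    if "u \<in> borel_measurable borel" for u k
    unfolding al_def by (rule multiplier_solution_periodic_response[OF T fi[OF that]])
  define L where "L = C * (W * G)"
  have L0: "L \<ge> 0" using C W0 G by (simp add: L_def)
  obtain u where u: "continuous_on UNIV u" "\<forall>t\<in>{0..T}. \<Phi> u t = u t"
  proof (rule schauder_lipschitz[of T "b + 2 * L" \<Phi> L])
    show "\<bar>\<Phi> u t\<bar> \<le> b + 2 * L" if "u \<in> borel_measurable borel" "t \<in> {0..T}" for u t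
    proof -
      have "truncate a b (par u - \<sigma> * al u) \<in> {a..b}" by (rule truncate_mem[OF ab(2)])
      then show ?thesis using yb(1)[OF that] yb(1)[OF that(1) t0] ab unfolding \<Phi>_def L_def by auto
    qed
    show "\<bar>\<Phi> u t - \<Phi> u t'\<bar> \<le> L * \<bar>t - t'\<bar>"
      if u: "u \<in> borel_measurable borel" and t: "t \<in> {0..T}" "t' \<in> {0..T}" for u t t'
    proof -
      have der: "(periodic_response T c (f u) has_real_derivative response_derivative T c (f u) s) (at s within {0..T})"
        if "s \<in> {0..T}" for s
        using aux[OF u, of 0] that by (simp add: multiplier_solution_def)
      have bd: "\<bar>response_derivative T c (f u) s\<bar> \<le> L" if "s \<in> {0..T}" for s
        using yb(2)[OF u that] by (simp add: L_def)
      have *: "\<bar>periodic_response T c (f u) q - periodic_response T c (f u) p\<bar> \<le> L * (q - p)"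
        if pq: "0 \<le> p" "p \<le> q" "q \<le> T" for p q
      proof -
        have "periodic_response T c (f u) q - periodic_response T c (f u) p \<le> L * (q - p)"
          by (rule derivative_le_imp_growth[OF der pq]) (use bd pq in \<open>auto simp: abs_le_iff\<close>)
        moreover have "periodic_response T c (f u) q - periodic_response T c (f u) p \<ge> - L * (q - p)"

        proof (rule derivative_ge_imp_growth[OF der pq])
          show "- L \<le> response_derivative T c (f u) r" if "p \<le> r" "r \<le> q" for r
            using bd[of r] pq that by (simp add: abs_le_iff)
        qed
        ultimately show ?thesis by (simp add: abs_le_iff)
      qed
      show ?thesis
        using *[of t t'] *[of t' t] t by (cases "t \<le> t'") (auto simp: \<Phi>_def abs_minus_commute)
    qed
    fix e :: real assume e: "e > 0"
    define Z where "Z = 2 * C * W + \<bar>\<sigma>\<bar> * W / T + 1"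
    have Z: "Z \<ge> 1" using C W0 T by (simp add: Z_def)
    define e' where "e' = e / (2 * Z)"
    have e': "e' > 0" using e Z by (simp add: e'_def)
    have "uniformly_continuous_on {0..K * b} g"
      by (rule compact_uniformly_continuous[OF gK]) simp
    then obtain d0 where d0: "d0 > 0"
      "\<And>x y. x \<in> {0..K * b} \<Longrightarrow> y \<in> {0..K * b} \<Longrightarrow> \<bar>x - y\<bar> < d0 \<Longrightarrow> \<bar>g x - g y\<bar> < e'"
      using e' unfolding uniformly_continuous_on_def dist_real_def by metis
    \<comment> \<open>Both \<open>u\<close> and the truncation level move by at most \<open>d\<close> and \<open>K * d\<close>.\<close>
    define d where "d = min (d0 / (2 * (1 + K))) (e / 2)"
    have d: "d > 0" using d0 e K by (simp add: d_def)
    have dd: "(1 + K) * d < d0"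
    proof -
      have "(1 + K) * d \<le> (1 + K) * (d0 / (2 * (1 + K)))" using K by (intro mult_left_mono) (auto simp: d_def)
      also have "\<dots> = d0 / 2" using K by (simp add: field_simps)
      finally show ?thesis using d0 by simp
    qed
    show "\<exists>d>0. \<forall>u v. u \<in> borel_measurable borel \<longrightarrow> (\<forall>t\<in>{0..T}. \<bar>u t\<bar> \<le> b + 2 * L) \<longrightarrow>
        v \<in> borel_measurable borel \<longrightarrow> (\<forall>t\<in>{0..T}. \<bar>v t\<bar> \<le> b + 2 * L) \<longrightarrow>
        (\<forall>t\<in>{0..T}. \<bar>u t - v t\<bar> \<le> d) \<longrightarrow> (\<forall>t\<in>{0..T}. \<bar>\<Phi> u t - \<Phi> v t\<bar> \<le> e)"
    proof (intro exI[of _ d] conjI d allI impI ballI)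
      fix u v :: "real \<Rightarrow> real" and t
      assume um: "u \<in> borel_measurable borel" and vm: "v \<in> borel_measurable borel"
        and uv: "\<forall>t\<in>{0..T}. \<bar>u t - v t\<bar> \<le> d" and t: "t \<in> {0..T}"
      have s: "\<bar>par u - par v\<bar> \<le> d"
        using truncate_lipschitz[of a b "u t0" b "v t0"] uv t0 unfolding par_def by fastforce
      have fd: "\<bar>f u r - f v r\<bar> \<le> \<bar>w r\<bar> * e'" if r: "r \<in> {0..T}" for r
      proof -
        have "\<bar>truncate 0 (K * par u) (u r) - truncate 0 (K * par v) (v r)\<bar> \<le> \<bar>u r - v r\<bar> + \<bar>K * par u - K * par v\<bar>"
          by (rule truncate_lipschitz)
        also have "\<bar>K * par u - K * par v\<bar> = K * \<bar>par u - par v\<bar>"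
          using K by (simp add: abs_mult flip: right_diff_distrib)
        also have "\<bar>u r - v r\<bar> + K * \<bar>par u - par v\<bar> \<le> d + K * d"
          using uv r s K by (intro add_mono mult_left_mono) auto
        also have "\<dots> < d0" using dd by (simp add: algebra_simps)
        finally have "\<bar>g (truncate 0 (K * par u) (u r)) - g (truncate 0 (K * par v) (v r))\<bar> < e'"
          by (intro d0 arg)
        then have "\<bar>w r\<bar> * \<bar>g (truncate 0 (K * par u) (u r)) - g (truncate 0 (K * par v) (v r))\<bar> \<le> \<bar>w r\<bar> * e'"
          by (intro mult_left_mono) auto
        then show ?thesis by (simp add: f_def abs_mult flip: right_diff_distrib)
      qed
      have di: "(\<lambda>r. f u r - f v r) absolutely_integrable_on {0..T}"
        by (intro set_integral_diff fa um vm)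
      have dN: "integral {0..T} (\<lambda>r. \<bar>f u r - f v r\<bar>) \<le> W * e'"
      proof -
        have "integral {0..T} (\<lambda>r. \<bar>f u r - f v r\<bar>) \<le> integral {0..T} (\<lambda>r. \<bar>w r\<bar> * e')"
          using di fd by (intro integral_le integrable_on_mult_left[OF wi]) (auto simp: absolutely_integrable_on_def)
        then show ?thesis by (simp add: W_def)
      qed
      have yd: "\<bar>periodic_response T c (f u) r - periodic_response T c (f v) r\<bar> \<le> C * (W * e')"
        if r: "r \<in> {0..T}" for r
        using periodic_response_bounds(1)[OF T di r, of c] mult_left_mono[OF dN less_imp_le[OF C]]
        unfolding periodic_response_diff[OF T fi[OF um] fi[OF vm] r] C_def by (rule order_trans)
      have ald: "\<bar>al u - al v\<bar> \<le> W * e' / T"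
      proof -
        have "al u - al v = - integral {0..T} (\<lambda>r. f u r - f v r) / T"
          by (simp add: al_def integral_diff[OF fi[OF um] fi[OF vm]] diff_divide_distrib)
        also have "\<bar>\<dots>\<bar> = \<bar>integral {0..T} (\<lambda>r. f u r - f v r)\<bar> / T" using T by simp
        also have "\<dots> \<le> integral {0..T} (\<lambda>r. \<bar>f u r - f v r\<bar>) / T"
          using di T by (intro divide_right_mono abs_integral_le_integral)
            (auto simp: absolutely_integrable_on_def)
        also have "\<dots> \<le> W * e' / T" using dN T by (intro divide_right_mono) auto
        finally show ?thesis .
      qed
      have "\<bar>truncate a b (par u - \<sigma> * al u) - truncate a b (par v - \<sigma> * al v)\<bar>
          \<le> \<bar>(par u - \<sigma> * al u) - (par v - \<sigma> * al v)\<bar>"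
        using truncate_lipschitz[of a b _ b] by (metis abs_0 add.right_neutral diff_self)
      also have "\<dots> \<le> \<bar>par u - par v\<bar> + \<bar>\<sigma> * (al u - al v)\<bar>"
        using abs_triangle_ineq4[of "par u - par v" "\<sigma> * (al u - al v)"] by (simp add: algebra_simps)
      also have "\<dots> \<le> e / 2 + \<bar>\<sigma>\<bar> * (W * e' / T)"
        unfolding abs_mult using s ald by (intro add_mono mult_left_mono) (auto simp: d_def)
      finally have "\<bar>\<Phi> u t - \<Phi> v t\<bar> \<le> e / 2 + \<bar>\<sigma>\<bar> * (W * e' / T) + 2 * (C * (W * e'))"
        using yd[OF t] yd[OF t0] unfolding \<Phi>_def by linarith
      also have "\<dots> \<le> e / 2 + Z * e'" using e' by (simp add: Z_def algebra_simps)
      also have "\<dots> = e" using Z by (simp add: e'_def)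
      finally show "\<bar>\<Phi> u t - \<Phi> v t\<bar> \<le> e" .
    qed
  qed (use T ab L0 in auto)
  have um: "u \<in> borel_measurable borel" using u(1) by (rule borel_measurable_continuous_onI)
  define s where "s = truncate a b (par u - \<sigma> * al u)"
  have ueq: "u t = s + (periodic_response T c (f u) t - periodic_response T c (f u) t0)" if "t \<in> {0..T}" for t
    using u(2) that by (simp add: \<Phi>_def s_def)
  have ut0: "u t0 = s" using ueq[OF t0] by simp
  have sab: "s \<in> {a..b}" unfolding s_def by (rule truncate_mem[OF ab(2)])
  have pars: "par u = s" using sab by (simp add: par_def ut0 truncate_def)
  have fu: "f u = (\<lambda>t. w t * g (truncate 0 (K * s) (u t)))" by (simp add: f_def[abs_def] pars)
  show thesis
  proof (rule that[of s u "al u" "response_derivative T c (f u)"])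
    have sol: "multiplier_solution T c (f u) (al u) (\<lambda>t. (s - periodic_response T c (f u) t0) + periodic_response T c (f u) t)
       (response_derivative T c (f u))" by (rule aux[OF um])
    have "(u has_real_derivative response_derivative T c (f u) t) (at t within {0..T})" if "t \<in> {0..T}" for t
    proof (rule has_field_derivative_transform_within[OF _ zero_less_one that])
      show "((\<lambda>t. (s - periodic_response T c (f u) t0) + periodic_response T c (f u) t) has_real_derivative
          response_derivative T c (f u) t) (at t within {0..T})"
        using sol that by (simp add: multiplier_solution_def)
    qed (simp add: ueq)
    then have "multiplier_solution T c (f u) (al u) u (response_derivative T c (f u))"
      using sol T unfolding multiplier_solution_def by (simp add: ueq)
    then show "multiplier_solution T c (\<lambda>t. w t * g (truncate 0 (K * s) (u t))) (al u) u (response_derivative T c (f u))"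
      by (simp add: fu)
    show "s = truncate a b (s - \<sigma> * al u)" using s_def pars by simp
    show "\<bar>u t - s\<bar> \<le> 2 * response_bound T c * integral {0..T} (\<lambda>t. \<bar>w t * g (truncate 0 (K * s) (u t))\<bar>)"
      if "t \<in> {0..T}" for t
      using periodic_response_bounds(1)[OF T fa[OF um] that, of c] periodic_response_bounds(1)[OF T fa[OF um] t0, of c]
        ueq[OF that] by (simp add: fu)
  qed (fact sab ut0 u(1))+
qed

section \<open>Consequences of regular oscillation and sublinearity\<close>

text \<open>The joint limit that defines regular oscillation, with the quotient cleared. The case \<open>\<omega> = 1\<close>, which
the punctured filter leaves out, is trivial.\<close>

lemma regularly_oscillating_eventually:
  fixes g :: "real \<Rightarrow> real" and F :: "real filter"
  assumes lim: "((\<lambda>(s, w). g (w * s) / g s) \<longlongrightarrow> 1) (F \<times>\<^sub>F at 1)" and e: "e > 0"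
    and pos: "\<forall>\<^sub>F s in F. g s > 0"
  obtains \<eta> where "0 < \<eta>" "\<eta> < 1"
    "\<forall>\<^sub>F s in F. \<forall>\<omega>. \<bar>\<omega> - 1\<bar> \<le> \<eta> \<longrightarrow> \<bar>g (\<omega> * s) - g s\<bar> \<le> e * g s"
proof -
  have "\<forall>\<^sub>F x in F \<times>\<^sub>F at 1. dist (case x of (s, w) \<Rightarrow> g (w * s) / g s) 1 < e"
    using lim e by (rule tendstoD)
  then obtain Pf Pg where P: "eventually Pf F" "eventually Pg (at (1::real))"
    "\<And>s w. Pf s \<Longrightarrow> Pg w \<Longrightarrow> \<bar>g (w * s) / g s - 1\<bar> < e"
    by (auto simp: eventually_prod_filter dist_real_def)
  then obtain d where d: "d > 0" "\<And>w. w \<noteq> 1 \<Longrightarrow> dist w 1 < d \<Longrightarrow> Pg w"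
    by (auto simp: eventually_at)
  define \<eta> where "\<eta> = min (d / 2) (1 / 2)"
  have "\<forall>\<^sub>F s in F. \<forall>\<omega>. \<bar>\<omega> - 1\<bar> \<le> \<eta> \<longrightarrow> \<bar>g (\<omega> * s) - g s\<bar> \<le> e * g s"
    using P(1) pos
  proof eventually_elim
    case (elim s)
    show ?case
    proof (intro allI impI)
      fix \<omega> :: real assume \<omega>: "\<bar>\<omega> - 1\<bar> \<le> \<eta>"
      show "\<bar>g (\<omega> * s) - g s\<bar> \<le> e * g s"
      proof (cases "\<omega> = 1")
        case True
        then show ?thesis using e elim by simp
      next
        case False
        then have "Pg \<omega>" using d \<omega> by (auto simp: dist_real_def \<eta>_def)
        then have "\<bar>g (\<omega> * s) / g s - 1\<bar> * g s \<le> e * g s"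
          using P(3)[of s \<omega>] elim by (intro mult_right_mono) auto
        moreover have "\<bar>g (\<omega> * s) / g s - 1\<bar> * g s = \<bar>(g (\<omega> * s) / g s - 1) * g s\<bar>"
          using elim by (simp add: abs_mult)
        ultimately show ?thesis using elim by (simp add: left_diff_distrib)
      qed
    qed
  qed
  then show thesis using that[of \<eta>] d by (simp add: \<eta>_def)
qed

lemma sublinear_at_zero:
  fixes g :: "real \<Rightarrow> real"
  assumes lim: "((\<lambda>s. g s / s) \<longlongrightarrow> 0) (at_right 0)" and g0: "g 0 = 0" and k: "k > 0" and K: "K > 0"
  shows "\<forall>\<^sub>F s in at_right 0. \<forall>x\<in>{0..K * s}. g x \<le> k * s"
proof -
  have "\<forall>\<^sub>F x in at_right 0. g x / x < k / K" using lim k K by (intro order_tendstoD(2)) auto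
  then obtain d where d: "d > 0" "\<And>x. 0 < x \<Longrightarrow> x < d \<Longrightarrow> g x / x < k / K"
    by (auto simp: eventually_at_right_field)
  have "\<forall>x\<in>{0..K * s}. g x \<le> k * s" if s: "0 < s" "s < d / K" for s
  proof
    fix x assume x: "x \<in> {0..K * s}"
    show "g x \<le> k * s"
    proof (cases "x = 0")
      case True then show ?thesis using g0 k s by simp
    next
      case False
      have "K * s < d" using s K by (simp add: pos_less_divide_eq mult.commute)
      then have "g x / x < k / K" using x False by (intro d) auto
      then have "g x \<le> k / K * x" using x False by (simp add: pos_divide_less_eq)
      also have "\<dots> \<le> k / K * (K * s)" using x k K by (intro mult_left_mono) auto
      finally show ?thesis using K by simp
    qed
  qed
  then show ?thesis using d K unfolding eventually_at_right_field by (intro exI[of _ "d / K"]) auto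
qed

lemma sublinear_at_top:
  fixes g :: "real \<Rightarrow> real"
  assumes lim: "((\<lambda>s. g s / s) \<longlongrightarrow> 0) at_top" and cont: "continuous_on {0..} g" and k: "k > 0" and K: "K > 0"
  shows "\<forall>\<^sub>F s in at_top. \<forall>x\<in>{0..K * s}. g x \<le> k * s"
proof -
  have "\<forall>\<^sub>F x in at_top. g x / x < k / K" using lim k K by (intro order_tendstoD(2)) auto
  then obtain R where R: "\<And>x. x \<ge> R \<Longrightarrow> g x / x < k / K" by (auto simp: eventually_at_top_linorder)
  define R' where "R' = max R 1"
  have "bounded (g ` {0..R'})"
    using continuous_on_subset[OF cont] by (intro compact_imp_bounded compact_continuous_image) auto
  then obtain M where M: "M > 0" "\<And>x. x \<in> {0..R'} \<Longrightarrow> \<bar>g x\<bar> \<le> M" by (auto simp: bounded_pos)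
  have "\<forall>x\<in>{0..K * s}. g x \<le> k * s" if s: "s \<ge> M / k" for s
  proof
    fix x assume x: "x \<in> {0..K * s}"
    have ks: "M \<le> k * s" using s k by (simp add: pos_divide_le_eq mult.commute)
    show "g x \<le> k * s"
    proof (cases "x \<le> R'")
      case True then show ?thesis using M(2)[of x] x ks by simp
    next
      case False
      then have "x > 0" "g x / x < k / K" using R by (auto simp: R'_def)
      then have "g x \<le> k / K * x" by (simp add: pos_divide_less_eq)
      also have "\<dots> \<le> k / K * (K * s)" using x k K by (intro mult_left_mono) auto
      finally show ?thesis using K by simp
    qed
  qed
  then show ?thesis unfolding eventually_at_top_linorder by blast
qed

lemma linear_bound:
  fixes g :: "real \<Rightarrow> real"
  assumes lim0: "((\<lambda>s. g s / s) \<longlongrightarrow> 0) (at_right 0)" and lim: "((\<lambda>s. g s / s) \<longlongrightarrow> 0) at_top"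
    and cont: "continuous_on {0..} g" and g0: "g 0 = 0"
  obtains K where "K > 0" "\<And>x. x \<ge> 0 \<Longrightarrow> g x \<le> K * x"
proof -
  have "\<forall>\<^sub>F x in at_right 0. g x / x < 1" using lim0 by (intro order_tendstoD(2)) auto
  then obtain d where d: "d > 0" "\<And>x. 0 < x \<Longrightarrow> x < d \<Longrightarrow> g x / x < 1"
    by (auto simp: eventually_at_right_field)
  have "\<forall>\<^sub>F x in at_top. g x / x < 1" using lim by (intro order_tendstoD(2)) auto
  then obtain R where R: "\<And>x. x \<ge> R \<Longrightarrow> g x / x < 1" by (auto simp: eventually_at_top_linorder)
  have "bounded (g ` {0..max R 1})"
    using continuous_on_subset[OF cont] by (intro compact_imp_bounded compact_continuous_image) auto
  then obtain M where M: "M > 0" "\<And>x. x \<in> {0..max R 1} \<Longrightarrow> \<bar>g x\<bar> \<le> M" by (auto simp: bounded_pos)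
  have "g x \<le> (1 + M / d) * x" if x: "x \<ge> 0" for x
  proof -
    have Md: "M / d * x \<ge> 0" using M d x by simp
    consider "x = 0" | "0 < x" "x < d" | "x \<ge> d" "x \<le> max R 1" | "x > max R 1" using x by linarith
    then show ?thesis
    proof cases
      case 1 then show ?thesis using g0 by simp
    next
      case 2
      then have "g x \<le> x" using d(2)[of x] by (simp add: pos_divide_less_eq)
      then show ?thesis using Md by (simp add: algebra_simps)
    next
      case 3
      have "M = M / d * d" using d by simp
      also have "\<dots> \<le> M / d * x" using 3 M d by (intro mult_left_mono) auto
      finally show ?thesis using M(2)[of x] 3 x by (simp add: algebra_simps)
    next
      case 4
      then have "g x \<le> x" using R[of x] by (simp add: pos_divide_less_eq)
      then show ?thesis using Md by (simp add: algebra_simps)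
    qed
  qed
  moreover have "1 + M / d > 0" using M d by (simp add: add_pos_pos)
  ultimately show thesis using that by blast
qed

section \<open>A priori estimates for the indefinite weight\<close>

text \<open>A compact subinterval \<open>[J0, J1]\<close> of the interior of \<open>I\<close> carries a positive amount of \<open>P\<close>; it cuts
off a third of the integral on each side. The interval \<open>[A, B]\<close> is the closure of \<open>I\<close>.\<close>

lemma interval_core:
  fixes P N :: "real \<Rightarrow> real" and I :: "real set"
  assumes P: "P absolutely_integrable_on {0..T}" and N: "N absolutely_integrable_on {0..T}"
    and N0: "\<And>t. N t \<ge> 0" and I: "is_interval I" "I \<subseteq> {0..T}"
    and NI: "(LINT t:I|lebesgue. N t) = 0" and PI: "0 < (LINT t:I|lebesgue. P t)"
  obtains A B J0 J1 where "0 \<le> A" "A < J0" "J0 \<le> J1" "J1 < B" "B \<le> T" "integral {J0..J1} P > 0"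
    "\<forall>p q. A \<le> p \<longrightarrow> p \<le> q \<longrightarrow> q \<le> B \<longrightarrow> integral {p..q} N = 0"
proof -
  have ne: "I \<noteq> {}" using PI by (auto simp: set_lebesgue_integral_def)
  define A B where "A = Inf I" and "B = Sup I"
  have bb: "bdd_below I" "bdd_above I"
    using I(2) by (meson bdd_below_mono bdd_below_Icc, meson bdd_above_mono bdd_above_Icc)
  have AB: "I \<subseteq> {A..B}" using bb by (auto simp: A_def B_def intro: cInf_lower cSup_upper)
  have A0: "0 \<le> A" unfolding A_def using I(2) ne by (intro cInf_greatest) auto
  have BT: "B \<le> T" unfolding B_def using I(2) ne by (intro cSup_least) auto
  have sub: "{A<..<B} \<subseteq> I"
  proof
    fix x assume x: "x \<in> {A<..<B}"
    obtain y where y: "y \<in> I" "y < x" using x ne bb cInf_less_iff[of I x] by (auto simp: A_def)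
    obtain z where z: "z \<in> I" "x < z" using x ne bb less_cSup_iff[of I x] by (auto simp: B_def)
    show "x \<in> I" using mem_is_interval_1_I[OF I(1) y(1) z(1)] y z by simp
  qed
  have "I = {A<..<B} \<union> (I \<inter> {A, B})" using sub AB by force
  then have Imeas: "I \<in> sets lebesgue"
    by (metis finite.emptyI finite_insert finite_Int finite_imp_null_set_lborel lmeasurable_open
        fmeasurableD bounded_box box_real(1) open_greaterThanLessThan sets.Un null_sets_completionI null_setsD2)
  have conv: "(LINT t:I|lebesgue. f t) = integral {A..B} f" if f: "f absolutely_integrable_on {0..T}" for f :: "real \<Rightarrow> real"
  proof -
    have "f absolutely_integrable_on I" by (rule set_integrable_subset[OF f Imeas I(2)])
    then have "(LINT t:I|lebesgue. f t) = integral I f" by (rule set_lebesgue_integral_eq_integral(2))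
    also have "\<dots> = integral {A..B} f"
    proof (rule integral_spike_set)
      have "finite {A, B}" by simp
      then have fin: "negligible {A, B}" by (rule negligible_finite)
      show "negligible {x \<in> I - {A..B}. f x \<noteq> 0}" using AB by (intro negligible_subset[OF negligible_empty]) auto
      show "negligible {x \<in> {A..B} - I. f x \<noteq> 0}" using sub by (intro negligible_subset[OF fin]) force
    qed
    finally show ?thesis .
  qed
  have Ntot: "integral {A..B} N = 0" and Ptot: "integral {A..B} P > 0" using conv N P NI PI by auto
  have subT: "{A..B} \<subseteq> {0..T}" using A0 BT by auto
  have Ni: "N integrable_on {A..B}" "P integrable_on {A..B}"
    using N P integrable_on_subinterval[OF _ subT] by (auto simp: absolutely_integrable_on_def)
  have AltB: "A < B" using Ptot by (cases "A < B"; cases "A = B") auto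
  have Nz: "integral {p..q} N = 0" if "A \<le> p" "p \<le> q" "q \<le> B" for p q
  proof -
    have s: "{p..q} \<subseteq> {A..B}" using that by auto
    have "integral {p..q} N \<le> integral {A..B} N"
      by (rule integral_subset_le[OF s integrable_on_subinterval[OF Ni(1) s] Ni(1)]) (use N0 in auto)
    moreover have "integral {p..q} N \<ge> 0"
      by (rule integral_nonneg[OF integrable_on_subinterval[OF Ni(1) s]]) (use N0 in auto)
    ultimately show ?thesis using Ntot by simp
  qed
  define F where "F t = integral {A..t} P" for t
  have Fc: "continuous_on {A..B} F" unfolding F_def by (rule indefinite_integral_continuous_1[OF Ni(2)])
  have F0: "F A = 0" and FB: "F B > 0" using Ptot by (auto simp: F_def)
  have "\<exists>x\<ge>A. x \<le> B \<and> F x = F B / 3" using F0 FB AltB Fc by (intro IVT') auto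
  then obtain J0 where J0: "A \<le> J0" "J0 \<le> B" "F J0 = F B / 3" by blast
  have "continuous_on {J0..B} F" using continuous_on_subset[OF Fc] J0 by auto
  then have "\<exists>x\<ge>J0. x \<le> B \<and> F x = 2 * F B / 3" using J0 FB by (intro IVT') auto
  then obtain J1 where J1: "J0 \<le> J1" "J1 \<le> B" "F J1 = 2 * F B / 3" by blast
  have "integral {A..J0} P + integral {J0..J1} P = integral {A..J1} P"
    using J0 J1 integrable_on_subinterval[OF Ni(2), of A J1]
    by (intro Henstock_Kurzweil_Integration.integral_combine) auto
  then have Jpos: "integral {J0..J1} P > 0" using J0(3) J1(3) FB by (simp add: F_def)
  have "J0 \<noteq> A" "J1 \<noteq> B" using J0(3) J1(3) F0 FB by auto
  with J0 J1 have "A < J0" "J1 < B" by auto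
  then show thesis using that[of A J0 J1 B] A0 BT J1(1) Jpos Nz by blast
qed

text \<open>The weight \<open>lam * P - \<mu> * N\<close>, where the nonnegative function \<open>N\<close> vanishes almost everywhere on
\<open>[A, B]\<close>; this is expressed by its integrals over subintervals. The base point
\<open>t\<^sub>0\<close> is \<open>J0\<close>.\<close>

locale indefinite_problem =
  fixes T c lam \<mu> :: real and g P N :: "real \<Rightarrow> real" and A B J0 J1 :: real
  assumes T: "T > 0" and g_cont: "continuous_on {0..} g" and g0: "g 0 = 0" and g_pos: "\<And>s. s > 0 \<Longrightarrow> g s > 0"
    and P_int: "P absolutely_integrable_on {0..T}" and N_int: "N absolutely_integrable_on {0..T}"
    and P_nonneg: "\<And>t. P t \<ge> 0" and N_nonneg: "\<And>t. N t \<ge> 0"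
    and ABJ: "0 \<le> A" "A < J0" "J0 \<le> J1" "J1 < B" "B \<le> T"
    and N_zero: "\<And>p q. A \<le> p \<Longrightarrow> p \<le> q \<Longrightarrow> q \<le> B \<Longrightarrow> integral {p..q} N = 0"
    and lam: "lam > 0" and mu: "\<mu> > 0"
begin

definition weight :: "real \<Rightarrow> real" where
  "weight t = lam * P t - \<mu> * N t"

text \<open>The constant of \<open>log_derivative_bound\<close> for the subinterval \<open>[J0, J1]\<close> of \<open>[A, B]\<close>.\<close>

definition log_bound :: real where
  "log_bound = exp (\<bar>c\<bar> * T) / min (J0 - A) (B - J1)"

text \<open>The function \<open>w g(u)\<close> with \<open>u\<close> truncated to \<open>[0, m]\<close>.\<close>

definition nonlinearity :: "real \<Rightarrow> (real \<Rightarrow> real) \<Rightarrow> real \<Rightarrow> real" where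
  "nonlinearity m u t = weight t * g (truncate 0 m (u t))"

lemma weight_int: "weight absolutely_integrable_on {0..T}"
  unfolding weight_def[abs_def] by (intro set_integral_diff set_integrable_mult_right P_int N_int)

lemma log_bound_pos: "log_bound > 0"
  using ABJ by (simp add: log_bound_def)

lemma J0_mem: "J0 \<in> {0..T}"
  using ABJ by simp

lemma g_nonneg: "x \<ge> 0 \<Longrightarrow> g x \<ge> 0"
  using g0 g_pos[of x] by (cases "x = 0") auto

lemma truncated_g_bounds:
  assumes "m \<ge> 0"
  obtains G where "G > 0" "\<And>x. g (truncate 0 m x) \<ge> 0" "\<And>x. g (truncate 0 m x) \<le> G"
proof -
  have "bounded (g ` {0..m})"
    using continuous_on_subset[OF g_cont] by (intro compact_imp_bounded compact_continuous_image) auto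
  then obtain G where "G > 0" "\<And>x. x \<in> {0..m} \<Longrightarrow> \<bar>g x\<bar> \<le> G" by (auto simp: bounded_pos)
  then show thesis using that[of G] truncate_mem[OF assms] g_nonneg by fastforce
qed

text \<open>What \<open>parameter_fixed_point\<close> yields: a periodic solution with multiplier \<open>\<alpha>\<close> for the nonlinearity
truncated at \<open>K * u J0\<close>, close to the constant \<open>u J0\<close> when the nonlinearity is small.\<close>

definition truncated_solution :: "real \<Rightarrow> real \<Rightarrow> (real \<Rightarrow> real) \<Rightarrow> (real \<Rightarrow> real) \<Rightarrow> bool" where
  "truncated_solution K \<alpha> u v \<longleftrightarrow>
     continuous_on UNIV u \<and> multiplier_solution T c (nonlinearity (K * u J0) u) \<alpha> u v \<and>
     (\<forall>t\<in>{0..T}. \<bar>u t - u J0\<bar> \<le>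
        2 * response_bound T c * integral {0..T} (\<lambda>t. \<bar>nonlinearity (K * u J0) u t\<bar>))"

lemma product_int:
  assumes u: "continuous_on UNIV u" and m: "m \<ge> 0" and f: "f absolutely_integrable_on {0..T}"
    and pq: "0 \<le> p" "q \<le> T"
  shows "(\<lambda>t. f t * g (truncate 0 m (u t))) integrable_on {p..q}"
proof -
  have "(\<lambda>t. f t * g (truncate 0 m (u t))) integrable_on {0..T}"
    using absolutely_integrable_truncated_product[OF f g_cont m borel_measurable_continuous_onI[OF u]]
    by (simp add: absolutely_integrable_on_def)
  then show ?thesis by (rule integrable_on_subinterval) (use pq in auto)
qed

text \<open>Since \<open>g\<close> is bounded on the truncation interval, the product with \<open>N\<close> has integral zero wherever \<open>N\<close>
has.\<close>

lemma integral_nonlinearity_core: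
  assumes u: "continuous_on UNIV u" and m: "m \<ge> 0" and pq: "A \<le> p" "p \<le> q" "q \<le> B"
  shows "integral {p..q} (nonlinearity m u) = lam * integral {p..q} (\<lambda>t. P t * g (truncate 0 m (u t)))"
proof -
  let ?h = "\<lambda>t. g (truncate 0 m (u t))"
  have pT: "0 \<le> p" "q \<le> T" using pq ABJ by auto
  note Pi = product_int[OF u m P_int pT] and Ni = product_int[OF u m N_int pT]
  obtain G where G: "G > 0" "\<And>x. g (truncate 0 m x) \<ge> 0" "\<And>x. g (truncate 0 m x) \<le> G"
    using truncated_g_bounds[OF m] by blast
  have Nint: "N integrable_on {p..q}"
    using N_int pT integrable_on_subinterval[of N "{0..T}" p q] by (auto simp: absolutely_integrable_on_def)
  have "integral {p..q} (\<lambda>t. N t * ?h t) \<le> integral {p..q} (\<lambda>t. N t * G)"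
    using G N_nonneg by (intro integral_le Ni integrable_on_mult_left[OF Nint] mult_left_mono) auto
  also have "\<dots> = 0" using N_zero[OF pq] by simp
  finally have "integral {p..q} (\<lambda>t. N t * ?h t) \<le> 0" .
  moreover have "integral {p..q} (\<lambda>t. N t * ?h t) \<ge> 0"
    using G N_nonneg by (intro integral_nonneg Ni) auto
  ultimately have z: "integral {p..q} (\<lambda>t. N t * ?h t) = 0" by simp
  have "integral {p..q} (nonlinearity m u) = integral {p..q} (\<lambda>t. lam * (P t * ?h t) - \<mu> * (N t * ?h t))"
    by (intro Henstock_Kurzweil_Integration.integral_cong) (simp add: nonlinearity_def weight_def algebra_simps)
  also have "\<dots> = lam * integral {p..q} (\<lambda>t. P t * ?h t) - \<mu> * integral {p..q} (\<lambda>t. N t * ?h t)"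
    using Pi Ni by (simp add: integral_diff integrable_on_mult_right)
  finally show ?thesis using z by simp
qed

lemma nonneg_and_log_bound:
  assumes u: "continuous_on UNIV u" and m: "m \<ge> 0" and sol: "multiplier_solution T c (nonlinearity m u) \<alpha> u v"
    and \<alpha>: "\<alpha> \<ge> 0" and s: "u J0 > 0"
  shows "\<And>t. t \<in> {0..T} \<Longrightarrow> u t \<ge> 0" and "\<And>t. t \<in> {J0..J1} \<Longrightarrow> \<bar>v t\<bar> \<le> log_bound * u t"
proof -
  show nn: "u t \<ge> 0" if "t \<in> {0..T}" for t
  proof (rule multiplier_solution_nonneg[OF T sol \<alpha> J0_mem s _ that])
    show "nonlinearity m u t = 0" if "u t \<le> 0" for t
      using that m by (simp add: nonlinearity_def truncate_def g0)
  qed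
  have der: "(u has_real_derivative v t) (at t within {A..B})" if "t \<in> {A..B}" for t
    by (rule DERIV_subset[OF multiplier_solution_derivative[OF sol]]) (use that ABJ in auto)
  have W: "v q + c * u q \<le> v p + c * u p" if "A \<le> p" "p \<le> q" "q \<le> B" for p q
  proof -
    have pT: "0 \<le> p" "q \<le> T" using that ABJ by auto
    have "integral {p..q} (\<lambda>t. P t * g (truncate 0 m (u t))) \<ge> 0"
      using g_nonneg truncate_mem[OF m] P_nonneg by (intro integral_nonneg product_int[OF u m P_int pT]) auto
    then have "integral {p..q} (nonlinearity m u) \<ge> 0"
      using lam by (simp add: integral_nonlinearity_core[OF u m that])
    moreover have "v q - v p = - c * (u q - u p) - integral {p..q} (nonlinearity m u) - \<alpha> * (q - p)"
      using sol that ABJ by (simp add: multiplier_solution_def)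
    moreover have "\<alpha> * (q - p) \<ge> 0" using \<alpha> that by simp
    ultimately show ?thesis by (simp add: algebra_simps)
  qed
  show "\<bar>v t\<bar> \<le> log_bound * u t" if "t \<in> {J0..J1}" for t
    unfolding log_bound_def
  proof (rule log_derivative_bound[OF der exp_mult_derivative_antimono[OF der W]])
    show "0 \<le> u t" if "t \<in> {A..B}" for t using nn[of t] that ABJ by simp
    show "A + min (J0 - A) (B - J1) \<le> t" "t \<le> B - min (J0 - A) (B - J1)"
      using that by (auto simp: min_def)
  qed (use ABJ in auto)
qed

text \<open>If \<open>\<alpha> \<ge> 0\<close>, then Harnack's inequality keeps \<open>u\<close> between two positive constants on \<open>[J0, J1]\<close>,
where \<open>g(u) \<ge> \<gamma>\<close>; integrating the equation over \<open>[J0, J1]\<close> contradicts the size of \<open>lam\<close>. The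
hypotheses on \<open>\<gamma>\<close> and \<open>lam\<close> do not involve \<open>\<mu>\<close>.\<close>

lemma multiplier_negative:
  assumes tr: "truncated_solution K \<alpha> u v" and s: "u J0 = 1" and K: "K \<ge> exp (log_bound * T)"
    and \<gamma>: "\<And>x. x \<in> {exp (- (log_bound * T))..exp (log_bound * T)} \<Longrightarrow> g x \<ge> \<gamma>"
    and large: "2 * (log_bound + \<bar>c\<bar>) * exp (log_bound * T) < lam * (\<gamma> * integral {J0..J1} P)"
  shows "\<alpha> < 0"
proof (rule ccontr)
  assume "\<not> \<alpha> < 0"
  then have \<alpha>: "\<alpha> \<ge> 0" by simp
  define m where "m = K * u J0"
  have m: "m \<ge> exp (log_bound * T)" using K s by (simp add: m_def)
  have u: "continuous_on UNIV u" and sol: "multiplier_solution T c (nonlinearity m u) \<alpha> u v"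
    using tr by (simp_all add: truncated_solution_def m_def)
  have m0: "m \<ge> 0" using m exp_ge_zero[of "log_bound * T"] by linarith
  note nl = nonneg_and_log_bound[OF u m0 sol \<alpha>, unfolded s, OF zero_less_one]
  let ?D = log_bound
  have der: "(u has_real_derivative v t) (at t within {J0..J1})" if "t \<in> {J0..J1}" for t
    by (rule DERIV_subset[OF multiplier_solution_derivative[OF sol]]) (use that ABJ in auto)
  have range: "u t \<in> {exp (- (?D * T))..exp (?D * T)}" if t: "t \<in> {J0..J1}" for t
  proof -
    have h: "u t \<le> exp (?D * (t - J0)) * u J0" "u J0 \<le> exp (?D * (t - J0)) * u t"
      using harnack_of_log_derivative_bound[OF der nl(2), of J0 t] t by auto
    have "?D * (t - J0) \<le> ?D * T" using t ABJ log_bound_pos by (intro mult_left_mono) auto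
    then have e: "exp (?D * (t - J0)) \<le> exp (?D * T)" by simp
    have "u t \<ge> 0" using nl(1)[of t] t ABJ by simp
    then have "exp (?D * (t - J0)) * u t \<le> exp (?D * T) * u t" using e by (intro mult_right_mono)
    then have "1 \<le> exp (?D * T) * u t" using h s by simp
    then have "exp (- (?D * T)) * 1 \<le> exp (- (?D * T)) * (exp (?D * T) * u t)" by (intro mult_left_mono) auto
    then have "exp (- (?D * T)) \<le> u t" by (simp add: mult.assoc[symmetric] flip: exp_add)
    moreover have "u t \<le> exp (?D * T)" using order_trans[OF _ e, of "u t"] h(1) s by simp
    ultimately show ?thesis by simp
  qed
  have hg: "g (truncate 0 m (u t)) \<ge> \<gamma>" if "t \<in> {J0..J1}" for t
  proof -
    have "truncate 0 m (u t) = u t"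
      using range[OF that] m nl(1)[of t] that ABJ by (simp add: truncate_def max_def min_def)
    then show ?thesis using \<gamma>[OF range[OF that]] by simp
  qed
  have JT: "0 \<le> J0" "J1 \<le> T" using ABJ by auto
  have Pint: "P integrable_on {J0..J1}"
    using P_int JT integrable_on_subinterval[of P "{0..T}" J0 J1] by (auto simp: absolutely_integrable_on_def)
  have "integral {J0..J1} (\<lambda>t. P t * \<gamma>) \<le> integral {J0..J1} (\<lambda>t. P t * g (truncate 0 m (u t)))"
    using hg P_nonneg by (intro integral_le integrable_on_mult_left[OF Pint] product_int[OF u m0 P_int JT] mult_left_mono) auto
  then have lower: "lam * (\<gamma> * integral {J0..J1} P) \<le> lam * integral {J0..J1} (\<lambda>t. P t * g (truncate 0 m (u t)))"
    using lam by (intro mult_left_mono) (auto simp: mult.commute)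
  have eq: "v J1 - v J0 = - c * (u J1 - u J0) - lam * integral {J0..J1} (\<lambda>t. P t * g (truncate 0 m (u t))) - \<alpha> * (J1 - J0)"
    using sol ABJ integral_nonlinearity_core[OF u m0, of J0 J1] by (simp add: multiplier_solution_def)
  have "\<alpha> * (J1 - J0) \<ge> 0" using \<alpha> ABJ by simp
  moreover have "\<bar>v t\<bar> \<le> ?D * exp (?D * T)" if "t \<in> {J0..J1}" for t
  proof -
    have "?D * u t \<le> ?D * exp (?D * T)" using range[OF that] log_bound_pos by (intro mult_left_mono) auto
    then show ?thesis using nl(2)[OF that] by linarith
  qed
  then have "\<bar>v J0\<bar> \<le> ?D * exp (?D * T)" "\<bar>v J1\<bar> \<le> ?D * exp (?D * T)" using ABJ by auto
  moreover have "\<bar>c * (u J1 - u J0)\<bar> \<le> \<bar>c\<bar> * (2 * exp (?D * T))"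
  proof -
    have "u J0 \<ge> 0" "u J1 \<ge> 0" using nl(1) ABJ by auto
    moreover have "u J0 \<le> exp (?D * T)" "u J1 \<le> exp (?D * T)" using range ABJ by auto
    ultimately show ?thesis unfolding abs_mult by (intro mult_left_mono) auto
  qed
  ultimately have "lam * integral {J0..J1} (\<lambda>t. P t * g (truncate 0 m (u t))) \<le> 2 * (?D + \<bar>c\<bar>) * exp (?D * T)"
    using eq by (simp add: algebra_simps abs_le_iff)
  then show False using lower large by linarith
qed

lemma a_priori_bounds:
  fixes k :: nat
  assumes tr: "truncated_solution K 0 u v" and s: "u J0 > 0" and K: "K \<ge> 0"
    and G: "G > 0" "\<And>x. x \<ge> 0 \<Longrightarrow> g x \<le> G * x"
    and k: "integral {0..T} (\<lambda>t. 1 + \<bar>c\<bar> + G * \<bar>weight t\<bar>) \<le> real (Suc k) / 2" and t: "t \<in> {0..T}"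
  shows "0 < u t" and "u t \<le> 2 ^ Suc k * (1 + log_bound) * u J0"
proof -
  define m where "m = K * u J0"
  have m: "m \<ge> 0" using K s by (simp add: m_def)
  have u: "continuous_on UNIV u" and sol: "multiplier_solution T c (nonlinearity m u) 0 u v"
    using tr by (simp_all add: truncated_solution_def m_def)
  note nl = nonneg_and_log_bound[OF u m sol order_refl s]
  have f: "\<bar>nonlinearity m u t\<bar> \<le> G * \<bar>weight t\<bar> * \<bar>u t\<bar>" if "t \<in> {0..T}" for t
  proof -
    have x: "truncate 0 m (u t) \<ge> 0" "truncate 0 m (u t) \<le> u t"
      using nl(1)[OF that] by (auto simp: truncate_def)
    have "g (truncate 0 m (u t)) \<le> G * u t"
      using G(2)[OF x(1)] mult_left_mono[OF x(2), of G] G(1) by linarith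
    then have "\<bar>weight t\<bar> * g (truncate 0 m (u t)) \<le> \<bar>weight t\<bar> * (G * \<bar>u t\<bar>)"
      using nl(1)[OF that] by (intro mult_left_mono) auto
    then show ?thesis using g_nonneg[OF x(1)] by (simp add: nonlinearity_def abs_mult mult_ac)
  qed
  have gron: "\<bar>u q\<bar> + \<bar>v q\<bar> \<le> 2 ^ Suc k * (\<bar>u p\<bar> + \<bar>v p\<bar>)" if "p \<in> {0..T}" "q \<in> {0..T}" for p q
    by (rule multiplier_solution_gronwall[OF sol weight_int less_imp_le[OF G(1)] f k that])
  show "0 < u t"
  proof (rule ccontr)
    assume "\<not> 0 < u t"
    then have ut: "u t = 0" using nl(1)[OF t] by simp
    have "v t = 0"
    proof (rule periodic_min_imp_zero_derivative[OF T multiplier_solution_derivative[OF sol] _ _ t])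
      show "u 0 = u T" "v 0 = v T" using sol by (auto simp: multiplier_solution_def)
      show "u t \<le> u s" if "s \<in> {0..T}" for s using nl(1)[OF that] ut by simp
    qed
    then show False using gron[OF t J0_mem] ut s by simp
  qed
  have "\<bar>v J0\<bar> \<le> log_bound * u J0" using nl(2) ABJ by simp
  then have "2 ^ Suc k * (\<bar>u J0\<bar> + \<bar>v J0\<bar>) \<le> 2 ^ Suc k * (u J0 + log_bound * u J0)"
    using s by (intro mult_left_mono add_mono) auto
  then show "u t \<le> 2 ^ Suc k * (1 + log_bound) * u J0"
    using gron[OF J0_mem t] by (simp add: algebra_simps)
qed

text \<open>When \<open>g\<close> is small relative to \<open>s\<close> on \<open>[0, K * s]\<close>, the solution is within \<open>\<eta> * s\<close> of \<open>s\<close>, the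
truncation is inactive, and \<open>g(u)\<close> differs from \<open>g s\<close> by at most \<open>\<epsilon> * g s\<close>. This applies both for \<open>s\<close>
near zero and for \<open>s\<close> near infinity.\<close>

lemma multiplier_positive:
  assumes tr: "truncated_solution K \<alpha> u v" and us0: "u J0 = s" and s: "s > 0" and K: "K \<ge> 2" and \<eta>: "0 < \<eta>" "\<eta> < 1"
    and osc: "\<And>\<omega>. \<bar>\<omega> - 1\<bar> \<le> \<eta> \<Longrightarrow> \<bar>g (\<omega> * s) - g s\<bar> \<le> \<epsilon> * g s"
    and small: "\<And>x. x \<in> {0..K * s} \<Longrightarrow> g x \<le> \<kappa> * s"
    and \<kappa>: "2 * response_bound T c * (\<kappa> * integral {0..T} (\<lambda>t. \<bar>weight t\<bar>)) \<le> \<eta>"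
    and neg: "(1 + \<epsilon>) * (lam * integral {0..T} P) < (1 - \<epsilon>) * (\<mu> * integral {0..T} N)"
  shows "\<alpha> > 0"
proof -
  have u: "continuous_on UNIV u" and sol: "multiplier_solution T c (nonlinearity (K * s) u) \<alpha> u v"
    and close: "\<And>t. t \<in> {0..T} \<Longrightarrow> \<bar>u t - s\<bar> \<le>
       2 * response_bound T c * integral {0..T} (\<lambda>t. \<bar>nonlinearity (K * s) u t\<bar>)"
    using tr us0 by (auto simp: truncated_solution_def)
  let ?h = "\<lambda>t. g (truncate 0 (K * s) (u t))"
  have m: "K * s \<ge> 0" using K s by simp
  have wi: "(\<lambda>t. \<bar>weight t\<bar>) integrable_on {0..T}" using weight_int by (simp add: absolutely_integrable_on_def)
  have na: "nonlinearity (K * s) u absolutely_integrable_on {0..T}"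
    unfolding nonlinearity_def
    by (rule absolutely_integrable_truncated_product[OF weight_int g_cont m borel_measurable_continuous_onI[OF u]])
  have rb: "response_bound T c \<ge> 0" using T by (simp add: response_bound_def)
  have "integral {0..T} (\<lambda>t. \<bar>nonlinearity (K * s) u t\<bar>) \<le> integral {0..T} (\<lambda>t. \<bar>weight t\<bar> * (\<kappa> * s))"
  proof (rule integral_le)
    show "\<bar>nonlinearity (K * s) u t\<bar> \<le> \<bar>weight t\<bar> * (\<kappa> * s)" for t
      unfolding nonlinearity_def abs_mult
      using small[OF truncate_mem[OF m]] g_nonneg truncate_mem[OF m] by (intro mult_left_mono) auto
  qed (use na integrable_on_mult_left[OF wi] in \<open>auto simp: absolutely_integrable_on_def\<close>)
  then have "2 * response_bound T c * integral {0..T} (\<lambda>t. \<bar>nonlinearity (K * s) u t\<bar>)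
      \<le> 2 * response_bound T c * (integral {0..T} (\<lambda>t. \<bar>weight t\<bar>) * (\<kappa> * s))"
    using rb by (intro mult_left_mono) auto
  also have "\<dots> = 2 * response_bound T c * (\<kappa> * integral {0..T} (\<lambda>t. \<bar>weight t\<bar>)) * s" by (simp add: mult_ac)
  also have "\<dots> \<le> \<eta> * s" using \<kappa> s by (intro mult_right_mono) auto
  finally have us: "\<bar>u t - s\<bar> \<le> \<eta> * s" if "t \<in> {0..T}" for t using close[OF that] by linarith
  have h: "\<bar>?h t - g s\<bar> \<le> \<epsilon> * g s" if t: "t \<in> {0..T}" for t
  proof -
    have es: "\<eta> * s < 1 * s" using \<eta> s by (intro mult_strict_right_mono) auto
    have Ks: "2 * s \<le> K * s" using K s by (intro mult_right_mono) auto
    have "u t > 0" "u t \<le> 2 * s" using us[OF t] es by (auto simp: abs_le_iff)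
    then have tr: "truncate 0 (K * s) (u t) = u t"
      using order_trans[OF _ Ks, of "u t"] by (simp add: truncate_def max_def min_def)
    have "u t / s - 1 = (u t - s) / s" using s by (simp add: diff_divide_distrib)
    then have "\<bar>u t / s - 1\<bar> = \<bar>u t - s\<bar> / s" using s by simp
    also have "\<dots> \<le> \<eta>" using us[OF t] s by (simp add: pos_divide_le_eq)
    finally have "\<bar>g (u t / s * s) - g s\<bar> \<le> \<epsilon> * g s" by (rule osc)
    then show ?thesis using s by (simp add: tr)
  qed
  have Pi: "P integrable_on {0..T}" and Ni: "N integrable_on {0..T}"
    using P_int N_int by (auto simp: absolutely_integrable_on_def)
  let ?b = "\<lambda>t. P t * (lam * ((1 + \<epsilon>) * g s)) - N t * (\<mu> * ((1 - \<epsilon>) * g s))"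
  have "integral {0..T} (nonlinearity (K * s) u) \<le> integral {0..T} ?b"
  proof (rule integral_le)
    show "nonlinearity (K * s) u integrable_on {0..T}" using na by (simp add: absolutely_integrable_on_def)
    show "?b integrable_on {0..T}" by (intro integrable_diff integrable_on_mult_left Pi Ni)
    fix t assume t: "t \<in> {0..T}"
    have "?h t \<le> (1 + \<epsilon>) * g s" "(1 - \<epsilon>) * g s \<le> ?h t" using h[OF t] by (auto simp: abs_le_iff algebra_simps)
    then have "(P t * lam) * ?h t \<le> (P t * lam) * ((1 + \<epsilon>) * g s)" "(N t * \<mu>) * ((1 - \<epsilon>) * g s) \<le> (N t * \<mu>) * ?h t"
      using P_nonneg N_nonneg lam mu by (auto intro!: mult_left_mono)
    moreover have "nonlinearity (K * s) u t = (P t * lam) * ?h t - (N t * \<mu>) * ?h t"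
      by (simp add: nonlinearity_def weight_def algebra_simps)
    moreover have "?b t = (P t * lam) * ((1 + \<epsilon>) * g s) - (N t * \<mu>) * ((1 - \<epsilon>) * g s)" by simp
    ultimately show "nonlinearity (K * s) u t \<le> ?b t" by linarith
  qed
  also have "\<dots> = ((1 + \<epsilon>) * (lam * integral {0..T} P) - (1 - \<epsilon>) * (\<mu> * integral {0..T} N)) * g s"
  proof -
    have "integral {0..T} ?b = integral {0..T} P * (lam * ((1 + \<epsilon>) * g s)) - integral {0..T} N * (\<mu> * ((1 - \<epsilon>) * g s))"
      using Pi Ni by (simp only: integral_diff integrable_on_mult_left integral_mult_left)
    then show ?thesis by (simp add: algebra_simps)
  qed
  also have "\<dots> < 0" using neg g_pos[OF s] by (intro mult_neg_pos) auto
  finally show ?thesis using multiplier_solution_mean[OF T sol] T by (simp add: divide_neg_pos)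
qed

text \<open>If the sign of the multiplier at \<open>a\<close> and \<open>b\<close> excludes fixed points at the end of the parameter
interval, there is a genuine positive periodic solution in between. The assumption \<open>inside\<close> makes the
truncation inactive when the multiplier vanishes.\<close>

lemma periodic_solution_between:
  assumes per: "\<And>t. weight (t + T) = weight t"
    and ab: "0 < a" "a < b" and K: "K > 0" and \<sigma>: "\<sigma> \<noteq> 0"
    and inside: "\<And>u v. truncated_solution K 0 u v \<Longrightarrow> u J0 > 0 \<Longrightarrow> \<forall>t\<in>{0..T}. 0 < u t \<and> u t \<le> K * u J0"
    and ends: "\<And>u v \<alpha>. truncated_solution K \<alpha> u v \<Longrightarrow>
        (u J0 = a \<longrightarrow> \<sigma> * \<alpha> < 0) \<and> (u J0 = b \<longrightarrow> \<sigma> * \<alpha> > 0)"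
  obtains U where "positive_periodic_solution T c weight g U" "U J0 \<in> {a<..<b}"
proof -
  obtain s \<alpha> u v where s: "s \<in> {a..b}" and us: "u J0 = s" and uc: "continuous_on UNIV u"
    and sol: "multiplier_solution T c (\<lambda>t. weight t * g (truncate 0 (K * s) (u t))) \<alpha> u v"
    and close: "\<And>t. t \<in> {0..T} \<Longrightarrow> \<bar>u t - s\<bar> \<le>
       2 * response_bound T c * integral {0..T} (\<lambda>t. \<bar>weight t * g (truncate 0 (K * s) (u t))\<bar>)"
    and fp: "s = truncate a b (s - \<sigma> * \<alpha>)"
    by (rule parameter_fixed_point[OF T weight_int g_cont ab(1) less_imp_le[OF ab(2)] K J0_mem, of c \<sigma>]) blast
  have nleq: "nonlinearity (K * u J0) u = (\<lambda>t. weight t * g (truncate 0 (K * s) (u t)))"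
    by (rule ext) (simp add: nonlinearity_def us)
  have tr: "truncated_solution K \<alpha> u v"
    using uc sol close by (simp add: truncated_solution_def nleq us nleq[unfolded us])
  have E: "(u J0 = a \<longrightarrow> \<sigma> * \<alpha> < 0) \<and> (u J0 = b \<longrightarrow> \<sigma> * \<alpha> > 0)" by (rule ends[OF tr])
  have sa: "s \<noteq> a"
  proof
    assume "s = a"
    then have "\<sigma> * \<alpha> < 0" using E us by simp
    then show False using fp \<open>s = a\<close> ab by (auto simp: truncate_def max_def min_def split: if_splits)
  qed
  have sb: "s \<noteq> b"
  proof
    assume "s = b"
    then have "\<sigma> * \<alpha> > 0" using E us by simp
    then show False using fp \<open>s = b\<close> ab by (auto simp: truncate_def max_def min_def split: if_splits)
  qed
  have "\<sigma> * \<alpha> = 0"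
    using fp sa sb s by (auto simp: truncate_def max_def min_def split: if_splits)
  then have a0: "\<alpha> = 0" using \<sigma> by simp
  have tr0: "truncated_solution K 0 u v" using tr a0 by simp
  then have sol0: "multiplier_solution T c (nonlinearity (K * u J0) u) 0 u v"
    by (simp add: truncated_solution_def)
  have s0: "u J0 > 0" using s us ab by simp
  have ub: "0 < u t" "u t \<le> K * s" if "t \<in> {0..T}" for t
    using inside[OF tr0 s0] that us by auto
  have nl: "nonlinearity (K * u J0) u t = weight t * g (u t)" if "t \<in> {0..T}" for t
    using ub[OF that] by (simp add: nleq truncate_def max_def min_def)
  have vc: "continuous_on {0..T} v" and per0: "u 0 = u T" "v 0 = v T"
    using sol0 by (auto simp: multiplier_solution_def)
  have "positive_periodic_solution T c weight g (periodic_extension T u)"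
  proof (rule positive_periodic_solution_of_cell[OF T per weight_int g_cont multiplier_solution_derivative[OF sol0] vc per0 ub(1)])
    fix p q assume pq: "0 \<le> p" "p \<le> q" "q \<le> T"
    have sub: "{p..q} \<subseteq> {0..T}" using pq by auto
    have "(v has_integral (u q - u p)) {p..q}"
    proof (rule fundamental_theorem_of_calculus)
      show "(u has_vector_derivative v t) (at t within {p..q})" if "t \<in> {p..q}" for t
        unfolding has_real_derivative_iff_has_vector_derivative[symmetric]
        by (rule DERIV_subset[OF multiplier_solution_derivative[OF sol0] sub]) (use that sub in auto)
    qed (use pq in auto)
    moreover have "(nonlinearity (K * u J0) u has_integral integral {p..q} (nonlinearity (K * u J0) u)) {p..q}"
      using sol0 sub by (intro integrable_integral) (auto simp: multiplier_solution_def intro: integrable_on_subinterval)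
    ultimately have "((\<lambda>t. - c * v t - nonlinearity (K * u J0) u t) has_integral
        - c * (u q - u p) - integral {p..q} (nonlinearity (K * u J0) u)) {p..q}"
      by (intro has_integral_diff has_integral_mult_right)
    moreover have "v q - v p = - c * (u q - u p) - integral {p..q} (nonlinearity (K * u J0) u)"
      using sol0 pq by (simp add: multiplier_solution_def)
    ultimately have "((\<lambda>t. - c * v t - nonlinearity (K * u J0) u t) has_integral (v q - v p)) {p..q}" by simp
    then show "((\<lambda>t. - c * v t - weight t * g (u t)) has_integral (v q - v p)) {p..q}"
      by (rule has_integral_eq[rotated]) (use nl sub in auto)
  qed auto
  moreover have "periodic_extension T u J0 \<in> {a<..<b}"
    using periodic_extension_base[OF T per0(1) J0_mem] us s sa sb by auto
  ultimately show thesis using that by blast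
qed

end

section \<open>Two positive periodic solutions\<close>

theorem corollary1p1:
  fixes T c :: real and g a :: "real \<Rightarrow> real" and I :: "real set"
  assumes "T > 0"
    and "continuous_on {0..} g"
    and "g 0 = 0"
    and "\<forall>s>0. g s > 0"
    and "regularly_oscillating_at_zero g"
    and "regularly_oscillating_at_infinity g"
    and "((\<lambda>s. g s / s) \<longlongrightarrow> 0) (at_right 0)"
    and "((\<lambda>s. g s / s) \<longlongrightarrow> 0) at_top"
    and "\<forall>t. a (t + T) = a t"
    and "set_integrable lebesgue {0..T} (pos_part a)"
    and "set_integrable lebesgue {0..T} (neg_part a)"
    and "(LINT t:{0..T}|lebesgue. neg_part a t) > 0"
    and "is_interval I"
    and "I \<subseteq> {0..T}"
    and "(LINT t:I|lebesgue. neg_part a t) = 0"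
    and "0 < (LINT t:I|lebesgue. pos_part a t)"
  shows "\<exists>lam0>0. \<forall>lam>lam0. \<forall>\<mu>.
           \<mu> > lam * ((LINT t:{0..T}|lebesgue. pos_part a t) / (LINT t:{0..T}|lebesgue. neg_part a t)) \<longrightarrow>
           (\<exists>u1 u2. u1 \<noteq> u2 \<and>
              positive_periodic_solution T c (\<lambda>t. lam * pos_part a t - \<mu> * neg_part a t) g u1 \<and>
              positive_periodic_solution T c (\<lambda>t. lam * pos_part a t - \<mu> * neg_part a t) g u2)"
proof -
  let ?P = "pos_part a" and ?N = "neg_part a"
  have nn: "?P t \<ge> 0" "?N t \<ge> 0" for t by (auto simp: pos_part_def neg_part_def abs_if)
  have per: "?P (t + T) = ?P t" "?N (t + T) = ?N t" for t
    using assms(9) by (simp_all add: pos_part_def neg_part_def)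
  have PN: "(LINT t:{0..T}|lebesgue. ?P t) = integral {0..T} ?P" "(LINT t:{0..T}|lebesgue. ?N t) = integral {0..T} ?N"
    using assms(10,11) by (auto intro: set_lebesgue_integral_eq_integral(2))
  have Npos: "integral {0..T} ?N > 0" using assms(12) PN by simp
  obtain A B J0 J1 where ABJ: "0 \<le> A" "A < J0" "J0 \<le> J1" "J1 < B" "B \<le> T" and Jpos: "integral {J0..J1} ?P > 0"
    and Nz: "\<forall>p q. A \<le> p \<longrightarrow> p \<le> q \<longrightarrow> q \<le> B \<longrightarrow> integral {p..q} ?N = 0"
    by (rule interval_core[OF assms(10,11) nn(2) assms(13-16)])
  have Ppos: "integral {0..T} ?P \<ge> 0"
    using assms(10) nn by (intro integral_nonneg) (auto simp: absolutely_integrable_on_def)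
  \<comment> \<open>The constants \<open>D\<close>, \<open>\<gamma>\<close> and hence \<open>lam0\<close> below depend only on \<open>c\<close>, \<open>T\<close>, \<open>g\<close> and the positive part
      of \<open>a\<close> on \<open>[A, B]\<close>, not on \<open>\<mu>\<close>.\<close>
  define D where "D = exp (\<bar>c\<bar> * T) / min (J0 - A) (B - J1)"
  have D: "D > 0" using ABJ by (simp add: D_def)
  obtain \<gamma> where \<gamma>: "\<gamma> > 0" "\<And>x. x \<in> {exp (- (D * T))..exp (D * T)} \<Longrightarrow> g x \<ge> \<gamma>"
  proof -
    have ne: "exp (- (D * T)) \<le> exp (D * T)" using D assms(1) by simp
    have "{exp (- (D * T))..exp (D * T)} \<subseteq> {0..}"
    proof
      fix x assume "x \<in> {exp (- (D * T))..exp (D * T)}"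
      then show "x \<in> {0..}" using exp_gt_zero[of "- (D * T)"] by (simp only: atLeastAtMost_iff atLeast_iff) linarith
    qed
    then have "continuous_on {exp (- (D * T))..exp (D * T)} g" by (rule continuous_on_subset[OF assms(2)])
    then obtain x where x: "x \<in> {exp (- (D * T))..exp (D * T)}" "\<And>y. y \<in> {exp (- (D * T))..exp (D * T)} \<Longrightarrow> g x \<le> g y"
      using continuous_attains_inf[of "{exp (- (D * T))..exp (D * T)}" g] ne by auto
    have "x > 0" using x(1) exp_gt_zero[of "- (D * T)"] by (simp only: atLeastAtMost_iff) linarith
    then show thesis using that[of "g x"] x assms(4) by blast
  qed
  define lam0 where "lam0 = 2 * (D + \<bar>c\<bar>) * exp (D * T) / (\<gamma> * integral {J0..J1} ?P)"
  have lam0: "lam0 > 0" using D \<gamma> Jpos by (simp add: lam0_def add_pos_nonneg)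
  obtain Kg where Kg: "Kg > 0" "\<And>x. x \<ge> 0 \<Longrightarrow> g x \<le> Kg * x"
    using linear_bound[OF assms(7,8,2,3)] by blast
  show ?thesis
  proof (intro exI[of _ lam0] conjI lam0 allI impI)
    fix lam \<mu> assume lam_gt: "lam0 < lam"
      and \<mu>: "lam * ((LINT t:{0..T}|lebesgue. ?P t) / (LINT t:{0..T}|lebesgue. ?N t)) < \<mu>"
    have lampos: "lam > 0" using lam_gt lam0 by simp
    have ratio: "lam * integral {0..T} ?P < \<mu> * integral {0..T} ?N"
      using \<mu> Npos by (simp add: PN field_simps)
    have "lam * integral {0..T} ?P \<ge> 0" using lampos Ppos by simp
    then have \<mu>pos: "\<mu> > 0" using ratio Npos by (smt (verit) mult_nonpos_nonneg)
    interpret indefinite_problem T c lam \<mu> g ?P ?N A B J0 J1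
      by unfold_locales (use assms(1-4,10,11) nn ABJ Nz lampos \<mu>pos in auto)
    have weq: "weight = (\<lambda>t. lam * ?P t - \<mu> * ?N t)" by (simp add: weight_def[abs_def])
    have wper: "weight (t + T) = weight t" for t by (simp add: weight_def per)
    have Deq: "log_bound = D" by (simp add: log_bound_def D_def)
    obtain k :: nat where k: "integral {0..T} (\<lambda>t. 1 + \<bar>c\<bar> + Kg * \<bar>weight t\<bar>) \<le> real (Suc k) / 2"
    proof -
      obtain k :: nat where "2 * integral {0..T} (\<lambda>t. 1 + \<bar>c\<bar> + Kg * \<bar>weight t\<bar>) \<le> real k"
        using real_arch_simple by blast
      then show thesis using that[of k] by simp
    qed
    \<comment> \<open>The truncation factor dominates the a priori bound, the Harnack constant, and \<open>2\<close>.\<close>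
    define K where "K = 2 + 2 ^ Suc k * (1 + D) + exp (D * T)"
    have pK: "2 ^ Suc k * (1 + D) \<ge> 0" using D by simp
    have K: "K \<ge> 2" "2 ^ Suc k * (1 + D) \<le> K" "exp (D * T) \<le> K"
      using pK exp_ge_zero[of "D * T"] unfolding K_def by linarith+
    have K0: "K > 0" using K(1) by simp
    have inside: "\<forall>t\<in>{0..T}. 0 < u t \<and> u t \<le> K * u J0"
      if tr: "truncated_solution K 0 u v" and s: "u J0 > 0" for u v
    proof
      fix t assume t: "t \<in> {0..T}"
      note ap = a_priori_bounds[OF tr s less_imp_le[OF K0] Kg k t, unfolded Deq]
      have "2 ^ Suc k * (1 + D) * u J0 \<le> K * u J0" using K(2) s by (intro mult_right_mono) auto
      then show "0 < u t \<and> u t \<le> K * u J0" using ap by linarith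
    qed
    have at1: "\<alpha> < 0" if tr: "truncated_solution K \<alpha> u v" and s: "u J0 = 1" for u v \<alpha>
    proof (rule multiplier_negative[OF tr s, where \<gamma> = \<gamma>, unfolded Deq])
      show "exp (D * T) \<le> K" by (rule K(3))
      show "\<gamma> \<le> g x" if "x \<in> {exp (- (D * T))..exp (D * T)}" for x by (rule \<gamma>(2)[OF that])
      have "\<gamma> * integral {J0..J1} ?P > 0" using \<gamma>(1) Jpos by simp
      then show "2 * (D + \<bar>c\<bar>) * exp (D * T) < lam * (\<gamma> * integral {J0..J1} ?P)"
        using lam_gt unfolding lam0_def by (simp only: pos_divide_less_eq)
    qed
    define a1 a2 where "a1 = lam * integral {0..T} ?P" and "a2 = \<mu> * integral {0..T} ?N"
    have a12: "0 \<le> a1" "a1 < a2" using lampos Ppos ratio by (auto simp: a1_def a2_def)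
    \<comment> \<open>The strict inequality between the two means leaves room for a relative error \<open>\<epsilon>\<close> in \<open>g\<close>.\<close>
    define \<epsilon> where "\<epsilon> = (a2 - a1) / 2 / (a1 + a2)"
    have \<epsilon>: "\<epsilon> > 0" using a12 by (simp add: \<epsilon>_def)
    have "a1 + a2 \<noteq> 0" using a12 by simp
    from nonzero_eq_divide_eq[OF this, THEN iffD1, OF \<epsilon>_def]
    have "\<epsilon> * (a1 + a2) = (a2 - a1) / 2" .
    then have neg: "(1 + \<epsilon>) * a1 < (1 - \<epsilon>) * a2" using a12 by (simp add: algebra_simps)
    define Q where "Q = 2 * response_bound T c * integral {0..T} (\<lambda>t. \<bar>weight t\<bar>) + 1"
    have Q: "Q > 0"
    proof -
      have "integral {0..T} (\<lambda>t. \<bar>weight t\<bar>) \<ge> 0"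
        using weight_int by (intro integral_nonneg) (auto simp: absolutely_integrable_on_def)
      moreover have "response_bound T c \<ge> 0" using T by (simp add: response_bound_def)
      ultimately show ?thesis by (simp add: Q_def add_nonneg_pos)
    qed
    have good: "\<forall>u v \<alpha>. truncated_solution K \<alpha> u v \<longrightarrow> u J0 = s \<longrightarrow> \<alpha> > 0"
      if s: "s > 0" and \<eta>: "0 < \<eta>" "\<eta> < 1"
        and osc: "\<forall>\<omega>. \<bar>\<omega> - 1\<bar> \<le> \<eta> \<longrightarrow> \<bar>g (\<omega> * s) - g s\<bar> \<le> \<epsilon> * g s"
        and small: "\<forall>x\<in>{0..K * s}. g x \<le> \<eta> / Q * s" for s \<eta>
    proof (intro allI impI)
      fix u v \<alpha> assume tr: "truncated_solution K \<alpha> u v" and us: "u J0 = s"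
      show "\<alpha> > 0"
      proof (rule multiplier_positive[OF tr us s K(1) \<eta>, where \<epsilon> = \<epsilon> and \<kappa> = "\<eta> / Q"])
        have "2 * response_bound T c * (\<eta> / Q * integral {0..T} (\<lambda>t. \<bar>weight t\<bar>)) = \<eta> / Q * (Q - 1)"
          by (simp add: Q_def)
        also have "\<dots> \<le> \<eta> / Q * Q" using \<eta> Q by (intro mult_left_mono) auto
        finally show "2 * response_bound T c * (\<eta> / Q * integral {0..T} (\<lambda>t. \<bar>weight t\<bar>)) \<le> \<eta>" using Q by simp
      qed (use osc small neg in \<open>auto simp: a1_def a2_def\<close>)
    qed
    obtain s0 where s0: "0 < s0" "s0 < 1" and good0: "\<forall>u v \<alpha>. truncated_solution K \<alpha> u v \<longrightarrow> u J0 = s0 \<longrightarrow> \<alpha> > 0"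
    proof -
      have lim: "((\<lambda>(s, w). g (w * s) / g s) \<longlongrightarrow> 1) (at_right 0 \<times>\<^sub>F at 1)"
        using assms(5) by (simp add: regularly_oscillating_at_zero_def)
      have pos: "\<forall>\<^sub>F s in at_right 0. g s > 0"
        unfolding eventually_at_right_field using g_pos by (intro exI[of _ 1]) auto
      obtain \<eta> where \<eta>: "0 < \<eta>" "\<eta> < 1"
        and osc: "\<forall>\<^sub>F s in at_right 0. \<forall>\<omega>. \<bar>\<omega> - 1\<bar> \<le> \<eta> \<longrightarrow> \<bar>g (\<omega> * s) - g s\<bar> \<le> \<epsilon> * g s"
        using regularly_oscillating_eventually[OF lim \<epsilon> pos] by blast
      have "\<eta> / Q > 0" using \<eta> Q by simp
      note sm = sublinear_at_zero[OF assms(7,3) this K0]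
      have "\<forall>\<^sub>F s in at_right 0. 0 < s \<and> s < (1::real)"
        unfolding eventually_at_right_field by (intro exI[of _ 1]) auto
      then have "\<forall>\<^sub>F s in at_right 0. (0 < s \<and> s < 1) \<and> (\<forall>\<omega>. \<bar>\<omega> - 1\<bar> \<le> \<eta> \<longrightarrow> \<bar>g (\<omega> * s) - g s\<bar> \<le> \<epsilon> * g s)
          \<and> (\<forall>x\<in>{0..K * s}. g x \<le> \<eta> / Q * s)"
        using osc sm by eventually_elim blast
      then obtain s where "0 < s" "s < 1" "\<forall>\<omega>. \<bar>\<omega> - 1\<bar> \<le> \<eta> \<longrightarrow> \<bar>g (\<omega> * s) - g s\<bar> \<le> \<epsilon> * g s"
          "\<forall>x\<in>{0..K * s}. g x \<le> \<eta> / Q * s"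
        using eventually_happens'[OF trivial_limit_at_right_real] by blast
      then show thesis by (intro that[of s] good[of s \<eta>] \<eta>)
    qed
    obtain R where R: "1 < R" and goodR: "\<forall>u v \<alpha>. truncated_solution K \<alpha> u v \<longrightarrow> u J0 = R \<longrightarrow> \<alpha> > 0"
    proof -
      have lim: "((\<lambda>(s, w). g (w * s) / g s) \<longlongrightarrow> 1) (at_top \<times>\<^sub>F at 1)"
        using assms(6) by (simp add: regularly_oscillating_at_infinity_def)
      have pos: "\<forall>\<^sub>F s in at_top. g s > 0"
        using eventually_gt_at_top[of 0] by eventually_elim (rule g_pos)
      obtain \<eta> where \<eta>: "0 < \<eta>" "\<eta> < 1"
        and osc: "\<forall>\<^sub>F s in at_top. \<forall>\<omega>. \<bar>\<omega> - 1\<bar> \<le> \<eta> \<longrightarrow> \<bar>g (\<omega> * s) - g s\<bar> \<le> \<epsilon> * g s"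
        using regularly_oscillating_eventually[OF lim \<epsilon> pos] by blast
      have "\<eta> / Q > 0" using \<eta> Q by simp
      note sm = sublinear_at_top[OF assms(8,2) this K0]
      have "\<forall>\<^sub>F s in at_top. 1 < s \<and> (\<forall>\<omega>. \<bar>\<omega> - 1\<bar> \<le> \<eta> \<longrightarrow> \<bar>g (\<omega> * s) - g s\<bar> \<le> \<epsilon> * g s)
          \<and> (\<forall>x\<in>{0..K * s}. g x \<le> \<eta> / Q * s)"
        using eventually_gt_at_top[of "1::real"] osc sm by eventually_elim blast
      then obtain s where "1 < s" "\<forall>\<omega>. \<bar>\<omega> - 1\<bar> \<le> \<eta> \<longrightarrow> \<bar>g (\<omega> * s) - g s\<bar> \<le> \<epsilon> * g s"
          "\<forall>x\<in>{0..K * s}. g x \<le> \<eta> / Q * s"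
        using eventually_happens'[OF trivial_limit_at_top_linorder] by blast
      then show thesis by (intro that[of s] good[of s \<eta>] \<eta>) linarith+
    qed
    \<comment> \<open>On \<open>[s0, 1]\<close> the multiplier is positive at the left end and negative at the right end; on
      \<open>[1, R]\<close> the signs are reversed. This determines \<open>\<sigma>\<close> in each case.\<close>
    obtain U1 where U1: "positive_periodic_solution T c weight g U1" "U1 J0 \<in> {s0<..<1}"
    proof (rule periodic_solution_between[OF wper s0 K0 _ inside, of "- 1"])
      show "(u J0 = s0 \<longrightarrow> - 1 * \<alpha> < 0) \<and> (u J0 = 1 \<longrightarrow> - 1 * \<alpha> > 0)"
        if "truncated_solution K \<alpha> u v" for u v \<alpha>
        using that good0 at1 by auto
    qed (use that in auto)
    obtain U2 where U2: "positive_periodic_solution T c weight g U2" "U2 J0 \<in> {1<..<R}"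
    proof (rule periodic_solution_between[OF wper zero_less_one R K0 _ inside, of 1])
      show "(u J0 = 1 \<longrightarrow> 1 * \<alpha> < 0) \<and> (u J0 = R \<longrightarrow> 1 * \<alpha> > 0)"
        if "truncated_solution K \<alpha> u v" for u v \<alpha>
        using that goodR at1 by auto
    qed (use that in auto)
    have "U1 \<noteq> U2" using U1(2) U2(2) by auto
    then show "\<exists>u1 u2. u1 \<noteq> u2 \<and>
        positive_periodic_solution T c (\<lambda>t. lam * ?P t - \<mu> * ?N t) g u1 \<and>
        positive_periodic_solution T c (\<lambda>t. lam * ?P t - \<mu> * ?N t) g u2"
      using U1(1) U2(1) unfolding weq by blast
  qed
qed

end
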